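(* Let $R$ be a hyperbolic Bessel process of index $\alpha=0$ starting from $x=0$. Then for every $t>0$, on $[1,\infty)$, $$\mathbb{P}(\cosh R_t\in dz)=-\frac14\,G'_{t/4}\Bigl(\frac{z-1}{4}\Bigr)\,dz,$$ where $$G_t(y)=e^{-t/2}\,\mathbb{E}\exp\Bigl(B_t+\frac{1}{2t}\bigl(B_t^2-\varphi_y^2(B_t)\bigr)\Bigr),$$ $B$ is a standard Brownian motion, $G_t'$ is the derivative of $G_t$ in $y$, and $$\varphi_y(z)=\ln\Bigl(ye^{-z}+\cosh(z)+\sqrt{y^2e^{-2z}+\sinh^2(z)+2ye^{-z}\cosh(z)}\Bigr).$$
   Context: A hyperbolic Bessel process of index $0$ starting from $0$ is the nonnegative diffusion $R$ satisfying $R_t=B_t+\frac12\int_0^t\coth R_u\,du$, where $B$ is a standard Brownian motion. In the claim $G_t(y)$ is considered for $y\ge0$. *)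

theory Defs
  imports "HOL-Probability.Probability"
begin

text \<open>
  Processes are functions \<open>X :: real \<Rightarrow> 'a \<Rightarrow> real\<close>; only times \<open>t \<ge> 0\<close> matter.  A filtration is
  formally indexed by all reals, its members at negative times being irrelevant (one may take them
  equal to the one at time 0).
\<close>

definition filtered_prob_space :: "'a measure \<Rightarrow> (real \<Rightarrow> 'a measure) \<Rightarrow> bool" where
  "filtered_prob_space M F \<longleftrightarrow>
     prob_space M \<and> filtration (space M) F \<and> (\<forall>t. subalgebra M (F t))"

definition adapted :: "(real \<Rightarrow> 'a measure) \<Rightarrow> (real \<Rightarrow> 'a \<Rightarrow> real) \<Rightarrow> bool" where
  "adapted F X \<longleftrightarrow> (\<forall>t\<ge>0. X t \<in> borel_measurable (F t))"

definition natural_filtration :: "'a measure \<Rightarrow> (real \<Rightarrow> 'a \<Rightarrow> real) \<Rightarrow> real \<Rightarrow> 'a measure" where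
  "natural_filtration M X t =
     sigma (space M) {X u -` A \<inter> space M | u A. 0 \<le> u \<and> u \<le> t \<and> A \<in> sets borel}"

definition brownian_motion_wrt ::
  "'a measure \<Rightarrow> (real \<Rightarrow> 'a measure) \<Rightarrow> (real \<Rightarrow> 'a \<Rightarrow> real) \<Rightarrow> bool" where
  "brownian_motion_wrt M F B \<longleftrightarrow>
     filtered_prob_space M F \<and>
     adapted F B \<and>
     (AE \<omega> in M. B 0 \<omega> = 0 \<and> continuous_on {0..} (\<lambda>t. B t \<omega>)) \<and>
     (\<forall>s t. 0 \<le> s \<and> s < t \<longrightarrow>
        distributed M lborel (\<lambda>\<omega>. B t \<omega> - B s \<omega>) (\<lambda>x. ennreal (normal_density 0 (sqrt (t - s)) x)) \<and>
        prob_space.indep_set M (sets (F s))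
          (sets (vimage_algebra (space M) (\<lambda>\<omega>. B t \<omega> - B s \<omega>) borel)))"

definition standard_brownian_motion :: "'a measure \<Rightarrow> (real \<Rightarrow> 'a \<Rightarrow> real) \<Rightarrow> bool" where
  "standard_brownian_motion M B \<longleftrightarrow> brownian_motion_wrt M (natural_filtration M B) B"

definition coth :: "real \<Rightarrow> ennreal" where
  "coth x = (if x > 0 then ennreal (cosh x / sinh x) else \<infinity>)"

text \<open>
  The process of index 0 started at 0.  The drift is an integral of a \<open>[0, \<infinity>]\<close>-valued function with
  \<open>coth 0 = \<infinity>\<close>; its finiteness is part of what it means to solve the equation (in particular, the
  solution spends Lebesgue-null time at 0).  The starting point \<open>R 0 = 0\<close> is the equation at time 0.
\<close>

definition hyperbolic_bessel_0 ::
  "'a measure \<Rightarrow> (real \<Rightarrow> 'a measure) \<Rightarrow> (real \<Rightarrow> 'a \<Rightarrow> real) \<Rightarrow> (real \<Rightarrow> 'a \<Rightarrow> real) \<Rightarrow> bool" where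
  "hyperbolic_bessel_0 M F B R \<longleftrightarrow>
     brownian_motion_wrt M F B \<and>
     adapted F R \<and>
     (AE \<omega> in M. continuous_on {0..} (\<lambda>t. R t \<omega>) \<and>
        (\<forall>t\<ge>0. R t \<omega> \<ge> 0 \<and>
           (\<integral>\<^sup>+u\<in>{0..t}. coth (R u \<omega>) \<partial>lborel) < \<infinity> \<and>
           R t \<omega> = B t \<omega> + 1 / 2 * enn2real (\<integral>\<^sup>+u\<in>{0..t}. coth (R u \<omega>) \<partial>lborel)))"

definition phi :: "real \<Rightarrow> real \<Rightarrow> real" where
  "phi y z = ln (y * exp (- z) + cosh z
     + sqrt (y\<^sup>2 * exp (- 2 * z) + (sinh z)\<^sup>2 + 2 * y * exp (- z) * cosh z))"

definition G_integrand :: "(real \<Rightarrow> 'a \<Rightarrow> real) \<Rightarrow> real \<Rightarrow> real \<Rightarrow> 'a \<Rightarrow> real" where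
  "G_integrand B t y \<omega> = exp (B t \<omega> + 1 / (2 * t) * ((B t \<omega>)\<^sup>2 - (phi y (B t \<omega>))\<^sup>2))"

definition G :: "'a measure \<Rightarrow> (real \<Rightarrow> 'a \<Rightarrow> real) \<Rightarrow> real \<Rightarrow> real \<Rightarrow> real" where
  "G M B t y = exp (- t / 2) * (\<integral>\<omega>. G_integrand B t y \<omega> \<partial>M)"

text \<open>
  The derivative in \<open>y\<close> on the domain \<open>y \<ge> 0\<close>, hence one-sided at \<open>y = 0\<close>.
\<close>

definition G_deriv :: "'a measure \<Rightarrow> (real \<Rightarrow> 'a \<Rightarrow> real) \<Rightarrow> real \<Rightarrow> real \<Rightarrow> real" where
  "G_deriv M B t y = vector_derivative (G M B t) (at y within {0..})"

end

theory Submission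
  imports Defs
begin

text \<open>
  A hyperbolic Bessel process of index 0 is the distance from the origin of a Brownian motion of the
  hyperbolic plane, and its law is found by projecting along horocycles. Seen from a point at
  distance \<open>r\<close> and angle \<open>\<theta>\<close>, the Busemann function of a boundary point is
  \<open>S = ln (cosh r + sinh r cos \<theta>)\<close>. If \<open>F\<close> is the average of \<open>q S\<close> over \<open>\<theta>\<close>, then
  \<open>F'' + coth F'\<close> is the average of \<open>(q'' + q') S\<close>. For \<open>q s = exp (- s / 2) cos (l s)\<close>, and likewise
  with the sine, \<open>q'' + q' = - (1/4 + l\<^sup>2) q\<close>, so the average is an eigenfunction of the generator of
  \<open>R\<close>: a spherical function (\<open>circle_mean_by_parts\<close>, \<open>spherical_function\<close>). Hence
  \<open>E F (R t) = F 0 exp (- (1/8 + l\<^sup>2/2) t)\<close> (\<open>expectation_circle_mean\<close>). As \<open>l\<close> is arbitrary, uniqueness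
  of characteristic functions shows that for an independent uniform angle the law of \<open>S (R t, \<theta>)\<close>,
  weighted by \<open>exp (- S / 2)\<close>, is \<open>exp (- t / 8)\<close> times the centred normal law of variance \<open>t\<close>
  (\<open>busemann_law\<close>).

  The passage from \<open>R\<close> to \<open>S\<close> is an Abel transform, and it is inverted by integrating against
  \<open>sqrt 2 sinh s / sqrt (cosh s - cosh a)\<close> over \<open>s > a\<close>: the average over the angle then becomes the
  indicator of \<open>r > a\<close> (\<open>abel_inversion\<close>). This gives the tail of \<open>R t\<close> as a one-dimensional Gaussian
  integral (\<open>tail_probability\<close>). On the other side, \<open>phi y x = arcosh (y exp (- x) + cosh x)\<close>; with
  \<open>y = (cosh a - 1) / 4\<close> and \<open>c = cosh (a / 2)\<close> the shift \<open>x = u + ln c\<close> makes the argument equal to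
  \<open>c cosh u\<close>, and the substitution \<open>cosh (s / 2) = c cosh u\<close> identifies the tail with
  \<open>G\<close> at time \<open>t / 4\<close> and point \<open>y\<close> (\<open>tail_eq_G\<close>). Differentiating \<open>G\<close> under the integral sign
  (\<open>DERIV_G\<close>) turns the tail of \<open>cosh (R t)\<close> into its density.

  The stochastic equation enters only through the identity
  \<open>E f (R T) - f 0 = \<integral> E (f'' + coth f') (R s) / 2 ds\<close> for smooth bounded \<open>f\<close> (\<open>expectation_ito\<close>). It
  is obtained by discretisation. Over one step of a grid, \<open>f (R)\<close> changes first by the Brownian
  increment and then by the drift. The first change has as conditional mean the effect of Gaussian
  smoothing, which is \<open>f'' / 2\<close> times the step to leading order; the sum of the second changes converges
  along every path (\<open>drift_sum_tendsto\<close>). The centred first changes are orthogonal, hence their sum is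
  bounded in \<open>L\<^sup>2\<close> (\<open>noise_sum_L2\<close>); as \<open>f\<close> is bounded, the drift sum is bounded in \<open>L\<^sup>2\<close> as well,
  and its limit can be taken under the expectation.
\<close>

section \<open>Spherical functions as averages of horocyclic waves\<close>

text \<open>
  The Busemann function of the hyperbolic plane in geodesic polar coordinates, normalised to vanish
  at the origin.
\<close>

definition busemann :: "real \<Rightarrow> real \<Rightarrow> real" where
  "busemann r \<theta> = ln (cosh r + sinh r * cos \<theta>)"

definition busemann_slope :: "real \<Rightarrow> real \<Rightarrow> real" where
  "busemann_slope r \<theta> = (sinh r + cosh r * cos \<theta>) / (cosh r + sinh r * cos \<theta>)"

text \<open>
  The real and imaginary parts of \<open>exp ((- 1/2 + \<i> l) s)\<close>, combined linearly: a space that is closed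
  under differentiation in \<open>s\<close>.
\<close>

definition wave :: "real \<Rightarrow> real \<Rightarrow> real \<Rightarrow> real \<Rightarrow> real" where
  "wave a b l s = exp (- s / 2) * (a * cos (l * s) + b * sin (l * s))"

text \<open>
  Since the radial derivative \<open>V\<close> of the Busemann function satisfies \<open>V' = 1 - V\<^sup>2\<close>, the averages with
  weights \<open>V ^ k\<close> contain all radial derivatives of the average of a wave. The average is not divided
  by the length \<open>pi\<close> of the interval.
\<close>

definition circle_mean :: "nat \<Rightarrow> real \<Rightarrow> real \<Rightarrow> real \<Rightarrow> real \<Rightarrow> real" where
  "circle_mean k a b l r =
     integral {0..pi} (\<lambda>\<theta>. wave a b l (busemann r \<theta>) * busemann_slope r \<theta> ^ k)"

lemma cosh_plus_sinh_cos_pos: "cosh r + sinh r * cos \<theta> > (0::real)"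
proof -
  have "\<bar>sinh r * cos \<theta>\<bar> \<le> \<bar>sinh r\<bar>"
    by (simp add: abs_mult mult_left_le)
  also have "\<bar>sinh r\<bar> < cosh r"
    using sinh_less_cosh_real[of r] sinh_less_cosh_real[of "-r"] by (auto simp: abs_if)
  finally show ?thesis by linarith
qed

lemma cosh_plus_sinh_cos_nz [simp]: "cosh r + sinh r * cos \<theta> \<noteq> (0::real)"
  using cosh_plus_sinh_cos_pos[of r \<theta>] by linarith

lemma exp_busemann: "exp (busemann r \<theta>) = cosh r + sinh r * cos \<theta>"
  unfolding busemann_def using cosh_plus_sinh_cos_pos by simp

lemma one_minus_slope_sq:
  "1 - (busemann_slope r \<theta>)\<^sup>2 = (sin \<theta>)\<^sup>2 / (cosh r + sinh r * cos \<theta>)\<^sup>2"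
proof -
  have "(cosh r + sinh r * cos \<theta>)\<^sup>2 - (sinh r + cosh r * cos \<theta>)\<^sup>2
      = ((cosh r)\<^sup>2 - (sinh r)\<^sup>2) * (1 - (cos \<theta>)\<^sup>2)"
    by (simp add: power2_eq_square algebra_simps)
  also have "\<dots> = (sin \<theta>)\<^sup>2"
    using sin_squared_eq[of \<theta>] by (simp add: cosh_square_eq)
  finally have "1 - (busemann_slope r \<theta>)\<^sup>2 = (sin \<theta>)\<^sup>2 / (cosh r + sinh r * cos \<theta>)\<^sup>2"
    by (simp add: busemann_slope_def power_divide diff_divide_eq_iff)
  then show ?thesis .
qed

lemma abs_slope_le_1: "\<bar>busemann_slope r \<theta>\<bar> \<le> 1"
proof -
  have "(busemann_slope r \<theta>)\<^sup>2 \<le> 1"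
    using one_minus_slope_sq[of r \<theta>] by (smt (verit) divide_nonneg_nonneg zero_le_power2)
  then show ?thesis by (simp add: abs_square_le_1)
qed

lemma DERIV_busemann:
  "((\<lambda>r. busemann r \<theta>) has_real_derivative busemann_slope r \<theta>) (at r within A)"
  unfolding busemann_def busemann_slope_def
  using cosh_plus_sinh_cos_pos[of r \<theta>]
  by (auto intro!: derivative_eq_intros simp: field_simps)

lemma DERIV_busemann_slope:
  "((\<lambda>r. busemann_slope r \<theta>) has_real_derivative 1 - (busemann_slope r \<theta>)\<^sup>2) (at r within A)"
proof -
  let ?N = "sinh r + cosh r * cos \<theta>" and ?D = "cosh r + sinh r * cos \<theta>"
  have "((\<lambda>r. busemann_slope r \<theta>) has_real_derivative (?D * ?D - ?N * ?N) / (?D * ?D)) (at r within A)"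
    unfolding busemann_slope_def
    by (rule DERIV_divide; (rule cosh_plus_sinh_cos_nz)?)
       (auto intro!: derivative_eq_intros simp: algebra_simps)
  also have "(?D * ?D - ?N * ?N) / (?D * ?D) = 1 - (busemann_slope r \<theta>)\<^sup>2"
    using cosh_plus_sinh_cos_nz[of r \<theta>]
    by (simp add: busemann_slope_def power_divide diff_divide_distrib power2_eq_square)
  finally show ?thesis .
qed

lemma DERIV_busemann_angle:
  "((\<lambda>\<theta>. busemann r \<theta>) has_real_derivative - sinh r * sin \<theta> / (cosh r + sinh r * cos \<theta>)) (at \<theta> within A)"
  unfolding busemann_def
  using cosh_plus_sinh_cos_pos[of r \<theta>]
  by (auto intro!: derivative_eq_intros simp: field_simps)

lemma DERIV_wave:
  "(wave a b l has_real_derivative wave (- a / 2 + l * b) (- b / 2 - l * a) l s) (at s within A)"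
  unfolding wave_def
  by (auto intro!: derivative_eq_intros simp: algebra_simps)

lemma abs_wave_le: "\<bar>wave a b l s\<bar> \<le> (\<bar>a\<bar> + \<bar>b\<bar>) * exp (- s / 2)"
proof -
  have "\<bar>a * cos (l * s) + b * sin (l * s)\<bar> \<le> \<bar>a * cos (l * s)\<bar> + \<bar>b * sin (l * s)\<bar>" by linarith
  also have "\<dots> \<le> \<bar>a\<bar> + \<bar>b\<bar>"
    by (intro add_mono) (simp_all add: abs_mult mult_left_le)
  finally show ?thesis unfolding wave_def by (simp add: abs_mult mult.commute)
qed

lemma continuous_on_wave [continuous_intros]:
  fixes A :: "'a::t2_space set" shows
  "continuous_on A f \<Longrightarrow> continuous_on A (\<lambda>x. wave a b l (f x))"
  unfolding wave_def by (intro continuous_intros) auto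

lemma continuous_on_busemann [continuous_intros]:
  fixes A :: "'a::t2_space set" shows
  "continuous_on A f \<Longrightarrow> continuous_on A g \<Longrightarrow> continuous_on A (\<lambda>x. busemann (f x) (g x))"
  unfolding busemann_def by (intro continuous_intros) auto

lemma continuous_on_busemann_slope [continuous_intros]:
  fixes A :: "'a::t2_space set" shows
  "continuous_on A f \<Longrightarrow> continuous_on A g \<Longrightarrow> continuous_on A (\<lambda>x. busemann_slope (f x) (g x))"
  unfolding busemann_slope_def by (intro continuous_intros) auto

lemma circle_mean_integrable:
  "(\<lambda>\<theta>. wave a b l (busemann r \<theta>) * busemann_slope r \<theta> ^ k) integrable_on {0..pi}"
  by (intro integrable_continuous_real continuous_intros)

lemma circle_mean_add:
  "circle_mean k a b l r + circle_mean k a' b' l r = circle_mean k (a + a') (b + b') l r"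
  unfolding circle_mean_def
  by (subst integral_add[symmetric, OF circle_mean_integrable circle_mean_integrable])
     (simp add: wave_def algebra_simps)

lemma circle_mean_scale: "c * circle_mean k a b l r = circle_mean k (c * a) (c * b) l r"
  unfolding circle_mean_def integral_mult_right[symmetric]
  by (simp add: wave_def algebra_simps)

lemma DERIV_circle_mean:
  "(circle_mean k a b l has_real_derivative
     circle_mean (k + 1) (- a / 2 + l * b) (- b / 2 - l * a) l r
     + k * (circle_mean (k - 1) a b l r - circle_mean (k + 1) a b l r)) (at r)"
proof -
  define w w' where "w = wave a b l" and "w' = wave (- a / 2 + l * b) (- b / 2 - l * a) l"
  let ?d = "\<lambda>r \<theta>. w' (busemann r \<theta>) * busemann_slope r \<theta> ^ (k + 1)
      + real k * (w (busemann r \<theta>) * busemann_slope r \<theta> ^ (k - 1)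
                  - w (busemann r \<theta>) * busemann_slope r \<theta> ^ (k + 1))"
  have "((\<lambda>r. integral (cbox 0 pi) (\<lambda>\<theta>. w (busemann r \<theta>) * busemann_slope r \<theta> ^ k))
       has_real_derivative integral (cbox 0 pi) (?d r)) (at r within UNIV)"
  proof (rule leibniz_rule_field_derivative)
    fix r \<theta> :: real
    have "((\<lambda>r. w (busemann r \<theta>)) has_real_derivative
            w' (busemann r \<theta>) * busemann_slope r \<theta>) (at r)"
      unfolding w_def w'_def by (rule DERIV_chain2[OF DERIV_wave DERIV_busemann])
    moreover have "((\<lambda>r. busemann_slope r \<theta> ^ k) has_real_derivative
        real k * (busemann_slope r \<theta> ^ (k - 1) - busemann_slope r \<theta> ^ (k + 1))) (at r)"
    proof (cases k)
      case (Suc j)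
      show ?thesis unfolding Suc
        by (rule derivative_eq_intros DERIV_busemann_slope refl)+
           (simp add: algebra_simps power2_eq_square)
    qed simp
    ultimately show "((\<lambda>r. w (busemann r \<theta>) * busemann_slope r \<theta> ^ k) has_real_derivative
        ?d r \<theta>) (at r within UNIV)"
      by (rule DERIV_mult[THEN DERIV_cong]) (simp add: algebra_simps)
  next
    show "continuous_on (UNIV \<times> cbox 0 pi) (\<lambda>(r, \<theta>). ?d r \<theta>)"
      unfolding w_def w'_def case_prod_beta by (intro continuous_intros)
  qed (auto simp: w_def circle_mean_integrable)
  moreover have "integral (cbox 0 pi) (?d r) =
     circle_mean (k + 1) (- a / 2 + l * b) (- b / 2 - l * a) l r
     + k * (circle_mean (k - 1) a b l r - circle_mean (k + 1) a b l r)"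
    unfolding circle_mean_def w_def w'_def cbox_interval
    by (subst integral_add integral_diff integral_mult_right;
        (intro integrable_continuous_real continuous_intros)?)+ simp
  ultimately show ?thesis
    unfolding circle_mean_def[abs_def] w_def by simp
qed

text \<open>
  The Poisson kernel has mean 1: this makes averages of \<open>exp (- S / 2)\<close> bounded in \<open>r\<close>, although
  \<open>exp (- S / 2)\<close> itself is unbounded.
\<close>

lemma integral_exp_minus_busemann: "integral {0..pi} (\<lambda>\<theta>. exp (- busemann r \<theta>)) = pi"
proof -
  let ?f = "\<lambda>r \<theta>. exp (- busemann r \<theta>)"
  have "((\<lambda>r. integral (cbox 0 pi) (?f r)) has_real_derivative 0) (at r)" for r
  proof -
    have "((\<lambda>r. integral (cbox 0 pi) (?f r)) has_real_derivative
        integral (cbox 0 pi) (\<lambda>\<theta>. - busemann_slope r \<theta> * exp (- busemann r \<theta>))) (at r within UNIV)"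
      by (rule leibniz_rule_field_derivative)
         (auto intro!: derivative_eq_intros DERIV_busemann integrable_continuous_real continuous_intros
               simp: case_prod_beta)
    (* the integral does not depend on r because the r-derivative of the integrand is a
       \<theta>-derivative of a function that vanishes at both ends *)
    moreover have "((\<lambda>\<theta>. - busemann_slope r \<theta> * exp (- busemann r \<theta>)) has_integral
        - sin pi / (cosh r + sinh r * cos pi) - - sin 0 / (cosh r + sinh r * cos 0)) {0..pi}"
    proof (rule fundamental_theorem_of_calculus)
      fix \<theta> :: real
      have "((\<lambda>\<theta>. - sin \<theta> / (cosh r + sinh r * cos \<theta>)) has_real_derivative
          (- cos \<theta> * (cosh r + sinh r * cos \<theta>) - - sin \<theta> * (sinh r * - sin \<theta>)) / (cosh r + sinh r * cos \<theta>)\<^sup>2)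
          (at \<theta> within {0..pi})"
        unfolding power2_eq_square
        by (rule DERIV_divide; (rule cosh_plus_sinh_cos_nz)?) (auto intro!: derivative_eq_intros)
      also have "- cos \<theta> * (cosh r + sinh r * cos \<theta>) - - sin \<theta> * (sinh r * - sin \<theta>)
          = - (sinh r * ((sin \<theta>)\<^sup>2 + (cos \<theta>)\<^sup>2) + cosh r * cos \<theta>)"
        unfolding power2_eq_square by algebra
      also have "\<dots> = - (sinh r + cosh r * cos \<theta>)" by simp
      also have "\<dots> / (cosh r + sinh r * cos \<theta>)\<^sup>2 = - busemann_slope r \<theta> * exp (- busemann r \<theta>)"
        unfolding exp_minus exp_busemann busemann_slope_def power2_eq_square
        by (simp add: divide_inverse mult.assoc del: minus_add_distrib)
      finally show "((\<lambda>\<theta>. - sin \<theta> / (cosh r + sinh r * cos \<theta>)) has_vector_derivative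
          - busemann_slope r \<theta> * exp (- busemann r \<theta>)) (at \<theta> within {0..pi})"
        by (simp add: has_real_derivative_iff_has_vector_derivative)
    qed simp
    from integral_unique[OF this]
    have "integral {0..pi} (\<lambda>\<theta>. - busemann_slope r \<theta> * exp (- busemann r \<theta>)) = 0"
      by (simp only: sin_pi sin_zero minus_zero div_0 diff_self)
    ultimately show ?thesis by simp
  qed
  from DERIV_isconst_all[OF allI[OF this], of r 0]
  have "integral (cbox 0 pi) (?f r) = integral (cbox 0 pi) (?f 0)" by simp
  also have "\<dots> = pi" by (simp add: busemann_def)
  finally show ?thesis by simp
qed

lemma integral_exp_half_busemann_le: "integral {0..pi} (\<lambda>\<theta>. exp (- busemann r \<theta> / 2)) \<le> pi"
proof -
  have "integral {0..pi} (\<lambda>\<theta>. exp (- busemann r \<theta> / 2))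
      \<le> integral {0..pi} (\<lambda>\<theta>. (1 + exp (- busemann r \<theta>)) / 2)"
  proof (rule integral_le)
    fix \<theta> :: real
    have "0 \<le> (1 - exp (- busemann r \<theta> / 2))\<^sup>2" by simp
    also have "\<dots> = 1 - 2 * exp (- busemann r \<theta> / 2) + exp (- busemann r \<theta>)"
      by (simp add: power2_eq_square algebra_simps flip: exp_add)
    finally show "exp (- busemann r \<theta> / 2) \<le> (1 + exp (- busemann r \<theta>)) / 2" by simp
  qed (intro integrable_continuous_real continuous_intros; simp)+
  also have "\<dots> = (pi + integral {0..pi} (\<lambda>\<theta>. exp (- busemann r \<theta>))) / 2"
    by (subst integral_divide, subst integral_add)
       (auto intro!: integrable_continuous_real continuous_intros)
  finally show ?thesis by (simp add: integral_exp_minus_busemann)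
qed

lemma abs_circle_mean_le: "\<bar>circle_mean k a b l r\<bar> \<le> (\<bar>a\<bar> + \<bar>b\<bar>) * pi"
proof -
  have "norm (circle_mean k a b l r) \<le> integral {0..pi} (\<lambda>\<theta>. (\<bar>a\<bar> + \<bar>b\<bar>) * exp (- busemann r \<theta> / 2))"
    unfolding circle_mean_def
  proof (rule integral_norm_bound_integral)
    fix \<theta> :: real
    have "norm (wave a b l (busemann r \<theta>) * busemann_slope r \<theta> ^ k) \<le> (\<bar>a\<bar> + \<bar>b\<bar>) * exp (- busemann r \<theta> / 2) * 1"
      unfolding norm_mult real_norm_def abs_mult
      by (intro mult_mono abs_wave_le) (auto simp: power_abs intro!: power_le_one abs_slope_le_1)
    then show "norm (wave a b l (busemann r \<theta>) * busemann_slope r \<theta> ^ k) \<le> (\<bar>a\<bar> + \<bar>b\<bar>) * exp (- busemann r \<theta> / 2)"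
      by simp
  qed (intro integrable_continuous_real continuous_intros; simp)+
  also have "\<dots> \<le> (\<bar>a\<bar> + \<bar>b\<bar>) * pi"
    using integral_exp_half_busemann_le[of r] by (simp add: mult_left_mono)
  finally show ?thesis by simp
qed

text \<open>
  With \<open>S\<^sub>\<theta>\<close> the angular derivative, \<open>1 - V\<^sup>2 = (S\<^sub>\<theta> / sinh r)\<^sup>2\<close>. One integration by parts in the angle of
  \<open>w' S\<^sub>\<theta>\<^sup>2\<close>, whose boundary terms vanish with \<open>sin \<theta>\<close>, therefore removes all powers of \<open>V\<close> from the
  hyperbolic Laplacian of an average. Here \<open>w\<close> is the first derivative of the averaged wave.
\<close>

lemma circle_mean_by_parts:
  assumes "r > 0"
  shows "circle_mean 2 (- a / 2 + l * b) (- b / 2 - l * a) l r - circle_mean 2 a b l r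
         + cosh r / sinh r * circle_mean 1 a b l r
       = circle_mean 0 (- a / 2 + l * b) (- b / 2 - l * a) l r"
proof -
  define w w' where "w = wave a b l" and "w' = wave (- a / 2 + l * b) (- b / 2 - l * a) l"
  have s: "sinh r > 0" using assms by simp
  let ?D = "\<lambda>\<theta>. cosh r + sinh r * cos \<theta>"
  let ?V = "\<lambda>\<theta>. busemann_slope r \<theta>" and ?S = "\<lambda>\<theta>. busemann r \<theta>"
  let ?d = "\<lambda>\<theta>. w' (?S \<theta>) * ?V \<theta> ^ 0 - w' (?S \<theta>) * ?V \<theta> ^ 2
                + (w (?S \<theta>) * ?V \<theta> ^ 2 - cosh r / sinh r * (w (?S \<theta>) * ?V \<theta> ^ 1))"
  have "(?d has_integral - sin pi / (sinh r * ?D pi) * w (?S pi)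
      - - sin 0 / (sinh r * ?D 0) * w (?S 0)) {0..pi}"
  proof (rule fundamental_theorem_of_calculus)
    fix \<theta> :: real
    let ?x = "- sin \<theta> / (sinh r * ?D \<theta>)"
    have "((\<lambda>\<theta>. - sin \<theta> / (sinh r * ?D \<theta>)) has_real_derivative
       - cos \<theta> / (sinh r * ?D \<theta>) - (sin \<theta>)\<^sup>2 / (?D \<theta>)\<^sup>2) (at \<theta> within {0..pi})"
    proof -
      have "((\<lambda>\<theta>. - sin \<theta> / (sinh r * ?D \<theta>)) has_real_derivative
         (- cos \<theta> * (sinh r * ?D \<theta>) - - sin \<theta> * (sinh r * (sinh r * - sin \<theta>))) /
         ((sinh r * ?D \<theta>) * (sinh r * ?D \<theta>))) (at \<theta> within {0..pi})"
        by (rule DERIV_divide) (use s in \<open>auto intro!: derivative_eq_intros\<close>)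
      also have "(- cos \<theta> * (sinh r * ?D \<theta>) - - sin \<theta> * (sinh r * (sinh r * - sin \<theta>))) /
         ((sinh r * ?D \<theta>) * (sinh r * ?D \<theta>)) = - cos \<theta> / (sinh r * ?D \<theta>) - (sin \<theta>)\<^sup>2 / (?D \<theta>)\<^sup>2"
        using s by (simp add: diff_divide_distrib power2_eq_square)
      finally show ?thesis .
    qed
    moreover have "((\<lambda>\<theta>. w (?S \<theta>)) has_real_derivative w' (?S \<theta>) * (- sinh r * sin \<theta> / ?D \<theta>)) (at \<theta> within {0..pi})"
      unfolding w_def w'_def by (rule DERIV_chain2[OF DERIV_wave DERIV_busemann_angle])
    ultimately have "((\<lambda>\<theta>. - sin \<theta> / (sinh r * ?D \<theta>) * w (?S \<theta>)) has_real_derivative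
       (- cos \<theta> / (sinh r * ?D \<theta>) - (sin \<theta>)\<^sup>2 / (?D \<theta>)\<^sup>2) * w (?S \<theta>)
       + w' (?S \<theta>) * (- sinh r * sin \<theta> / ?D \<theta>) * ?x) (at \<theta> within {0..pi})"
      by (rule DERIV_mult)
    also have "w' (?S \<theta>) * (- sinh r * sin \<theta> / ?D \<theta>) * ?x = w' (?S \<theta>) * (1 - (?V \<theta>)\<^sup>2)"
      unfolding one_minus_slope_sq using s by (simp add: power2_eq_square)
    also have "- cos \<theta> / (sinh r * ?D \<theta>) - (sin \<theta>)\<^sup>2 / (?D \<theta>)\<^sup>2 = (?V \<theta>)\<^sup>2 - cosh r / sinh r * ?V \<theta>"
    proof -
      have "cosh r / sinh r * ?V \<theta> - 1 =
         (cosh r * (sinh r + cosh r * cos \<theta>) - sinh r * ?D \<theta>) / (sinh r * ?D \<theta>)"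
        using s unfolding busemann_slope_def by (simp add: divide_simps)
      also have "cosh r * (sinh r + cosh r * cos \<theta>) - sinh r * ?D \<theta>
          = ((cosh r)\<^sup>2 - (sinh r)\<^sup>2) * cos \<theta>"
        by (simp add: algebra_simps power2_eq_square)
      also have "\<dots> = cos \<theta>" by (simp add: cosh_square_eq)
      finally have "cosh r / sinh r * ?V \<theta> = 1 + cos \<theta> / (sinh r * ?D \<theta>)" by simp
      then show ?thesis unfolding one_minus_slope_sq[symmetric] by simp
    qed
    finally show "((\<lambda>\<theta>. - sin \<theta> / (sinh r * ?D \<theta>) * w (?S \<theta>)) has_vector_derivative ?d \<theta>)
        (at \<theta> within {0..pi})"
      by (simp add: has_real_derivative_iff_has_vector_derivative algebra_simps)
  qed simp
  then have "integral {0..pi} ?d = 0" by (simp add: integral_unique)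
  also have "integral {0..pi} ?d = circle_mean 0 (- a / 2 + l * b) (- b / 2 - l * a) l r
     - circle_mean 2 (- a / 2 + l * b) (- b / 2 - l * a) l r
     + (circle_mean 2 a b l r - cosh r / sinh r * circle_mean 1 a b l r)"
    unfolding circle_mean_def w_def w'_def
    by (subst integral_add integral_diff integral_mult_right;
        (intro integrable_continuous_real continuous_intros)?)+ simp
  finally show ?thesis by simp
qed

text \<open>
  All that the expected Ito formula requires of its test function. The function \<open>F2\<close> is Lipschitz
  because the third derivative is again a combination of circle averages.
\<close>

lemma spherical_function:
  fixes a b l :: real
  obtains F1 F2 :: "real \<Rightarrow> real" and C where
    "\<And>r. (circle_mean 0 a b l has_real_derivative F1 r) (at r)"
    "\<And>r. (F1 has_real_derivative F2 r) (at r)"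
    "\<And>r. \<bar>circle_mean 0 a b l r\<bar> \<le> C" "\<And>r. \<bar>F1 r\<bar> \<le> C" "\<And>r. \<bar>F2 r\<bar> \<le> C"
    "\<And>x y. \<bar>F2 x - F2 y\<bar> \<le> C * \<bar>x - y\<bar>"
    "\<And>r. r > 0 \<Longrightarrow> F2 r + cosh r / sinh r * F1 r = - (1 / 4 + l\<^sup>2) * circle_mean 0 a b l r"
proof -
  define a1 b1 where "a1 = - a / 2 + l * b" and "b1 = - b / 2 - l * a"
  define a2 b2 where "a2 = - a1 / 2 + l * b1" and "b2 = - b1 / 2 - l * a1"
  define a3 b3 where "a3 = - a2 / 2 + l * b2" and "b3 = - b2 / 2 - l * a2"
  define F1 where "F1 = circle_mean 1 a1 b1 l"
  define F2 where "F2 = (\<lambda>r. circle_mean 2 a2 b2 l r + (circle_mean 0 a1 b1 l r - circle_mean 2 a1 b1 l r))"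
  define F3 where "F3 = (\<lambda>r. circle_mean 3 a3 b3 l r + 2 * (circle_mean 1 a2 b2 l r - circle_mean 3 a2 b2 l r)
     + (circle_mean 1 a2 b2 l r - (circle_mean 3 a2 b2 l r + 2 * (circle_mean 1 a1 b1 l r - circle_mean 3 a1 b1 l r))))"
  define K K1 K2 K3 where "K = (\<bar>a\<bar> + \<bar>b\<bar>) * pi" and "K1 = (\<bar>a1\<bar> + \<bar>b1\<bar>) * pi"
    and "K2 = (\<bar>a2\<bar> + \<bar>b2\<bar>) * pi" and "K3 = (\<bar>a3\<bar> + \<bar>b3\<bar>) * pi"
  define C where "C = K + 7 * K1 + 7 * K2 + 7 * K3"
  have bds: "\<bar>circle_mean k a b l r\<bar> \<le> K" "\<bar>circle_mean k a1 b1 l r\<bar> \<le> K1"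
      "\<bar>circle_mean k a2 b2 l r\<bar> \<le> K2" "\<bar>circle_mean k a3 b3 l r\<bar> \<le> K3"
      "0 \<le> K" "0 \<le> K1" "0 \<le> K2" "0 \<le> K3" for k r
    unfolding K_def K1_def K2_def K3_def by (auto intro!: abs_circle_mean_le)
  have d0: "(circle_mean 0 a b l has_real_derivative F1 r) (at r)" for r
    using DERIV_circle_mean[of 0 a b l r] by (simp add: F1_def a1_def b1_def)
  have d1: "(F1 has_real_derivative F2 r) (at r)" for r
    using DERIV_circle_mean[of 1 a1 b1 l r] by (simp add: F1_def F2_def a2_def b2_def numeral_2_eq_2)
  have d2: "(F2 has_real_derivative F3 r) (at r)" for r
    unfolding F2_def
    using DERIV_circle_mean[of 2 a2 b2 l r] DERIV_circle_mean[of 0 a1 b1 l r] DERIV_circle_mean[of 2 a1 b1 l r]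
    by (auto intro!: derivative_eq_intros simp: F3_def a3_def b3_def a2_def b2_def numeral_3_eq_3)
  have b3: "\<bar>F3 r\<bar> \<le> C" for r
  proof -
    have lin: "\<bar>x + 2 * (y - z) + (y - (z + 2 * (u - v)))\<bar> \<le> k + 7 * k1 + 7 * k2 + 7 * k3"
      if "\<bar>x\<bar> \<le> k3" "\<bar>y\<bar> \<le> k2" "\<bar>z\<bar> \<le> k2" "\<bar>u\<bar> \<le> k1" "\<bar>v\<bar> \<le> k1" "0 \<le> k" for x y z u v k k1 k2 k3 :: real
    proof -
      have "\<bar>x + 2 * (y - z) + (y - (z + 2 * (u - v)))\<bar> \<le> \<bar>x\<bar> + 3 * \<bar>y\<bar> + 3 * \<bar>z\<bar> + 2 * \<bar>u\<bar> + 2 * \<bar>v\<bar>"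
        by (simp add: abs_le_iff) linarith
      with that show ?thesis by linarith
    qed
    show ?thesis unfolding F3_def C_def by (rule lin) (rule bds)+
  qed
  show ?thesis
  proof (rule that[of F1 F2 C])
    show "\<bar>circle_mean 0 a b l r\<bar> \<le> C" for r
      unfolding C_def using bds(1)[of 0 r] bds(5-) by linarith
    show "\<bar>F1 r\<bar> \<le> C" for r
      unfolding C_def F1_def using bds(2)[of 1 r] bds(5-) by linarith
    show "\<bar>F2 r\<bar> \<le> C" for r
      unfolding C_def F2_def using bds(2)[of 0 r] bds(2)[of 2 r] bds(3)[of 2 r] bds(5-) by linarith
    show "\<bar>F2 x - F2 y\<bar> \<le> C * \<bar>x - y\<bar>" for x y
      using field_differentiable_bound[of UNIV F2 F3 C x y] d2 b3 by simp
    show "F2 r + cosh r / sinh r * F1 r = - (1 / 4 + l\<^sup>2) * circle_mean 0 a b l r" if "r > 0" for r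
    proof -
      have "F2 r + cosh r / sinh r * F1 r = circle_mean 0 a2 b2 l r + circle_mean 0 a1 b1 l r"
        using circle_mean_by_parts[OF that, of a1 l b1] by (simp add: F1_def F2_def a2_def b2_def)
      also have "\<dots> = - (1 / 4 + l\<^sup>2) * circle_mean 0 a b l r"
        unfolding circle_mean_add circle_mean_scale
        by (rule arg_cong2[where f = "\<lambda>a b. circle_mean 0 a b l r"])
           (simp_all add: a1_def b1_def a2_def b2_def field_simps power2_eq_square)
      finally show ?thesis .
    qed
  qed (use d0 d1 in auto)
qed

section \<open>Riemann sums and the drift along a path\<close>

lemma grid_in_interval:
  assumes "i \<le> n" "T \<ge> (0::real)"
  shows "T * real i / real n \<in> {0..T}"
proof (cases "n = 0")
  case False
  have "T * real i / real n \<le> T * real n / real n"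
    using assms by (intro divide_right_mono mult_left_mono) auto
  with assms False show ?thesis by simp
qed (use assms in auto)

lemma grid_mono: "i \<le> j \<Longrightarrow> T \<ge> 0 \<Longrightarrow> T * real i / real n \<le> T * real j / (real n :: real)"
  by (intro divide_right_mono mult_left_mono) auto

lemma integral_grid_sum:
  fixes f :: "real \<Rightarrow> real"
  assumes T: "T \<ge> 0" and n: "n > 0" and f: "f integrable_on {0..T}"
  shows "integral {0..T} f = (\<Sum>i<n. integral {T * real i / real n .. T * real (Suc i) / real n} f)"
proof -
  have "integral {0..T * real k / real n} f
      = (\<Sum>i<k. integral {T * real i / real n .. T * real (Suc i) / real n} f)" if "k \<le> n" for k
    using that
  proof (induction k)
    case (Suc k)
    have "integral {0..T * real (Suc k) / real n} f
        = integral {0..T * real k / real n} f + integral {T * real k / real n..T * real (Suc k) / real n} f"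
    proof (rule Henstock_Kurzweil_Integration.integral_combine[symmetric])
      show "f integrable_on {0..T * real (Suc k) / real n}"
        using grid_in_interval[OF Suc.prems T] by (intro integrable_on_subinterval[OF f]) auto
    qed (use T grid_mono[of k "Suc k" T n] in auto)
    with Suc show ?case by simp
  qed simp
  from this[of n] n show ?thesis by simp
qed

lemma uniform_modulus_on_grid:
  fixes f :: "real \<Rightarrow> real"
  assumes "T > 0" and f: "continuous_on {0..T} f" and e: "e > 0"
  shows "\<forall>\<^sub>F n in sequentially. \<forall>i<n. \<forall>u\<in>{T * real i / real n .. T * real (Suc i) / real n}.
      \<forall>v\<in>{T * real i / real n .. T * real (Suc i) / real n}. \<bar>f u - f v\<bar> < e"
proof -
  have "uniformly_continuous_on {0..T} f"
    using f compact_uniformly_continuous compact_Icc by blast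
  then obtain d where d: "d > 0" "\<And>u v. u \<in> {0..T} \<Longrightarrow> v \<in> {0..T} \<Longrightarrow> \<bar>u - v\<bar> < d \<Longrightarrow> \<bar>f u - f v\<bar> < e"
    using e unfolding uniformly_continuous_on_def dist_real_def by (metis abs_minus_commute)
  have "(\<lambda>n. T / real n) \<longlonglongrightarrow> 0" by (intro tendsto_divide_0[OF tendsto_const] filterlim_at_top_imp_at_infinity filterlim_real_sequentially)
  then have "\<forall>\<^sub>F n in sequentially. T / real n < d" using d(1) by (auto dest: order_tendstoD)
  then show ?thesis
  proof eventually_elim
    case (elim n)
    show ?case
    proof (intro allI impI ballI)
      fix i u v assume i: "i < n" and uv: "u \<in> {T * real i / real n .. T * real (Suc i) / real n}"
        "v \<in> {T * real i / real n .. T * real (Suc i) / real n}"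
      have "T * real (Suc i) / real n = T * real i / real n + T / real n"
        by (simp add: field_simps add_divide_distrib)
      with uv elim have "\<bar>u - v\<bar> < d" by auto
      moreover have "T * real i / real n \<in> {0..T}" "T * real (Suc i) / real n \<in> {0..T}"
        using i assms(1) grid_in_interval[of i n T] grid_in_interval[of "Suc i" n T] by auto
      ultimately show "\<bar>f u - f v\<bar> < e" using uv by (intro d) auto
    qed
  qed
qed

lemma riemann_sum_tendsto:
  fixes f :: "real \<Rightarrow> real"
  assumes T: "T > 0" and f: "continuous_on {0..T} f"
  shows "(\<lambda>n. T / real n * (\<Sum>i<n. f (T * real i / real n))) \<longlonglongrightarrow> integral {0..T} f"
proof (rule tendstoI)
  fix e :: real assume "e > 0"
  then have "e / (2 * T) > 0" using T by simp
  from uniform_modulus_on_grid[OF T f this] eventually_gt_at_top[of 0]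
  show "\<forall>\<^sub>F n in sequentially. dist (T / real n * (\<Sum>i<n. f (T * real i / real n))) (integral {0..T} f) < e"
  proof eventually_elim
    case (elim n)
    have fi: "f integrable_on {0..T}" using f by (rule integrable_continuous_real)
    have "\<bar>T / real n * f (T * real i / real n) - integral {T * real i / real n .. T * real (Suc i) / real n} f\<bar>
        \<le> T / real n * (e / (2 * T))" if i: "i < n" for i
    proof -
      let ?I = "{T * real i / real n .. T * real (Suc i) / real n}"
      have len: "T * real (Suc i) / real n - T * real i / real n = T / real n"
        by (simp add: field_simps add_divide_distrib)
      have le: "T * real i / real n \<le> T * real (Suc i) / real n"
        using T by (intro grid_mono) auto
      have sub: "?I \<subseteq> {0..T}"
        using grid_in_interval[of i n T] grid_in_interval[of "Suc i" n T] i T by auto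
      have fI: "f integrable_on ?I" using integrable_on_subinterval[OF fi sub] .
      have "((\<lambda>u. f (T * real i / real n)) has_integral T / real n * f (T * real i / real n)) ?I"
        using has_integral_const_real[of "f (T * real i / real n)" "T * real i / real n" "T * real (Suc i) / real n"] le len
        by (simp add: mult.commute)
      then have "((\<lambda>u. f (T * real i / real n) - f u) has_integral
          T / real n * f (T * real i / real n) - integral ?I f) ?I"
        by (intro has_integral_diff integrable_integral fI)
      then have "norm (T / real n * f (T * real i / real n) - integral ?I f)
          \<le> e / (2 * T) * Henstock_Kurzweil_Integration.content ?I"
        using elim(1) i le T \<open>e > 0\<close>
        by (intro has_integral_bound_real[where S = "{}"]) (auto intro!: less_imp_le)
      then show ?thesis using le len by (simp add: mult.commute)
    qed
    then have "\<bar>\<Sum>i<n. T / real n * f (T * real i / real n) - integral {T * real i / real n .. T * real (Suc i) / real n} f\<bar>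
        \<le> (\<Sum>i<n. T / real n * (e / (2 * T)))"
      by (intro order_trans[OF sum_abs sum_mono]) auto
    also have "\<dots> < e" using elim(2) T \<open>e > 0\<close> by simp
    finally show ?case
      using integral_grid_sum[OF less_imp_le[OF T] elim(2) fi]
      by (simp add: dist_real_def sum_subtractf sum_distrib_left)
  qed
qed

lemma borel_measurable_coth [measurable]: "coth \<in> borel_measurable borel"
proof -
  have [measurable]: "(cosh :: real \<Rightarrow> real) \<in> borel_measurable borel"
    "(sinh :: real \<Rightarrow> real) \<in> borel_measurable borel"
    by (intro borel_measurable_continuous_onI continuous_intros)+
  show ?thesis unfolding coth_def[abs_def] by measurable
qed

text \<open>
  Let \<open>b\<close> and \<open>r\<close> be paths of the noise and of the solution. Between \<open>r\<close> plus the increment of \<open>b\<close> and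
  the next value of \<open>r\<close> lies exactly the drift of one step, so each summand is \<open>f1\<close> at a nearby point
  times that drift. The drift has a density that is integrable but unbounded near \<open>r = 0\<close>; the error is
  controlled by the modulus of continuity times the total drift, and \<open>coth\<close> reappears only in the
  product \<open>h\<close> with \<open>f1\<close>, which is continuous.
\<close>

lemma drift_sum_tendsto:
  fixes r b f f1 h :: "real \<Rightarrow> real"
  assumes T: "T > 0"
    and r: "continuous_on {0..T} r" and r0: "\<And>t. t \<in> {0..T} \<Longrightarrow> r t \<ge> 0"
    and fin: "(\<integral>\<^sup>+u\<in>{0..T}. coth (r u) \<partial>lborel) < \<infinity>"
    and eq: "\<And>t. t \<in> {0..T} \<Longrightarrow> r t = b t + 1 / 2 * enn2real (\<integral>\<^sup>+u\<in>{0..t}. coth (r u) \<partial>lborel)"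
    and b: "continuous_on {0..T} b"
    and f: "\<And>x. (f has_real_derivative f1 x) (at x)"
    and f1: "\<And>x y. \<bar>f1 x - f1 y\<bar> \<le> C * \<bar>x - y\<bar>"
    and h: "continuous_on UNIV h" and hf: "\<And>x. x > 0 \<Longrightarrow> h x = cosh x / sinh x * f1 x"
  shows "(\<lambda>n. (\<Sum>i<n. f (r (T * real (Suc i) / real n))
       - f (r (T * real i / real n) + (b (T * real (Suc i) / real n) - b (T * real i / real n)))))
     \<longlonglongrightarrow> integral {0..T} (\<lambda>u. h (r u)) / 2"
proof -
  (* the path frozen outside the interval is continuous on the whole line, hence measurable *)
  define q where "q u = r (max 0 (min T u))" for u
  have q_eq: "q u = r u" if "u \<in> {0..T}" for u using that by (auto simp: q_def max_def min_def)
  have "continuous_on UNIV q"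
    unfolding q_def using T by (intro continuous_on_compose2[OF r] continuous_intros) auto
  then have q_meas [measurable]: "q \<in> borel_measurable borel" by (rule borel_measurable_continuous_onI)
  define k where "k u = enn2real (coth (q u))" for u
  have k_meas [measurable]: "k \<in> borel_measurable borel" unfolding k_def[abs_def] by measurable
  have k0: "k u \<ge> 0" for u by (simp add: k_def)
  define c where "c t = enn2real (\<integral>\<^sup>+u\<in>{0..t}. coth (r u) \<partial>lborel)" for t
  have nnq: "(\<integral>\<^sup>+u\<in>{0..t}. coth (r u) \<partial>lborel) = (\<integral>\<^sup>+u\<in>{0..t}. coth (q u) \<partial>lborel)" if "t \<le> T" for t
    using that by (intro nn_integral_cong) (auto simp: indicator_def q_eq)
  have fint: "(\<integral>\<^sup>+u\<in>{0..t}. coth (q u) \<partial>lborel) < \<infinity>" if "t \<le> T" for t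
  proof -
    have "(\<integral>\<^sup>+u\<in>{0..t}. coth (q u) \<partial>lborel) \<le> (\<integral>\<^sup>+u\<in>{0..T}. coth (q u) \<partial>lborel)"
      using that by (intro nn_integral_mono) (auto simp: indicator_def)
    with fin nnq[of T] show ?thesis by auto
  qed
  have "AE u in lborel. coth (q u) * indicator {0..T} u \<noteq> \<infinity>"
    by (rule nn_integral_PInf_AE) (use fint[of T] in auto)
  then have pos: "AE u in lborel. u \<in> {0..T} \<longrightarrow> q u > 0"
    by eventually_elim (auto simp: coth_def split: if_splits)
  have kc: "(k has_integral c t) {0..t}" if t: "t \<in> {0..T}" for t
  proof -
    have "((\<lambda>u. k u * indicator {0..t} u) has_integral c t) UNIV"
    proof (rule nn_integral_has_integral)
      have "(\<integral>\<^sup>+u. ennreal (k u * indicator {0..t} u) \<partial>lborel) = (\<integral>\<^sup>+u\<in>{0..t}. coth (q u) \<partial>lborel)"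
      proof (rule nn_integral_cong_AE)
        show "AE u in lborel. ennreal (k u * indicator {0..t} u) = coth (q u) * indicator {0..t} u"
          using pos by eventually_elim (use t in \<open>auto simp: k_def coth_def indicator_def\<close>)
      qed
      also have "\<dots> = ennreal (c t)"
        using fint[of t] nnq[of t] t by (simp add: c_def less_top)
      finally show "(\<integral>\<^sup>+u. ennreal (k u * indicator {0..t} u) \<partial>lborel) = ennreal (c t)" .
    qed (auto simp: k0 c_def)
    moreover have "(\<lambda>u. k u * indicator {0..t} u) = (\<lambda>u. if u \<in> {0..t} then k u else 0)"
      by (auto simp: indicator_def)
    ultimately show ?thesis using has_integral_restrict_UNIV[of "{0..t}" k "c t"] by simp
  qed
  have kI: "(k has_integral (r t - r s - (b t - b s)) * 2) {s..t}" if "s \<in> {0..T}" "t \<in> {0..T}" "s \<le> t" for s t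
  proof -
    have "k integrable_on {0..t}" using kc[OF that(2)] by auto
    then have "integral {0..s} k + integral {s..t} k = integral {0..t} k" "k integrable_on {s..t}"
      using that by (auto intro!: Henstock_Kurzweil_Integration.integral_combine intro: integrable_on_subinterval)
    then show ?thesis
      using kc[OF that(1)] kc[OF that(2)] eq[OF that(1)] eq[OF that(2)]
      by (auto simp: c_def has_integral_iff algebra_simps)
  qed
  (* finiteness of the drift forces the path to spend a null set of times at 0 *)
  define Z where "Z = {u \<in> {0..T}. \<not> q u > 0}"
  have "Z \<in> sets lborel" unfolding Z_def by simp
  moreover have "AE u in lborel. u \<notin> Z" using pos by eventually_elim (auto simp: Z_def)
  ultimately have "Z \<in> null_sets lborel" by (simp add: AE_iff_null_sets)
  then have Z: "negligible Z" by (simp add: negligible_iff_null_sets null_sets_completionI)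
  define H where "H u = (if u \<in> Z then 0 else h (q u))" for u
  have hrc: "continuous_on {0..T} (\<lambda>u. h (r u))"
    by (rule continuous_on_compose2[OF h r]) auto
  have hI: "H integrable_on {0..T}" "integral {0..T} H = integral {0..T} (\<lambda>u. h (r u))"
  proof -
    have "integral {0..T} (\<lambda>u. h (r u)) = integral {0..T} H"
      by (rule integral_spike[OF Z]) (auto simp: H_def q_eq)
    then show "integral {0..T} H = integral {0..T} (\<lambda>u. h (r u))" by simp
    show "H integrable_on {0..T}"
      by (rule integrable_spike[OF integrable_continuous_real[OF hrc] Z]) (auto simp: H_def q_eq)
  qed
  have C0: "C \<ge> 0" using f1[of 1 0] by auto
  have cT: "c T \<ge> 0" by (simp add: c_def)
  show ?thesis
  proof (rule tendstoI)
    fix e :: real assume e: "e > 0"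
    define \<eta> where "\<eta> = e / (2 * C * c T + 1)"
    have den: "2 * C * c T + 1 > 0" using C0 cT by (simp add: add_nonneg_pos)
    have \<eta>: "\<eta> > 0" using e den by (simp add: \<eta>_def)
    from uniform_modulus_on_grid[OF T r \<eta>] uniform_modulus_on_grid[OF T b \<eta>] eventually_gt_at_top[of 0]
    show "\<forall>\<^sub>F n in sequentially. dist (\<Sum>i<n. f (r (T * real (Suc i) / real n))
       - f (r (T * real i / real n) + (b (T * real (Suc i) / real n) - b (T * real i / real n))))
        (integral {0..T} (\<lambda>u. h (r u)) / 2) < e"
    proof eventually_elim
      case (elim n)
      let ?t = "\<lambda>i. T * real i / real n"
      have "\<bar>f (r (?t (Suc i))) - f (r (?t i) + (b (?t (Suc i)) - b (?t i))) - integral {?t i..?t (Suc i)} H / 2\<bar>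
          \<le> 3 * C * \<eta> * integral {?t i..?t (Suc i)} k / 2" if i: "i < n" for i
      proof -
        let ?x = "r (?t i) + (b (?t (Suc i)) - b (?t i))" and ?y = "r (?t (Suc i))"
        let ?I = "{?t i..?t (Suc i)}"
        have tin: "?t i \<in> {0..T}" "?t (Suc i) \<in> {0..T}" and le: "?t i \<le> ?t (Suc i)"
          using i T grid_in_interval[of i n T] grid_in_interval[of "Suc i" n T] grid_mono[of i "Suc i" T n]
          by (auto simp del: of_nat_Suc)
        have K: "(k has_integral (?y - ?x) * 2) ?I"
          using kI[OF tin le] by (simp add: algebra_simps)
        have xy: "?x \<le> ?y" using has_integral_nonneg[OF K] k0 by simp
        have "\<exists>z. ?x \<le> z \<and> z \<le> ?y \<and> f ?y - f ?x = f1 z * (?y - ?x)"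
        proof (cases "?x = ?y")
          case True then show ?thesis by (intro exI[of _ ?x]) simp
        next
          case False
          with xy have "?x < ?y" by simp
          then obtain z where "?x < z" "z < ?y" "f ?y - f ?x = (?y - ?x) * f1 z"
            using MVT2[of ?x ?y f f1] f by blast
          then show ?thesis by (intro exI[of _ z]) (simp only: mult.commute less_imp_le simp_thms)
        qed
        then obtain z where z: "?x \<le> z" "z \<le> ?y" "f ?y - f ?x = f1 z * (?y - ?x)" by blast
        have HI: "H integrable_on ?I" using tin by (intro integrable_on_subinterval[OF hI(1)]) auto
        have fk: "((\<lambda>u. f1 z * k u) has_integral f1 z * ((?y - ?x) * 2)) ?I"
          by (intro has_integral_mult_right K)
        have "\<bar>integral ?I (\<lambda>u. f1 z * k u - H u)\<bar> \<le> integral ?I (\<lambda>u. 3 * C * \<eta> * k u)"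
          unfolding real_norm_def[symmetric]
        proof (rule integral_norm_bound_integral)
          show "(\<lambda>u. f1 z * k u - H u) integrable_on ?I"
            using fk HI by (auto intro!: integrable_diff)
          show "(\<lambda>u. 3 * C * \<eta> * k u) integrable_on ?I"
            using has_integral_mult_right[OF K] by blast
          fix u assume u: "u \<in> ?I"
          then have uT: "u \<in> {0..T}" using tin by auto
          show "norm (f1 z * k u - H u) \<le> 3 * C * \<eta> * k u"
          proof (cases "u \<in> Z")
            case True
            then have "k u = 0" by (simp add: k_def Z_def coth_def)
            with True show ?thesis by (simp add: H_def)
          next
            case False
            then have qp: "q u > 0" using uT by (simp add: Z_def)
            then have ku: "k u = cosh (q u) / sinh (q u)" by (simp add: k_def coth_def)
            have "f1 z * k u - H u = (f1 z - f1 (q u)) * k u"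
              using False hf[OF qp] by (simp add: H_def ku left_diff_distrib right_diff_distrib diff_divide_distrib mult.commute)
            moreover have "\<bar>z - q u\<bar> \<le> 3 * \<eta>"
            proof -
              have "\<bar>?y - r u\<bar> < \<eta>" "\<bar>?y - r (?t i)\<bar> < \<eta>" "\<bar>b (?t (Suc i)) - b (?t i)\<bar> < \<eta>"
                using elim(1,2) i u le by auto
              then show ?thesis using z(1,2) q_eq[OF uT] by linarith
            qed
            then have "\<bar>f1 z - f1 (q u)\<bar> \<le> C * (3 * \<eta>)"
              using f1[of z "q u"] C0 by (meson mult_left_mono order_trans)
            then have "\<bar>f1 z - f1 (q u)\<bar> * k u \<le> C * (3 * \<eta>) * k u"
              using k0 by (intro mult_right_mono)
            ultimately show ?thesis
              using k0[of u] by (simp add: abs_mult mult_ac)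
          qed
        qed
        moreover have "integral ?I (\<lambda>u. f1 z * k u - H u) = 2 * (f ?y - f ?x - integral ?I H / 2)"
          using fk HI z(3) by (subst integral_diff) (auto simp: has_integral_iff)
        moreover have "integral ?I (\<lambda>u. 3 * C * \<eta> * k u) = 3 * C * \<eta> * integral ?I k" by simp
        ultimately have "2 * \<bar>f ?y - f ?x - integral ?I H / 2\<bar> \<le> 3 * C * \<eta> * integral ?I k"
          by (simp only: abs_mult abs_numeral)
        then show ?thesis by (simp only: mult.commute[of 2] pos_le_divide_eq[symmetric] zero_less_numeral)
      qed
      then have "\<bar>\<Sum>i<n. f (r (?t (Suc i))) - f (r (?t i) + (b (?t (Suc i)) - b (?t i))) - integral {?t i..?t (Suc i)} H / 2\<bar>
          \<le> (\<Sum>i<n. 3 * C * \<eta> * integral {?t i..?t (Suc i)} k / 2)"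
        by (intro order_trans[OF sum_abs sum_mono]) auto
      also have "\<dots> = 3 * C * \<eta> / 2 * (\<Sum>i<n. integral {?t i..?t (Suc i)} k)"
        by (simp add: sum_distrib_left)
      also have "(\<Sum>i<n. integral {?t i..?t (Suc i)} k) = c T"
        using integral_grid_sum[of T n k] kc[of T] T elim(3) by (auto simp: has_integral_iff)
      also have "3 * C * \<eta> / 2 * c T < e"
      proof -
        have "3 * C * \<eta> / 2 * c T \<le> \<eta> * (2 * C * c T)"
          using C0 cT \<eta> by (simp add: mult_nonneg_nonneg)
        also have "\<dots> < \<eta> * (2 * C * c T + 1)" using \<eta> by simp
        also have "\<dots> = e" using den by (simp add: \<eta>_def)
        finally show ?thesis .
      qed
      finally show ?case
        using integral_grid_sum[of T n H] hI T elim(3)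
        by (simp add: dist_real_def sum_subtractf sum_divide_distrib)
    qed
  qed
qed

section \<open>Gaussian smoothing\<close>

text \<open>
  The heat semigroup at time \<open>v\<close>, applied to \<open>f\<close>.
\<close>

definition heat :: "real \<Rightarrow> (real \<Rightarrow> real) \<Rightarrow> real \<Rightarrow> real" where
  "heat v f x = (\<integral>b. normal_density 0 (sqrt v) b * f (x + b) \<partial>lborel)"

lemma normal_moments:
  assumes "v > 0"
  shows "has_bochner_integral lborel (normal_density 0 (sqrt v)) 1"
    and "has_bochner_integral lborel (\<lambda>b. normal_density 0 (sqrt v) b * b) 0"
    and "has_bochner_integral lborel (\<lambda>b. normal_density 0 (sqrt v) b * b\<^sup>2) v"
    and "has_bochner_integral lborel (\<lambda>b. normal_density 0 (sqrt v) b * \<bar>b\<bar>) (sqrt v * sqrt (2 / pi))"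
    and "has_bochner_integral lborel (\<lambda>b. normal_density 0 (sqrt v) b * \<bar>b\<bar> ^ 3) (2 * v * sqrt v * sqrt (2 / pi))"
proof -
  have s: "sqrt v > 0" and vv: "sqrt v * sqrt v = v" using assms by auto
  show "has_bochner_integral lborel (normal_density 0 (sqrt v)) 1"
    using normal_moment_even[OF s, of 0 0] by simp
  show "has_bochner_integral lborel (\<lambda>b. normal_density 0 (sqrt v) b * b) 0"
    using normal_moment_odd[OF s, of 0 0] by simp
  show "has_bochner_integral lborel (\<lambda>b. normal_density 0 (sqrt v) b * b\<^sup>2) v"
    using normal_moment_even[OF s, of 0 1] assms by (simp add: fact_numeral)
  show "has_bochner_integral lborel (\<lambda>b. normal_density 0 (sqrt v) b * \<bar>b\<bar>) (sqrt v * sqrt (2 / pi))"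
    using normal_moment_abs_odd[OF s, of 0 0] by simp
  show "has_bochner_integral lborel (\<lambda>b. normal_density 0 (sqrt v) b * \<bar>b\<bar> ^ 3) (2 * v * sqrt v * sqrt (2 / pi))"
    using normal_moment_abs_odd[OF s, of 0 1] vv
    by (simp add: power3_eq_cube mult.assoc[symmetric])
qed

lemma sqrt_2_pi_le_1: "sqrt (2 / pi) \<le> 1"
  using pi_gt3 by simp

lemma heat_integrable:
  assumes "v > 0" and [measurable]: "f \<in> borel_measurable borel" and f: "\<And>x. \<bar>f x\<bar> \<le> C"
  shows "integrable lborel (\<lambda>b. normal_density 0 (sqrt v) b * f (x + b))"
proof (rule Bochner_Integration.integrable_bound)
  show "integrable lborel (\<lambda>b. C * normal_density 0 (sqrt v) b)"
    using normal_moments(1)[OF assms(1)] by (auto simp: has_bochner_integral_iff)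
  show "AE b in lborel. norm (normal_density 0 (sqrt v) b * f (x + b)) \<le> norm (C * normal_density 0 (sqrt v) b)"
  proof (rule AE_I2)
    fix b
    have "\<bar>f (x + b)\<bar> \<le> \<bar>C\<bar>" using f[of "x + b"] by linarith
    from mult_right_mono[OF this normal_density_nonneg[of 0 "sqrt v" b]]
    show "norm (normal_density 0 (sqrt v) b * f (x + b)) \<le> norm (C * normal_density 0 (sqrt v) b)"
      by (simp add: abs_mult mult.commute)
  qed
qed simp

lemma heat_diff_le:
  assumes v: "v > 0" and f_meas [measurable]: "f \<in> borel_measurable borel" and f: "\<And>x. \<bar>f x\<bar> \<le> C"
    and lip: "\<And>x y. \<bar>f x - f y\<bar> \<le> C * \<bar>x - y\<bar>"
  shows "\<bar>heat v f x - f x\<bar> \<le> C * sqrt v"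
proof -
  note m = normal_moments[OF v, unfolded has_bochner_integral_iff]
  have "C \<ge> 0" using f[of 0] by linarith
  have "heat v f x - f x = (\<integral>b. normal_density 0 (sqrt v) b * (f (x + b) - f x) \<partial>lborel)"
    unfolding heat_def right_diff_distrib using heat_integrable[OF v f_meas f] m
    by (subst Bochner_Integration.integral_diff) auto
  also have "norm \<dots> \<le> (\<integral>b. C * (normal_density 0 (sqrt v) b * \<bar>b\<bar>) \<partial>lborel)"
  proof (rule Bochner_Integration.integral_norm_bound_integral)
    show "integrable lborel (\<lambda>b. normal_density 0 (sqrt v) b * (f (x + b) - f x))"
      unfolding right_diff_distrib using heat_integrable[OF v f_meas f] m by auto
    show "norm (normal_density 0 (sqrt v) b * (f (x + b) - f x)) \<le> C * (normal_density 0 (sqrt v) b * \<bar>b\<bar>)" for b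
      using mult_left_mono[OF lip[of "x + b" x] normal_density_nonneg[of 0 "sqrt v" b]]
      by (simp add: abs_mult mult_ac)
  qed (use m in auto)
  also have "\<dots> = C * (sqrt v * sqrt (2 / pi))" using m by simp
  also have "\<dots> \<le> C * sqrt v"
    using sqrt_2_pi_le_1 \<open>C \<ge> 0\<close> v by (intro mult_left_mono mult_left_le) auto
  finally show ?thesis by simp
qed

lemma taylor_cubic_remainder:
  fixes f f1 f2 :: "real \<Rightarrow> real"
  assumes f: "\<And>x. (f has_real_derivative f1 x) (at x)"
    and f1: "\<And>x. (f1 has_real_derivative f2 x) (at x)"
    and f2: "\<And>x y. \<bar>f2 x - f2 y\<bar> \<le> C * \<bar>x - y\<bar>"
  shows "\<bar>f (x + b) - f x - f1 x * b - f2 x * b\<^sup>2 / 2\<bar> \<le> C * \<bar>b\<bar> ^ 3"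
proof -
  have C: "C \<ge> 0" using order_trans[OF abs_ge_zero f2[of 1 0]] by simp
  define S where "S = cball x \<bar>b\<bar>"
  have S: "convex S" "x \<in> S" "x + b \<in> S" by (auto simp: S_def dist_real_def)
  have near: "\<bar>y - x\<bar> \<le> \<bar>b\<bar>" if "y \<in> S" for y
    using that by (simp add: S_def dist_real_def abs_minus_commute)
  have 1: "\<bar>f1 y - f1 x - f2 x * (y - x)\<bar> \<le> C * \<bar>b\<bar> * \<bar>b\<bar>" if y: "y \<in> S" for y
  proof -
    have "norm ((f1 y - f2 x * y) - (f1 x - f2 x * x)) \<le> C * \<bar>b\<bar> * norm (y - x)"
    proof (rule field_differentiable_bound[OF S(1), where f' = "\<lambda>z. f2 z - f2 x"])
      show "((\<lambda>z. f1 z - f2 x * z) has_field_derivative f2 z - f2 x) (at z within S)" for z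
        by (auto intro!: derivative_eq_intros has_field_derivative_at_within[OF f1])
      show "norm (f2 z - f2 x) \<le> C * \<bar>b\<bar>" if "z \<in> S" for z
        using f2[of z x] mult_left_mono[OF near[OF that] C] by simp
    qed (use S y in auto)
    also have "\<dots> \<le> C * \<bar>b\<bar> * \<bar>b\<bar>" using near[OF y] C by (intro mult_left_mono) auto
    finally show ?thesis by (simp add: algebra_simps)
  qed
  have "norm ((f (x + b) - f1 x * (x + b) - f2 x * (x + b - x)\<^sup>2 / 2) - (f x - f1 x * x - f2 x * (x - x)\<^sup>2 / 2))
      \<le> C * \<bar>b\<bar> * \<bar>b\<bar> * norm (x + b - x)"
  proof (rule field_differentiable_bound[OF S(1), where f' = "\<lambda>z. f1 z - f1 x - f2 x * (z - x)"])
    show "((\<lambda>z. f z - f1 x * z - f2 x * (z - x)\<^sup>2 / 2) has_field_derivative f1 z - f1 x - f2 x * (z - x)) (at z within S)" for z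
      by (auto intro!: derivative_eq_intros has_field_derivative_at_within[OF f])
    show "norm (f1 z - f1 x - f2 x * (z - x)) \<le> C * \<bar>b\<bar> * \<bar>b\<bar>" if "z \<in> S" for z
      using 1[OF that] by simp
  qed (use S in auto)
  then show ?thesis by (simp add: algebra_simps power3_eq_cube)
qed

lemma heat_taylor:
  fixes f f1 f2 :: "real \<Rightarrow> real"
  assumes v: "v > 0"
    and f: "\<And>x. (f has_real_derivative f1 x) (at x)"
    and f1: "\<And>x. (f1 has_real_derivative f2 x) (at x)"
    and f2: "\<And>x y. \<bar>f2 x - f2 y\<bar> \<le> C * \<bar>x - y\<bar>"
    and f0: "\<And>x. \<bar>f x\<bar> \<le> C"
  shows "\<bar>heat v f x - f x - v / 2 * f2 x\<bar> \<le> 2 * C * v * sqrt v"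
proof -
  note m = normal_moments[OF v, unfolded has_bochner_integral_iff]
  have "C \<ge> 0" using f0[of 0] by linarith
  have f_meas [measurable]: "f \<in> borel_measurable borel"
    using f by (intro borel_measurable_continuous_onI) (auto intro: DERIV_continuous_on)
  let ?n = "normal_density 0 (sqrt v)"
  let ?g = "\<lambda>b. ?n b * f (x + b) - f x * ?n b - f1 x * (?n b * b) - f2 x / 2 * (?n b * b\<^sup>2)"
  have "(\<integral>b. ?g b \<partial>lborel) = heat v f x - f x - v / 2 * f2 x"
    unfolding heat_def using heat_integrable[OF v f_meas f0] m by simp
  then have "\<bar>heat v f x - f x - v / 2 * f2 x\<bar> = norm (\<integral>b. ?g b \<partial>lborel)" by (simp only: real_norm_def)
  moreover have "norm (\<integral>b. ?g b \<partial>lborel) \<le> (\<integral>b. C * (?n b * \<bar>b\<bar> ^ 3) \<partial>lborel)"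
  proof (rule Bochner_Integration.integral_norm_bound_integral)
    show "integrable lborel ?g" using heat_integrable[OF v f_meas f0] m by auto
    show "norm (?g b) \<le> C * (?n b * \<bar>b\<bar> ^ 3)" for b
    proof -
      have "?g b = ?n b * (f (x + b) - f x - f1 x * b - f2 x * b\<^sup>2 / 2)" by (simp add: algebra_simps)
      then have "norm (?g b) = ?n b * \<bar>f (x + b) - f x - f1 x * b - f2 x * b\<^sup>2 / 2\<bar>"
        by (simp add: abs_mult)
      also have "\<dots> \<le> ?n b * (C * \<bar>b\<bar> ^ 3)"
        by (intro mult_left_mono taylor_cubic_remainder[OF f f1 f2]) auto
      finally show ?thesis by (simp add: mult_ac)
    qed
  qed (use m in auto)
  moreover have "(\<integral>b. C * (?n b * \<bar>b\<bar> ^ 3) \<partial>lborel) = C * (2 * v * sqrt v * sqrt (2 / pi))"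
    using m by simp
  moreover have "C * (2 * v * sqrt v * sqrt (2 / pi)) \<le> C * (2 * v * sqrt v)"
    using sqrt_2_pi_le_1 \<open>C \<ge> 0\<close> v by (intro mult_left_mono mult_left_le) auto
  ultimately have "\<bar>heat v f x - f x - v / 2 * f2 x\<bar> \<le> C * (2 * v * sqrt v)" by linarith
  then show ?thesis by (simp add: mult_ac)
qed

lemma heat_centered_square:
  assumes v: "v > 0" and f_meas [measurable]: "f \<in> borel_measurable borel" and f: "\<And>x. \<bar>f x\<bar> \<le> C"
    and lip: "\<And>x y. \<bar>f x - f y\<bar> \<le> C * \<bar>x - y\<bar>"
  shows "(\<integral>b. normal_density 0 (sqrt v) b * (f (x + b) - heat v f x) \<partial>lborel) = 0"
    and "(\<integral>b. normal_density 0 (sqrt v) b * (f (x + b) - heat v f x)\<^sup>2 \<partial>lborel) \<le> 4 * C\<^sup>2 * v"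
proof -
  note m = normal_moments[OF v, unfolded has_bochner_integral_iff]
  let ?n = "normal_density 0 (sqrt v)"
  have "C \<ge> 0" using f[of 0] by linarith
  show "(\<integral>b. ?n b * (f (x + b) - heat v f x) \<partial>lborel) = 0"
    unfolding right_diff_distrib using heat_integrable[OF v f_meas f] m
    by (subst Bochner_Integration.integral_diff) (auto simp: heat_def)
  have sq: "(f (x + b) - heat v f x)\<^sup>2 \<le> 2 * C\<^sup>2 * b\<^sup>2 + 2 * C\<^sup>2 * v" for b
  proof -
    define p q where "p = f (x + b) - f x" and "q = f x - heat v f x"
    have p: "p\<^sup>2 \<le> C\<^sup>2 * b\<^sup>2"
      using lip[of "x + b" x] \<open>C \<ge> 0\<close> unfolding p_def power_mult_distrib[symmetric]
      by (intro iffD2[OF abs_le_square_iff[symmetric]]) (auto simp: abs_mult abs_le_square_iff[symmetric])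
    have "\<bar>q\<bar> \<le> \<bar>C * sqrt v\<bar>"
      using heat_diff_le[OF v f_meas f lip, of x] unfolding q_def by linarith
    then have q: "q\<^sup>2 \<le> C\<^sup>2 * v"
      using v unfolding abs_le_square_iff by (simp add: power_mult_distrib)
    have "(p + q)\<^sup>2 \<le> 2 * p\<^sup>2 + 2 * q\<^sup>2"
      using zero_le_power2[of "p - q"] by (simp add: power2_eq_square algebra_simps)
    with p q show ?thesis by (simp add: p_def q_def)
  qed
  have bd: "\<bar>?n b * (f (x + b) - heat v f x)\<^sup>2\<bar> \<le> 2 * C\<^sup>2 * (?n b * b\<^sup>2) + 2 * C\<^sup>2 * v * ?n b" for b
    using mult_left_mono[OF sq[of b] normal_density_nonneg[of 0 "sqrt v" b]] by (simp add: algebra_simps)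
  have int: "integrable lborel (\<lambda>b. 2 * C\<^sup>2 * (?n b * b\<^sup>2) + 2 * C\<^sup>2 * v * ?n b)"
    using m by auto
  have "(\<integral>b. ?n b * (f (x + b) - heat v f x)\<^sup>2 \<partial>lborel)
      \<le> (\<integral>b. 2 * C\<^sup>2 * (?n b * b\<^sup>2) + 2 * C\<^sup>2 * v * ?n b \<partial>lborel)"
  proof (rule integral_mono)
    show "integrable lborel (\<lambda>b. ?n b * (f (x + b) - heat v f x)\<^sup>2)"
      by (rule Bochner_Integration.integrable_bound[OF int]) (use bd order_trans[OF _ abs_ge_self] in auto)
  qed (use bd int abs_le_D1 in blast)+
  also have "\<dots> = 4 * C\<^sup>2 * v" using m by simp
  finally show "(\<integral>b. ?n b * (f (x + b) - heat v f x)\<^sup>2 \<partial>lborel) \<le> 4 * C\<^sup>2 * v" .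
qed

lemma abs_heat_le:
  assumes v: "v > 0" and f_meas [measurable]: "f \<in> borel_measurable borel" and f: "\<And>x. \<bar>f x\<bar> \<le> C"
  shows "\<bar>heat v f x\<bar> \<le> C"
proof -
  note m = normal_moments[OF v, unfolded has_bochner_integral_iff]
  have "norm (heat v f x) \<le> (\<integral>b. C * normal_density 0 (sqrt v) b \<partial>lborel)"
    unfolding heat_def
  proof (rule Bochner_Integration.integral_norm_bound_integral)
    show "norm (normal_density 0 (sqrt v) b * f (x + b)) \<le> C * normal_density 0 (sqrt v) b" for b
      using mult_left_mono[OF f[of "x + b"] normal_density_nonneg[of 0 "sqrt v" b]] by (simp add: abs_mult mult_ac)
  qed (use m heat_integrable[OF v f_meas f] in auto)
  then show ?thesis using m by simp
qed

lemma borel_measurable_heat [measurable]: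
  assumes [measurable]: "f \<in> borel_measurable borel"
  shows "heat v f \<in> borel_measurable borel"
  unfolding heat_def[abs_def] by measurable

section \<open>Functions of Brownian increments\<close>

locale brownian =
  fixes M :: "'a measure" and F :: "real \<Rightarrow> 'a measure" and B :: "real \<Rightarrow> 'a \<Rightarrow> real"
  assumes bm: "brownian_motion_wrt M F B"
begin

lemma prob_space_M: "prob_space M"
  using bm by (simp add: brownian_motion_wrt_def filtered_prob_space_def)

sublocale prob_space M by (rule prob_space_M)

lemma space_F: "space (F s) = space M" and sets_F: "sets (F s) \<subseteq> sets M"
  using bm by (auto simp: brownian_motion_wrt_def filtered_prob_space_def subalgebra_def)

lemma F_measurable_M: "X \<in> measurable (F s) N \<Longrightarrow> X \<in> measurable M N"
  using space_F[of s] sets_F[of s] unfolding measurable_def by auto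

lemma F_mono: "X \<in> measurable (F s) N \<Longrightarrow> s \<le> t \<Longrightarrow> X \<in> measurable (F t) N"
proof -
  assume X: "X \<in> measurable (F s) N" and st: "s \<le> t"
  have "sets (F s) \<subseteq> sets (F t)"
    using bm st unfolding brownian_motion_wrt_def filtered_prob_space_def filtration_def by blast
  with X space_F[of s] space_F[of t] show ?thesis unfolding measurable_def by auto
qed

lemma B_measurable_F: "0 \<le> s \<Longrightarrow> s \<le> t \<Longrightarrow> B s \<in> borel_measurable (F t)"
  using bm F_mono unfolding brownian_motion_wrt_def adapted_def by blast

lemma B_measurable: "0 \<le> s \<Longrightarrow> B s \<in> borel_measurable M"
  using B_measurable_F F_measurable_M by blast

text \<open>
  The increment can be integrated out while everything known at time \<open>s\<close> is kept fixed. This takes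
  the place of a conditional expectation.
\<close>

lemma expectation_increment:
  fixes u :: "real \<Rightarrow> real \<Rightarrow> real"
  assumes st: "0 \<le> s" "s < t" and X: "X \<in> borel_measurable (F s)" and Z: "Z \<in> borel_measurable (F s)"
    and u [measurable]: "case_prod u \<in> borel_measurable (borel \<Otimes>\<^sub>M borel)"
    and Zb: "\<And>\<omega>. \<bar>Z \<omega>\<bar> \<le> K" and ub: "\<And>x b. \<bar>u x b\<bar> \<le> L"
  shows "expectation (\<lambda>\<omega>. Z \<omega> * u (X \<omega>) (B t \<omega> - B s \<omega>))
       = expectation (\<lambda>\<omega>. Z \<omega> * (\<integral>b. normal_density 0 (sqrt (t - s)) b * u (X \<omega>) b \<partial>lborel))"
proof -
  let ?D = "\<lambda>\<omega>. B t \<omega> - B s \<omega>" and ?D' = "\<lambda>\<omega>. (B t \<omega> - B s \<omega>, 0 :: real)" and ?Y = "\<lambda>\<omega>. (Z \<omega>, X \<omega>)" and ?BB = "borel \<Otimes>\<^sub>M borel :: (real \<times> real) measure"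
  have dist: "distributed M lborel ?D (\<lambda>x. ennreal (normal_density 0 (sqrt (t - s)) x))"
    and ind: "indep_set (sets (F s)) (sets (vimage_algebra (space M) ?D borel))"
    using bm st unfolding brownian_motion_wrt_def by blast+
  have YF: "?Y \<in> measurable (F s) ?BB" using X Z by measurable
  have Y [measurable]: "?Y \<in> measurable M ?BB" using YF by (rule F_measurable_M)
  have D [measurable]: "?D \<in> borel_measurable M" using st B_measurable[of s] B_measurable[of t] by auto
  (* the increment is padded with 0 because indep_var speaks of two variables of one type *)
  have "indep_set (sigma_sets (space M) {?Y -` A \<inter> space M |A. A \<in> sets ?BB})
      (sigma_sets (space M) {?D' -` A \<inter> space M |A. A \<in> sets ?BB})"
    unfolding indep_set_def
  proof (rule indep_sets_mono_sets[OF ind[unfolded indep_set_def]])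
    fix i :: bool
    have "sigma_sets (space (F s)) {?Y -` A \<inter> space M |A. A \<in> sets ?BB} \<subseteq> sets (F s)"
      using measurable_sets[OF YF] space_F[of s] by (intro sets.sigma_sets_subset) auto
    moreover have "sigma_sets (space (vimage_algebra (space M) ?D borel)) {?D' -` A \<inter> space M |A. A \<in> sets ?BB}
        \<subseteq> sets (vimage_algebra (space M) ?D borel)"
    proof (rule sets.sigma_sets_subset)
      have "?D' \<in> measurable (vimage_algebra (space M) ?D borel) ?BB"
        by (intro measurable_Pair measurable_vimage_algebra1 measurable_const) auto
      then show "{?D' -` A \<inter> space M |A. A \<in> sets ?BB} \<subseteq> sets (vimage_algebra (space M) ?D borel)"
        using measurable_sets[of ?D' "vimage_algebra (space M) ?D borel" ?BB]
        by (auto simp only: space_vimage_algebra)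
    qed
    ultimately show "case_bool (sigma_sets (space M) {?Y -` A \<inter> space M |A. A \<in> sets ?BB})
        (sigma_sets (space M) {?D' -` A \<inter> space M |A. A \<in> sets ?BB}) i
        \<subseteq> case_bool (sets (F s)) (sets (vimage_algebra (space M) ?D borel)) i"
      by (cases i) (auto simp: space_F)
  qed
  then have "indep_var ?BB ?Y ?BB ?D'" by (simp add: indep_var_eq)
  then have joint: "distr M ?BB ?Y \<Otimes>\<^sub>M distr M ?BB ?D' = distr M (?BB \<Otimes>\<^sub>M ?BB) (\<lambda>\<omega>. (?Y \<omega>, ?D' \<omega>))"
    by (simp add: indep_var_distribution_eq)
  interpret P1: prob_space "distr M ?BB ?Y" by (rule prob_space_distr) simp
  interpret P2: prob_space "distr M ?BB ?D'" by (rule prob_space_distr) simp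
  interpret P: pair_prob_space "distr M ?BB ?Y" "distr M ?BB ?D'" ..
  let ?g = "\<lambda>p :: (real \<times> real) \<times> (real \<times> real). fst (fst p) * u (snd (fst p)) (fst (snd p))"
  have KL: "K \<ge> 0" "L \<ge> 0" using Zb[of undefined] ub[of 0 0] by linarith+
  have [measurable]: "?g \<in> borel_measurable (?BB \<Otimes>\<^sub>M ?BB)" by measurable
  have "integrable M (\<lambda>\<omega>. ?g (?Y \<omega>, ?D' \<omega>))"
    by (rule integrable_const_bound[of _ "K * L"])
       (use KL in \<open>auto simp: abs_mult intro!: mult_mono Zb ub\<close>)
  then have gi: "integrable (distr M ?BB ?Y \<Otimes>\<^sub>M distr M ?BB ?D') ?g"
    unfolding joint by (subst integrable_distr_eq) auto
  have "expectation (\<lambda>\<omega>. Z \<omega> * u (X \<omega>) (?D \<omega>)) = integral\<^sup>L (distr M ?BB ?Y \<Otimes>\<^sub>M distr M ?BB ?D') ?g"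
    unfolding joint by (subst integral_distr) auto
  also have "\<dots> = (\<integral>y. (\<integral>b. ?g (y, b) \<partial>distr M ?BB ?D') \<partial>distr M ?BB ?Y)"
    by (rule P.integral_fst'[OF gi, symmetric])
  also have "\<dots> = (\<integral>y. fst y * (\<integral>b. normal_density 0 (sqrt (t - s)) b * u (snd y) b \<partial>lborel) \<partial>distr M ?BB ?Y)"
  proof (rule Bochner_Integration.integral_cong[OF refl])
    fix y :: "real \<times> real"
    have "(\<integral>b. u (snd y) (fst b) \<partial>distr M ?BB ?D') = expectation (\<lambda>\<omega>. u (snd y) (?D \<omega>))"
      by (subst integral_distr) auto
    also have "\<dots> = (\<integral>b. normal_density 0 (sqrt (t - s)) b * u (snd y) b \<partial>lborel)"
      by (rule distributed_integral[OF dist, symmetric]) auto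
    finally show "(\<integral>b. ?g (y, b) \<partial>distr M ?BB ?D') =
        fst y * (\<integral>b. normal_density 0 (sqrt (t - s)) b * u (snd y) b \<partial>lborel)" by simp
  qed
  also have "\<dots> = expectation (\<lambda>\<omega>. Z \<omega> * (\<integral>b. normal_density 0 (sqrt (t - s)) b * u (X \<omega>) b \<partial>lborel))"
    by (subst integral_distr) auto
  finally show ?thesis .
qed

text \<open>
  The summands are martingale differences: each is centred given the past, so the mixed terms in the
  square of the sum vanish and only the sum of the variances remains.
\<close>

lemma noise_sum_L2:
  fixes X :: "real \<Rightarrow> 'a \<Rightarrow> real" and tt :: "nat \<Rightarrow> real" and f :: "real \<Rightarrow> real"
  assumes v: "v > 0" and t: "\<And>i. tt i \<ge> 0" "\<And>i. tt (Suc i) = tt i + v"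
    and X: "adapted F X"
    and f_meas [measurable]: "f \<in> borel_measurable borel" and f: "\<And>x. \<bar>f x\<bar> \<le> C"
    and lip: "\<And>x y. \<bar>f x - f y\<bar> \<le> C * \<bar>x - y\<bar>"
  defines "e \<equiv> (\<lambda>i \<omega>. f (X (tt i) \<omega> + (B (tt (Suc i)) \<omega> - B (tt i) \<omega>)) - heat v f (X (tt i) \<omega>))"
  shows "expectation (\<lambda>\<omega>. e k \<omega>) = 0"
    and "expectation (\<lambda>\<omega>. (\<Sum>i<k. e i \<omega>)\<^sup>2) \<le> real k * (4 * C\<^sup>2 * v)"
proof -
  have C: "C \<ge> 0" using f[of 0] by linarith
  have mono: "tt i \<le> tt j" if "i \<le> j" for i j
    by (rule lift_Suc_mono_le[OF _ that]) (use t(2) v in auto)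
  have XF: "X (tt i) \<in> borel_measurable (F (tt i))" for i using X t(1) by (simp add: adapted_def)
  have eF: "e i \<in> borel_measurable (F (tt j))" if "i < j" for i j
  proof -
    have [measurable]: "X (tt i) \<in> borel_measurable (F (tt j))" "B (tt i) \<in> borel_measurable (F (tt j))"
      "B (tt (Suc i)) \<in> borel_measurable (F (tt j))"
      using that mono[of i j] mono[of "Suc i" j] XF[of i] t(1) F_mono B_measurable_F by auto
    show ?thesis unfolding e_def by measurable
  qed
  have eM [measurable]: "e i \<in> borel_measurable M" for i
    using eF[of i "Suc i"] F_measurable_M by blast
  have eb: "\<bar>e i \<omega>\<bar> \<le> 2 * C" for i \<omega>
    unfolding e_def using f[of "X (tt i) \<omega> + (B (tt (Suc i)) \<omega> - B (tt i) \<omega>)"]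
      abs_heat_le[OF v f_meas f, of "X (tt i) \<omega>"] by linarith
  define S where "S k \<omega> = (\<Sum>i<k. e i \<omega>)" for k \<omega>
  have SF: "S k \<in> borel_measurable (F (tt k))" for k
    unfolding S_def[abs_def] by (intro borel_measurable_sum eF) auto
  have SM [measurable]: "S k \<in> borel_measurable M" for k using SF F_measurable_M by blast
  have Sb: "\<bar>S k \<omega>\<bar> \<le> real k * (2 * C)" for k \<omega>
    unfolding S_def using sum_norm_bound[of "{..<k}" "\<lambda>i. e i \<omega>" "2 * C"] eb by simp
  have u_meas: "case_prod (\<lambda>x b. f (x + b) - heat v f x) \<in> borel_measurable (borel \<Otimes>\<^sub>M borel)"
    by measurable
  have u2_meas: "case_prod (\<lambda>x b. (f (x + b) - heat v f x)\<^sup>2) \<in> borel_measurable (borel \<Otimes>\<^sub>M borel)"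
    by measurable
  have ub: "\<bar>f (x + b) - heat v f x\<bar> \<le> 2 * C" for x b
    using f[of "x + b"] abs_heat_le[OF v f_meas f, of x] by linarith
  have u2b: "\<bar>(f (x + b) - heat v f x)\<^sup>2\<bar> \<le> (2 * C)\<^sup>2" for x b
    using ub[of x b] C abs_le_square_iff[of "f (x + b) - heat v f x" "2 * C"] by simp
  have orth: "expectation (\<lambda>\<omega>. Z \<omega> * e k \<omega>) = 0"
    if "Z \<in> borel_measurable (F (tt k))" "\<And>\<omega>. \<bar>Z \<omega>\<bar> \<le> K" for Z K k
    using expectation_increment[OF t(1)[of k] _ XF that(1) u_meas that(2) ub, of "tt (Suc k)"] v
    by (simp add: e_def t(2) heat_centered_square(1)[OF v f_meas f lip])
  show "expectation (\<lambda>\<omega>. e k \<omega>) = 0" using orth[of "\<lambda>_. 1" k 1] by simp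
  have sq: "expectation (\<lambda>\<omega>. (e k \<omega>)\<^sup>2) \<le> 4 * C\<^sup>2 * v" for k
  proof -
    have "expectation (\<lambda>\<omega>. (e k \<omega>)\<^sup>2)
       = expectation (\<lambda>\<omega>. \<integral>b. normal_density 0 (sqrt v) b * (f (X (tt k) \<omega> + b) - heat v f (X (tt k) \<omega>))\<^sup>2 \<partial>lborel)"
      using expectation_increment[OF t(1)[of k] _ XF _ u2_meas _ u2b, of "tt (Suc k)" "\<lambda>_. 1" 1] v
      by (simp add: e_def t(2))
    also have "\<dots> \<le> expectation (\<lambda>\<omega>. 4 * C\<^sup>2 * v)"
    proof (rule integral_mono')
      show "integrable M (\<lambda>\<omega>. 4 * C\<^sup>2 * v)" by simp
    qed (use heat_centered_square(2)[OF v f_meas f lip] v in auto)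
    finally show ?thesis by (simp add: prob_space)
  qed
  have "expectation (\<lambda>\<omega>. (S k \<omega>)\<^sup>2) \<le> real k * (4 * C\<^sup>2 * v)" for k
  proof (induction k)
    case (Suc k)
    have i1: "integrable M (\<lambda>\<omega>. (S k \<omega>)\<^sup>2)"
      by (rule integrable_const_bound[of _ "(real k * (2 * C))\<^sup>2"])
         (use Sb C in \<open>auto simp: abs_le_square_iff[symmetric] abs_mult\<close>)
    have i2: "integrable M (\<lambda>\<omega>. S k \<omega> * e k \<omega>)"
      by (rule integrable_const_bound[of _ "(real k * (2 * C)) * (2 * C)"])
         (use C in \<open>auto simp only: real_norm_def abs_mult intro!: AE_I2 mult_mono Sb eb borel_measurable_times SM eM mult_nonneg_nonneg\<close>)
    have i3: "integrable M (\<lambda>\<omega>. (e k \<omega>)\<^sup>2)"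
      by (rule integrable_const_bound[of _ "(2 * C)\<^sup>2"])
         (use power_mono[OF eb[of k] abs_ge_zero, of _ 2] in auto)
    have "(\<lambda>\<omega>. (S (Suc k) \<omega>)\<^sup>2) = (\<lambda>\<omega>. (S k \<omega>)\<^sup>2 + 2 * (S k \<omega> * e k \<omega>) + (e k \<omega>)\<^sup>2)"
      by (auto simp: S_def power2_eq_square algebra_simps)
    then have "expectation (\<lambda>\<omega>. (S (Suc k) \<omega>)\<^sup>2)
        = expectation (\<lambda>\<omega>. (S k \<omega>)\<^sup>2) + 2 * expectation (\<lambda>\<omega>. S k \<omega> * e k \<omega>) + expectation (\<lambda>\<omega>. (e k \<omega>)\<^sup>2)"
      using i1 i2 i3 by simp
    then show ?case
      using Suc sq[of k] orth[OF SF[of k] Sb[of k]] by (simp add: algebra_simps)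
  qed (simp add: S_def)
  then show "expectation (\<lambda>\<omega>. (\<Sum>i<k. e i \<omega>)\<^sup>2) \<le> real k * (4 * C\<^sup>2 * v)"
    by (simp add: S_def)
qed

end

section \<open>The expected Ito formula\<close>

lemma (in prob_space) abs_expectation_le:
  fixes f g :: "'a \<Rightarrow> real"
  assumes "integrable M f" "integrable M g" "\<And>\<omega>. \<bar>f \<omega>\<bar> \<le> g \<omega>"
  shows "\<bar>expectation f\<bar> \<le> expectation g"
proof -
  have "\<bar>expectation f\<bar> \<le> expectation (\<lambda>\<omega>. \<bar>f \<omega>\<bar>)" by (rule integral_abs_bound)
  also have "\<dots> \<le> expectation g" by (rule integral_mono) (use assms in auto)
  finally show ?thesis .
qed

text \<open>
  Boundedness in \<open>L\<^sup>2\<close> implies uniform integrability: the part of \<open>D n\<close> above level \<open>c\<close> contributes at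
  most \<open>K / c\<close>.
\<close>

lemma (in prob_space) expectation_tendsto_0_of_L2_bound:
  fixes D :: "nat \<Rightarrow> 'a \<Rightarrow> real"
  assumes [measurable]: "\<And>n. D n \<in> borel_measurable M"
    and lim: "AE \<omega> in M. (\<lambda>n. D n \<omega>) \<longlonglongrightarrow> 0"
    and int: "\<And>n. integrable M (\<lambda>\<omega>. (D n \<omega>)\<^sup>2)"
    and L2: "\<And>n. expectation (\<lambda>\<omega>. (D n \<omega>)\<^sup>2) \<le> K"
  shows "(\<lambda>n. expectation (D n)) \<longlonglongrightarrow> 0"
proof (rule LIMSEQ_I)
  fix e :: real assume e: "e > 0"
  have K: "K \<ge> 0" using order_trans[OF _ L2[of 0]] by (simp add: integral_nonneg_AE)
  (* the truncation level is chosen such that K / c is at most e / 2 *)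
  define c where "c = 2 * K / e + 1"
  have c: "c > 0" using K e by (simp add: c_def add_nonneg_pos)
  have "(\<lambda>n. expectation (\<lambda>\<omega>. min \<bar>D n \<omega>\<bar> c)) \<longlonglongrightarrow> expectation (\<lambda>\<omega>. 0)"
  proof (rule integral_dominated_convergence[where w = "\<lambda>_. c"])
    show "AE \<omega> in M. (\<lambda>n. min \<bar>D n \<omega>\<bar> c) \<longlonglongrightarrow> 0"
      using lim
    proof eventually_elim
      case (elim \<omega>)
      have "(\<lambda>n. min \<bar>D n \<omega>\<bar> c) \<longlonglongrightarrow> min \<bar>0\<bar> c"
        by (intro tendsto_min tendsto_rabs tendsto_const elim)
      with c show ?case by simp
    qed
  qed (use c in auto)
  from LIMSEQ_D[OF this, of "e / 2"] e
  obtain N where "\<forall>n\<ge>N. norm (expectation (\<lambda>\<omega>. min \<bar>D n \<omega>\<bar> c) - expectation (\<lambda>\<omega>. 0)) < e / 2" by auto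
  then have N: "\<bar>expectation (\<lambda>\<omega>. min \<bar>D n \<omega>\<bar> c)\<bar> < e / 2" if "n \<ge> N" for n
    using that by simp
  show "\<exists>N. \<forall>n\<ge>N. norm (expectation (D n) - 0) < e"
  proof (intro exI[of _ N] allI impI)
    fix n assume n: "n \<ge> N"
    have i1: "integrable M (\<lambda>\<omega>. min \<bar>D n \<omega>\<bar> c)"
      by (rule integrable_const_bound[of _ c]) (use c in auto)
    have i2: "integrable M (\<lambda>\<omega>. min \<bar>D n \<omega>\<bar> c + (D n \<omega>)\<^sup>2 / c)"
      using i1 int by auto
    have bd: "\<bar>D n \<omega>\<bar> \<le> min \<bar>D n \<omega>\<bar> c + (D n \<omega>)\<^sup>2 / c" for \<omega>
    proof (cases "\<bar>D n \<omega>\<bar> \<le> c")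
      case False
      then have "\<bar>D n \<omega>\<bar> * c \<le> \<bar>D n \<omega>\<bar> * \<bar>D n \<omega>\<bar>" by (intro mult_left_mono) auto
      then have "\<bar>D n \<omega>\<bar> \<le> (D n \<omega>)\<^sup>2 / c" using c by (simp add: pos_le_divide_eq power2_eq_square)
      with c show ?thesis by (simp add: min_def)
    qed (use c in simp)
    have iD: "integrable M (D n)"
      by (rule Bochner_Integration.integrable_bound[OF i2])
         (use bd in \<open>auto intro!: AE_I2 order_trans[OF bd abs_ge_self]\<close>)
    have "norm (expectation (D n)) \<le> expectation (\<lambda>\<omega>. min \<bar>D n \<omega>\<bar> c + (D n \<omega>)\<^sup>2 / c)"
      unfolding real_norm_def by (rule abs_expectation_le[OF iD i2 bd])
    also have "\<dots> = expectation (\<lambda>\<omega>. min \<bar>D n \<omega>\<bar> c) + expectation (\<lambda>\<omega>. (D n \<omega>)\<^sup>2) / c"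
      using i1 int[of n] by simp
    also have "\<dots> < e / 2 + e / 2"
    proof (rule add_less_le_mono)
      show "expectation (\<lambda>\<omega>. min \<bar>D n \<omega>\<bar> c) < e / 2" using N[OF n] by linarith
      have "expectation (\<lambda>\<omega>. (D n \<omega>)\<^sup>2) / c \<le> K / c" using L2[of n] c by (intro divide_right_mono) auto
      also have "\<dots> \<le> e / 2"
      proof -
        have "e * c = 2 * K + e" using e by (simp add: c_def algebra_simps)
        then show ?thesis using c e by (simp add: pos_divide_le_eq)
      qed
      finally show "expectation (\<lambda>\<omega>. (D n \<omega>)\<^sup>2) / c \<le> e / 2" .
    qed
    finally show "norm (expectation (D n) - 0) < e" by simp
  qed
qed

locale bessel =
  fixes M :: "'a measure" and F :: "real \<Rightarrow> 'a measure" and B R :: "real \<Rightarrow> 'a \<Rightarrow> real"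
  assumes hb: "hyperbolic_bessel_0 M F B R"
begin

sublocale brownian M F B
  using hb unfolding hyperbolic_bessel_0_def by unfold_locales (elim conjE)

lemma R_adapted: "adapted F R"
  using hb unfolding hyperbolic_bessel_0_def by (elim conjE)

lemma R_measurable: "0 \<le> t \<Longrightarrow> R t \<in> borel_measurable M"
  using R_adapted F_measurable_M unfolding adapted_def by blast

lemma AE_B: "AE \<omega> in M. B 0 \<omega> = 0 \<and> continuous_on {0..} (\<lambda>t. B t \<omega>)"
  using bm unfolding brownian_motion_wrt_def by (elim conjE)

lemma AE_R: "AE \<omega> in M. continuous_on {0..} (\<lambda>t. R t \<omega>) \<and>
        (\<forall>t\<ge>0. R t \<omega> \<ge> 0 \<and>
           (\<integral>\<^sup>+u\<in>{0..t}. coth (R u \<omega>) \<partial>lborel) < \<infinity> \<and>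
           R t \<omega> = B t \<omega> + 1 / 2 * enn2real (\<integral>\<^sup>+u\<in>{0..t}. coth (R u \<omega>) \<partial>lborel))"
  using hb unfolding hyperbolic_bessel_0_def by (elim conjE)

lemma AE_R_nonneg: "t \<ge> 0 \<Longrightarrow> AE \<omega> in M. R t \<omega> \<ge> 0"
  using AE_R by eventually_elim blast

lemma AE_R_0: "AE \<omega> in M. R 0 \<omega> = 0"
  using AE_R AE_B
proof eventually_elim
  case (elim \<omega>)
  have null: "(\<integral>\<^sup>+u\<in>{0..0}. coth (R u \<omega>) \<partial>lborel) = (\<integral>\<^sup>+u. 0 \<partial>(lborel :: real measure))"
  proof (rule nn_integral_cong_AE)
    show "AE u in lborel. coth (R u \<omega>) * indicator {0..0} u = 0"
      using AE_lborel_singleton[of "0 :: real"] by eventually_elim auto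
  qed
  have "R 0 \<omega> = B 0 \<omega> + 1 / 2 * enn2real (\<integral>\<^sup>+u\<in>{0..0}. coth (R u \<omega>) \<partial>lborel)" and B0: "B 0 \<omega> = 0"
    using elim by blast+
  from this(1)[unfolded null B0] show ?case by simp
qed

text \<open>
  Continuity in time of the means makes their Riemann sums converge.
\<close>

lemma mean_continuous:
  fixes f :: "real \<Rightarrow> real" and C :: real
  assumes "continuous_on UNIV f" and f: "\<And>x. \<bar>f x\<bar> \<le> C"
  shows "continuous_on {0..} (\<lambda>t. expectation (\<lambda>\<omega>. f (R t \<omega>)))"
  unfolding continuous_on_sequentially
proof (intro allI ballI impI)
  fix s :: "nat \<Rightarrow> real" and t assume t: "t \<in> {0..}" and s: "(\<forall>n. s n \<in> {0..}) \<and> s \<longlonglongrightarrow> t"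
  have [measurable]: "f \<in> borel_measurable borel" using assms(1) by (rule borel_measurable_continuous_onI)
  have [measurable]: "R (s n) \<in> borel_measurable M" "R t \<in> borel_measurable M" for n
    using s t by (auto intro: R_measurable)
  show "((\<lambda>t. expectation (\<lambda>\<omega>. f (R t \<omega>))) \<circ> s) \<longlonglongrightarrow> expectation (\<lambda>\<omega>. f (R t \<omega>))"
    unfolding comp_def
  proof (rule integral_dominated_convergence[where w = "\<lambda>_. C"])
    show "AE \<omega> in M. (\<lambda>n. f (R (s n) \<omega>)) \<longlonglongrightarrow> f (R t \<omega>)"
      using AE_R
    proof eventually_elim
      case (elim \<omega>)
      then have "continuous_on {0..} (\<lambda>t. R t \<omega>)" by blast
      then have "continuous_on {0..} (\<lambda>t. f (R t \<omega>))"
        by (rule continuous_on_compose2[OF assms(1)]) auto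
      with s t show ?case unfolding continuous_on_sequentially comp_def by blast
    qed
  qed (use f in auto)
qed

text \<open>
  The random variable \<open>D n\<close> below is the drift sum minus the Riemann sum of its limit. Along almost every
  path it tends to 0. Telescoping expresses it through \<open>f (R T) - f (R 0)\<close>, the centred noise
  \<open>e n i\<close> and bounded terms, which gives the bound in \<open>L\<^sup>2\<close>; the same expression shows that its
  expectation is, up to the Taylor error of the smoothing, the difference of the two sides of the
  claimed formula with the integral replaced by a Riemann sum.
\<close>

lemma expectation_ito:
  fixes f f1 f2 g :: "real \<Rightarrow> real" and C T :: real
  assumes T: "T > 0"
    and f: "\<And>x. (f has_real_derivative f1 x) (at x)"
    and f1: "\<And>x. (f1 has_real_derivative f2 x) (at x)"
    and b0: "\<And>x. \<bar>f x\<bar> \<le> C" and b1: "\<And>x. \<bar>f1 x\<bar> \<le> C" and b2: "\<And>x. \<bar>f2 x\<bar> \<le> C"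
    and lip2: "\<And>x y. \<bar>f2 x - f2 y\<bar> \<le> C * \<bar>x - y\<bar>"
    and g: "continuous_on UNIV g" and bg: "\<And>x. \<bar>g x\<bar> \<le> C"
    and fg: "\<And>x. x > 0 \<Longrightarrow> g x = (f2 x + cosh x / sinh x * f1 x) / 2"
  shows "expectation (\<lambda>\<omega>. f (R T \<omega>)) - f 0 = integral {0..T} (\<lambda>s. expectation (\<lambda>\<omega>. g (R s \<omega>)))"
proof -
  have cancel: "x - (x - y) = y" for x y :: real by simp
  have C: "C \<ge> 0" using b0[of 0] by linarith
  have lip0: "\<bar>f x - f y\<bar> \<le> C * \<bar>x - y\<bar>" for x y
    using field_differentiable_bound[of UNIV f f1 C x y] f b1 by simp
  have lip1: "\<bar>f1 x - f1 y\<bar> \<le> C * \<bar>x - y\<bar>" for x y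
    using field_differentiable_bound[of UNIV f1 f2 C x y] f1 b2 by simp
  have f2c: "continuous_on UNIV f2"
    by (rule lipschitz_on_continuous_on[of C]) (use lip2 C in \<open>auto intro!: lipschitz_onI simp: dist_real_def\<close>)
  have meas [measurable]: "f \<in> borel_measurable borel" "f2 \<in> borel_measurable borel" "g \<in> borel_measurable borel"
    using f f2c g by (auto intro!: borel_measurable_continuous_onI intro: DERIV_continuous_on)
  (* the continuous extension of coth * f1 to the whole line *)
  define h where "h x = 2 * g x - f2 x" for x
  have hc: "continuous_on UNIV h" unfolding h_def[abs_def] by (intro continuous_intros g f2c)
  have hf: "h x = cosh x / sinh x * f1 x" if "x > 0" for x using fg[OF that] by (simp add: h_def)
  have [measurable]: "h \<in> borel_measurable borel" using hc by (rule borel_measurable_continuous_onI)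
  have hb: "\<bar>h x\<bar> \<le> 3 * C" for x unfolding h_def using bg[of x] b2[of x] by linarith
  define tt where "tt n i = T * real i / real (Suc n)" for n i
  define v where "v n = T / real (Suc n)" for n
  have v: "v n > 0" for n using T by (simp add: v_def)
  have tt0: "tt n i \<ge> 0" for n i using T by (simp add: tt_def)
  have ttS: "tt n (Suc i) = tt n i + v n" for n i
  proof -
    have "T * real (Suc i) = T * real i + T" by (simp add: algebra_simps)
    then show ?thesis by (simp only: tt_def v_def add_divide_distrib)
  qed
  have vn: "real (Suc n) * v n = T" for n by (simp add: v_def)
  have [measurable]: "R (tt n i) \<in> borel_measurable M" "B (tt n i) \<in> borel_measurable M" for n i
    using tt0 by (auto intro: R_measurable B_measurable)
  have [measurable]: "R T \<in> borel_measurable M" "R 0 \<in> borel_measurable M" using T by (auto intro: R_measurable)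
  define x where "x n i \<omega> = R (tt n i) \<omega> + (B (tt n (Suc i)) \<omega> - B (tt n i) \<omega>)" for n i \<omega>
  have [measurable]: "x n i \<in> borel_measurable M" for n i unfolding x_def[abs_def] by measurable
  define e where "e n i \<omega> = f (x n i \<omega>) - heat (v n) f (R (tt n i) \<omega>)" for n i \<omega>
  have [measurable]: "e n i \<in> borel_measurable M" for n i unfolding e_def[abs_def] by measurable
  (* the conditional mean of the noise part of one step *)
  define p where "p n i \<omega> = heat (v n) f (R (tt n i) \<omega>) - f (R (tt n i) \<omega>)" for n i \<omega>
  define D where "D n \<omega> = (\<Sum>i<Suc n. f (R (tt n (Suc i)) \<omega>) - f (x n i \<omega>)) - v n / 2 * (\<Sum>i<Suc n. h (R (tt n i) \<omega>))" for n \<omega>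
  have [measurable]: "D n \<in> borel_measurable M" for n unfolding D_def[abs_def] by measurable
  have D_eq: "D n \<omega> = f (R T \<omega>) - f (R 0 \<omega>) - (\<Sum>i<Suc n. e n i \<omega>) - (\<Sum>i<Suc n. p n i \<omega> + v n / 2 * h (R (tt n i) \<omega>))" for n \<omega>
  proof -
    have "(\<Sum>i<Suc n. f (R (tt n (Suc i)) \<omega>) - f (R (tt n i) \<omega>)) = f (R (tt n (Suc n)) \<omega>) - f (R (tt n 0) \<omega>)"
      by (rule sum_lessThan_telescope)
    moreover have "tt n (Suc n) = T" "tt n 0 = 0" by (simp_all add: tt_def del: of_nat_Suc)
    ultimately have tel: "f (R T \<omega>) - f (R 0 \<omega>) = (\<Sum>i<Suc n. f (R (tt n (Suc i)) \<omega>) - f (R (tt n i) \<omega>))" by (simp only:)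
    show ?thesis
      unfolding D_def tel e_def p_def
      by (simp only: sum_distrib_left sum_subtractf[symmetric]) (simp add: sum_subtractf sum.distrib algebra_simps)
  qed
  have pb: "\<bar>p n i \<omega> - v n / 2 * f2 (R (tt n i) \<omega>)\<bar> \<le> 2 * C * v n * sqrt (v n)" for n i \<omega>
    unfolding p_def by (rule heat_taylor[OF v f f1 lip2 b0])
  have vT: "v n \<le> T" for n using T by (simp add: v_def divide_le_eq)
  define K where "K = 2 * C + T * (2 * C + 2 * C * sqrt T)"
  have rest: "\<bar>f (R T \<omega>) - f (R 0 \<omega>) - (\<Sum>i<Suc n. p n i \<omega> + v n / 2 * h (R (tt n i) \<omega>))\<bar> \<le> K" for n \<omega>
  proof -
    have "\<bar>p n i \<omega> + v n / 2 * h (R (tt n i) \<omega>)\<bar> \<le> v n * (2 * C + 2 * C * sqrt T)" for i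
    proof -
      have "\<bar>v n / 2 * f2 (R (tt n i) \<omega>)\<bar> \<le> v n / 2 * C" "\<bar>v n / 2 * h (R (tt n i) \<omega>)\<bar> \<le> v n / 2 * (3 * C)"
        unfolding abs_mult using v[of n] b2 hb by (auto intro!: mult_mono)
      moreover have "2 * C * v n * sqrt (v n) \<le> 2 * C * v n * sqrt T"
        using C v[of n] vT[of n] by (intro mult_left_mono) auto
      moreover have "v n * (2 * C + 2 * C * sqrt T) = v n / 2 * C + v n / 2 * (3 * C) + 2 * C * v n * sqrt T"
        by (simp add: algebra_simps)
      ultimately show ?thesis using pb[of n i \<omega>] by linarith
    qed
    then have "\<bar>\<Sum>i<Suc n. p n i \<omega> + v n / 2 * h (R (tt n i) \<omega>)\<bar> \<le> (\<Sum>i<Suc n. v n * (2 * C + 2 * C * sqrt T))"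
      by (intro order_trans[OF sum_abs sum_mono]) auto
    also have "\<dots> = (real (Suc n) * v n) * (2 * C + 2 * C * sqrt T)" by (simp only: sum_constant card_lessThan mult.assoc)
    also have "\<dots> = T * (2 * C + 2 * C * sqrt T)" by (simp only: vn)
    finally show ?thesis unfolding K_def using b0[of "R T \<omega>"] b0[of "R 0 \<omega>"] by linarith
  qed
  have noise1: "expectation (\<lambda>\<omega>. e n i \<omega>) = 0" for n i
    unfolding e_def x_def
    by (rule noise_sum_L2(1)[where tt = "tt n" and X = R and C = C]) (rule v tt0 ttS R_adapted meas(1) b0 lip0)+
  have noise2: "expectation (\<lambda>\<omega>. (\<Sum>i<Suc n. e n i \<omega>)\<^sup>2) \<le> real (Suc n) * (4 * C\<^sup>2 * v n)" for n
    unfolding e_def x_def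
    by (rule noise_sum_L2(2)[where tt = "tt n" and X = R and C = C]) (rule v tt0 ttS R_adapted meas(1) b0 lip0)+
  have e_b: "\<bar>e n i \<omega>\<bar> \<le> 2 * C" for n i \<omega>
    unfolding e_def using b0[of "x n i \<omega>"] abs_heat_le[OF v meas(1) b0, of n "R (tt n i) \<omega>"] by linarith
  have e_int: "integrable M (e n i)" for n i
    by (rule integrable_const_bound[of _ "2 * C"]) (use e_b in auto)
  have eS_b: "\<bar>\<Sum>i<Suc n. e n i \<omega>\<bar> \<le> real (Suc n) * (2 * C)" for n \<omega>
    using sum_norm_bound[of "{..<Suc n}" "\<lambda>i. e n i \<omega>" "2 * C"] e_b by simp
  have eS_int: "integrable M (\<lambda>\<omega>. (\<Sum>i<Suc n. e n i \<omega>)\<^sup>2)" for n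
  proof (rule integrable_const_bound[of _ "(real (Suc n) * (2 * C))\<^sup>2"])
    show "AE \<omega> in M. norm ((\<Sum>i<Suc n. e n i \<omega>)\<^sup>2) \<le> (real (Suc n) * (2 * C))\<^sup>2"
    proof (rule AE_I2)
      fix \<omega>
      have "\<bar>\<Sum>i<Suc n. e n i \<omega>\<bar> \<le> \<bar>real (Suc n) * (2 * C)\<bar>" using eS_b[of n \<omega>] by linarith
      then show "norm ((\<Sum>i<Suc n. e n i \<omega>)\<^sup>2) \<le> (real (Suc n) * (2 * C))\<^sup>2"
        unfolding abs_le_square_iff real_norm_def by (simp only: abs_power2)
    qed
  qed measurable
  have D_sq: "(D n \<omega>)\<^sup>2 \<le> 2 * (\<Sum>i<Suc n. e n i \<omega>)\<^sup>2 + 2 * K\<^sup>2" for n \<omega>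
  proof -
    have *: "(a - b)\<^sup>2 \<le> 2 * b\<^sup>2 + 2 * K\<^sup>2" if "\<bar>a\<bar> \<le> K" for a b :: real
    proof -
      have "(a - b)\<^sup>2 \<le> 2 * a\<^sup>2 + 2 * b\<^sup>2"
        using zero_le_power2[of "a + b"] by (simp add: power2_eq_square algebra_simps)
      moreover have "a\<^sup>2 \<le> K\<^sup>2" using that by (simp add: abs_le_square_iff[symmetric])
      ultimately show ?thesis by linarith
    qed
    have "D n \<omega> = (f (R T \<omega>) - f (R 0 \<omega>) - (\<Sum>i<Suc n. p n i \<omega> + v n / 2 * h (R (tt n i) \<omega>))) - (\<Sum>i<Suc n. e n i \<omega>)"
      unfolding D_eq[of n \<omega>] by linarith
    with *[OF rest[of \<omega> n], of "\<Sum>i<Suc n. e n i \<omega>"] show ?thesis by (simp only:)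
  qed
  have i0: "integrable M (\<lambda>\<omega>. 2 * (\<Sum>i<Suc n. e n i \<omega>)\<^sup>2 + 2 * K\<^sup>2)" for n
    using eS_int[of n] by auto
  have D_int: "integrable M (\<lambda>\<omega>. (D n \<omega>)\<^sup>2)" for n
  proof (rule Bochner_Integration.integrable_bound[OF i0[of n]])
    show "AE \<omega> in M. norm ((D n \<omega>)\<^sup>2) \<le> norm (2 * (\<Sum>i<Suc n. e n i \<omega>)\<^sup>2 + 2 * K\<^sup>2)"
      unfolding real_norm_def abs_power2 by (intro AE_I2 order_trans[OF D_sq abs_ge_self])
  qed measurable
  have D_L2: "expectation (\<lambda>\<omega>. (D n \<omega>)\<^sup>2) \<le> 8 * C\<^sup>2 * T + 2 * K\<^sup>2" for n
  proof -
    have "expectation (\<lambda>\<omega>. (D n \<omega>)\<^sup>2) \<le> expectation (\<lambda>\<omega>. 2 * (\<Sum>i<Suc n. e n i \<omega>)\<^sup>2 + 2 * K\<^sup>2)"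
      by (rule integral_mono[OF D_int i0 D_sq])
    also have "\<dots> = 2 * expectation (\<lambda>\<omega>. (\<Sum>i<Suc n. e n i \<omega>)\<^sup>2) + 2 * K\<^sup>2"
      using eS_int[of n] by (simp add: prob_space del: sum.lessThan_Suc)
    also have "\<dots> \<le> 2 * (real (Suc n) * (4 * C\<^sup>2 * v n)) + 2 * K\<^sup>2"
      using noise2[of n] by linarith
    also have "2 * (real (Suc n) * (4 * C\<^sup>2 * v n)) = 8 * C\<^sup>2 * (real (Suc n) * v n)" by simp
    finally show ?thesis by (simp only: vn)
  qed
  have D_lim: "AE \<omega> in M. (\<lambda>n. D n \<omega>) \<longlonglongrightarrow> 0"
    using AE_R AE_B
  proof eventually_elim
    case (elim \<omega>)
    then have Rc: "continuous_on {0..} (\<lambda>t. R t \<omega>)" and Bc: "continuous_on {0..} (\<lambda>t. B t \<omega>)" by blast+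
    have Rc': "continuous_on {0..T} (\<lambda>t. R t \<omega>)" and Bc': "continuous_on {0..T} (\<lambda>t. B t \<omega>)"
      by (rule continuous_on_subset[OF Rc] continuous_on_subset[OF Bc], force)+
    have E: "R t \<omega> \<ge> 0" "(\<integral>\<^sup>+u\<in>{0..t}. coth (R u \<omega>) \<partial>lborel) < \<infinity>"
        "R t \<omega> = B t \<omega> + 1 / 2 * enn2real (\<integral>\<^sup>+u\<in>{0..t}. coth (R u \<omega>) \<partial>lborel)" if "t \<ge> 0" for t
      using elim(1) that by blast+
    have "(\<lambda>n. (\<Sum>i<n. f (R (T * real (Suc i) / real n) \<omega>)
       - f (R (T * real i / real n) \<omega> + (B (T * real (Suc i) / real n) \<omega> - B (T * real i / real n) \<omega>))))
       \<longlonglongrightarrow> integral {0..T} (\<lambda>u. h (R u \<omega>)) / 2"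
    proof (rule drift_sum_tendsto[OF T Rc' _ _ _ Bc' f lip1 hc hf])
      show "(\<integral>\<^sup>+u\<in>{0..T}. coth (R u \<omega>) \<partial>lborel) < \<infinity>" using T by (intro E(2)) simp
      fix t assume "t \<in> {0..T}"
      then have t: "t \<ge> 0" by simp
      show "R t \<omega> \<ge> 0" using t by (rule E(1))
      show "R t \<omega> = B t \<omega> + 1 / 2 * enn2real (\<integral>\<^sup>+u\<in>{0..t}. coth (R u \<omega>) \<partial>lborel)"
        using t by (rule E(3))
    qed
    moreover have "(\<lambda>n. T / real n * (\<Sum>i<n. h (R (T * real i / real n) \<omega>))) \<longlonglongrightarrow> integral {0..T} (\<lambda>u. h (R u \<omega>))"
      by (rule riemann_sum_tendsto[OF T]) (rule continuous_on_compose2[OF hc Rc' subset_UNIV])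
    ultimately have "(\<lambda>n. (\<Sum>i<n. f (R (T * real (Suc i) / real n) \<omega>)
       - f (R (T * real i / real n) \<omega> + (B (T * real (Suc i) / real n) \<omega> - B (T * real i / real n) \<omega>)))
       - (T / real n * (\<Sum>i<n. h (R (T * real i / real n) \<omega>))) / 2)
       \<longlonglongrightarrow> integral {0..T} (\<lambda>u. h (R u \<omega>)) / 2 - integral {0..T} (\<lambda>u. h (R u \<omega>)) / 2"
      by (intro tendsto_diff tendsto_divide tendsto_const) simp_all
    from LIMSEQ_Suc[OF this] show ?case
      unfolding D_def x_def tt_def v_def by (simp only: diff_self times_divide_eq_left mult.commute)
  qed
  have "(\<lambda>n. expectation (D n)) \<longlonglongrightarrow> 0"
    by (rule expectation_tendsto_0_of_L2_bound[OF _ D_lim D_int D_L2]) simp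
  moreover have "(\<lambda>n. expectation (D n) - (expectation (\<lambda>\<omega>. f (R T \<omega>)) - f 0 - v n * (\<Sum>i<Suc n. expectation (\<lambda>\<omega>. g (R (tt n i) \<omega>))))) \<longlonglongrightarrow> 0"
  proof (rule tendsto_rabs_zero_cancel, rule tendsto_sandwich[where f = "\<lambda>_. 0" and h = "\<lambda>n. 2 * C * T * sqrt (v n)"])
    show "(\<lambda>n. 2 * C * T * sqrt (v n)) \<longlonglongrightarrow> 0"
    proof -
      have "v \<longlonglongrightarrow> 0"
        unfolding v_def[abs_def] using LIMSEQ_Suc[OF tendsto_divide_0[OF tendsto_const[of T] filterlim_at_top_imp_at_infinity[OF filterlim_real_sequentially]]] .
      then have "(\<lambda>n. 2 * C * T * sqrt (v n)) \<longlonglongrightarrow> 2 * C * T * sqrt 0" by (intro tendsto_intros)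
      then show ?thesis by simp
    qed
    show "\<forall>\<^sub>F n in sequentially. \<bar>expectation (D n) - (expectation (\<lambda>\<omega>. f (R T \<omega>)) - f 0 - v n * (\<Sum>i<Suc n. expectation (\<lambda>\<omega>. g (R (tt n i) \<omega>))))\<bar> \<le> 2 * C * T * sqrt (v n)"
    proof (rule always_eventually, rule allI)
      fix n
      let ?q = "\<lambda>i \<omega>. p n i \<omega> - v n / 2 * f2 (R (tt n i) \<omega>)"
      have [measurable]: "p n i \<in> borel_measurable M" for i unfolding p_def[abs_def] by measurable
      have q_int: "integrable M (?q i)" for i
        by (rule integrable_const_bound[of _ "2 * C * v n * sqrt (v n)"]) (use pb in auto)
      have g_int: "integrable M (\<lambda>\<omega>. g (R (tt n i) \<omega>))" for i
        by (rule integrable_const_bound[of _ C]) (use bg in auto)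
      have f_int: "integrable M (\<lambda>\<omega>. f (R T \<omega>))" "integrable M (\<lambda>\<omega>. f (R 0 \<omega>))"
        by (rule integrable_const_bound[of _ C]; use b0 in auto)+
      have fR0: "expectation (\<lambda>\<omega>. f (R 0 \<omega>)) = f 0"
      proof -
        have "expectation (\<lambda>\<omega>. f (R 0 \<omega>)) = expectation (\<lambda>\<omega>. f 0)"
          using AE_R_0 by (intro integral_cong_AE) auto
        then show ?thesis by (simp add: prob_space)
      qed
      have e0: "expectation (e n i) = 0" for i
        using noise1[of n i] by simp
      have "D n = (\<lambda>\<omega>. f (R T \<omega>) - f (R 0 \<omega>) - (\<Sum>i<Suc n. e n i \<omega>) - (\<Sum>i<Suc n. ?q i \<omega> + v n * g (R (tt n i) \<omega>)))"
        unfolding D_eq h_def by (intro ext arg_cong2[where f = "(-)"] sum.cong refl) (simp add: algebra_simps)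
      then have "expectation (D n) = expectation (\<lambda>\<omega>. f (R T \<omega>)) - expectation (\<lambda>\<omega>. f (R 0 \<omega>)) - (\<Sum>i<Suc n. expectation (e n i))
           - (\<Sum>i<Suc n. expectation (?q i) + v n * expectation (\<lambda>\<omega>. g (R (tt n i) \<omega>)))"
        using e_int q_int g_int f_int by (simp del: sum.lessThan_Suc)
      then have "expectation (D n) - (expectation (\<lambda>\<omega>. f (R T \<omega>)) - f 0 - v n * (\<Sum>i<Suc n. expectation (\<lambda>\<omega>. g (R (tt n i) \<omega>))))
          = - (\<Sum>i<Suc n. expectation (?q i))"
        by (simp add: fR0 e0 sum.distrib sum_distrib_left del: sum.lessThan_Suc)
      moreover have "\<bar>\<Sum>i<Suc n. expectation (?q i)\<bar> \<le> real (Suc n) * (2 * C * v n * sqrt (v n))"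
      proof -
        have "norm (expectation (?q i)) \<le> 2 * C * v n * sqrt (v n)" for i
        proof -
          have "norm (expectation (?q i)) \<le> expectation (\<lambda>\<omega>. 2 * C * v n * sqrt (v n))"
            unfolding real_norm_def by (rule abs_expectation_le[OF q_int _ pb]) simp
          then show ?thesis by (simp add: prob_space)
        qed
        then show ?thesis
          using sum_norm_bound[of "{..<Suc n}" "\<lambda>i. expectation (?q i)"] by (simp del: sum.lessThan_Suc)
      qed
      moreover have "real (Suc n) * (2 * C * v n * sqrt (v n)) = 2 * C * (real (Suc n) * v n) * sqrt (v n)"
        by (simp only: mult_ac)
      ultimately show "\<bar>expectation (D n) - (expectation (\<lambda>\<omega>. f (R T \<omega>)) - f 0 - v n * (\<Sum>i<Suc n. expectation (\<lambda>\<omega>. g (R (tt n i) \<omega>))))\<bar> \<le> 2 * C * T * sqrt (v n)"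
        by (simp only: vn abs_minus_cancel)
    qed
    show "\<forall>\<^sub>F n in sequentially. 0 \<le> \<bar>expectation (D n) - (expectation (\<lambda>\<omega>. f (R T \<omega>)) - f 0 - v n * (\<Sum>i<Suc n. expectation (\<lambda>\<omega>. g (R (tt n i) \<omega>))))\<bar>"
      by (intro always_eventually allI abs_ge_zero)
  qed (rule tendsto_const)
  ultimately have "(\<lambda>n. expectation (D n) - (expectation (D n) - (expectation (\<lambda>\<omega>. f (R T \<omega>)) - f 0 - v n * (\<Sum>i<Suc n. expectation (\<lambda>\<omega>. g (R (tt n i) \<omega>)))))) \<longlonglongrightarrow> 0 - 0"
    by (rule tendsto_diff)
  then have "(\<lambda>n. expectation (\<lambda>\<omega>. f (R T \<omega>)) - f 0 - v n * (\<Sum>i<Suc n. expectation (\<lambda>\<omega>. g (R (tt n i) \<omega>)))) \<longlonglongrightarrow> 0"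
    by (simp only: cancel diff_self)
  moreover have "(\<lambda>n. v n * (\<Sum>i<Suc n. expectation (\<lambda>\<omega>. g (R (tt n i) \<omega>)))) \<longlonglongrightarrow> integral {0..T} (\<lambda>s. expectation (\<lambda>\<omega>. g (R s \<omega>)))"
    unfolding v_def tt_def
    by (rule LIMSEQ_Suc, rule riemann_sum_tendsto[OF T], rule continuous_on_subset[OF mean_continuous[OF g bg]], rule Icc_subset_Ici_iff[THEN iffD2], simp)
  then have "(\<lambda>n. expectation (\<lambda>\<omega>. f (R T \<omega>)) - f 0 - v n * (\<Sum>i<Suc n. expectation (\<lambda>\<omega>. g (R (tt n i) \<omega>)))) \<longlonglongrightarrow> expectation (\<lambda>\<omega>. f (R T \<omega>)) - f 0 - integral {0..T} (\<lambda>s. expectation (\<lambda>\<omega>. g (R s \<omega>)))"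
    by (intro tendsto_diff tendsto_const)
  ultimately have "expectation (\<lambda>\<omega>. f (R T \<omega>)) - f 0 - integral {0..T} (\<lambda>s. expectation (\<lambda>\<omega>. g (R s \<omega>))) = 0"
    by (rule LIMSEQ_unique[symmetric])
  then show ?thesis by linarith
qed

end

section \<open>The law of the Busemann function\<close>

lemma exponential_of_integral_equation:
  fixes m :: "real \<Rightarrow> real"
  assumes T: "T \<ge> 0" and m: "continuous_on {0..T} m"
    and eq: "\<And>t. t \<in> {0..T} \<Longrightarrow> m t = m0 + integral {0..t} (\<lambda>s. - \<kappa> * m s)"
  shows "m T = m0 * exp (- \<kappa> * T)"
proof -
  let ?\<phi> = "\<lambda>t. exp (\<kappa> * t) * (m0 + integral {0..t} (\<lambda>s. - \<kappa> * m s))"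
  have "(?\<phi> has_field_derivative 0) (at t within {0..T})" if t: "t \<in> {0..T}" for t
  proof -
    have "((\<lambda>t. integral {0..t} (\<lambda>s. - \<kappa> * m s)) has_real_derivative - \<kappa> * m t) (at t within {0..T})"
      by (rule integral_has_real_derivative[OF _ t]) (intro continuous_intros m)
    from DERIV_add[OF DERIV_const[of m0] this]
    have "((\<lambda>t. m0 + integral {0..t} (\<lambda>s. - \<kappa> * m s)) has_real_derivative - \<kappa> * m t) (at t within {0..T})"
      by (simp only: add_0)
    moreover have "((\<lambda>t. exp (\<kappa> * t)) has_real_derivative \<kappa> * exp (\<kappa> * t)) (at t within {0..T})"
      by (auto intro!: derivative_eq_intros)
    ultimately have "(?\<phi> has_field_derivative
        \<kappa> * exp (\<kappa> * t) * (m0 + integral {0..t} (\<lambda>s. - \<kappa> * m s)) + - \<kappa> * m t * exp (\<kappa> * t)) (at t within {0..T})"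
      by (intro DERIV_mult)
    moreover have "\<kappa> * exp (\<kappa> * t) * (m0 + integral {0..t} (\<lambda>s. - \<kappa> * m s)) + - \<kappa> * m t * exp (\<kappa> * t) = 0"
    proof -
      have "a * b * c + - a * c * b = 0" for a b c :: real by simp
      then show ?thesis unfolding eq[OF t, symmetric] .
    qed
    ultimately show ?thesis by (simp only:)
  qed
  then obtain c where c: "\<And>t. t \<in> {0..T} \<Longrightarrow> ?\<phi> t = c"
    using has_field_derivative_zero_constant[of "{0..T}" ?\<phi>] by blast
  have "exp (\<kappa> * T) * m T = ?\<phi> 0"
    using c[of 0] c[of T] eq[of T] T by (metis atLeastAtMost_iff order_refl)
  then have "exp (\<kappa> * T) * m T = m0" by simp
  then show ?thesis by (simp add: exp_minus field_simps)
qed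

lemma circle_mean_0: "circle_mean 0 a b l 0 = pi * a"
  by (simp add: circle_mean_def busemann_def wave_def)

text \<open>
  For an eigenfunction of the generator the expected Ito formula is a linear integral equation in
  time. At the origin the Busemann function vanishes, so only the coefficient \<open>a\<close> of the cosine
  survives in the initial value.
\<close>

lemma (in bessel) expectation_circle_mean:
  assumes t: "t \<ge> 0"
  shows "expectation (\<lambda>\<omega>. circle_mean 0 a b l (R t \<omega>)) = pi * a * exp (- (1 / 8 + l\<^sup>2 / 2) * t)"
proof (rule spherical_function[of a b l])
  fix F1 F2 :: "real \<Rightarrow> real" and C :: real
  assume S:
    "\<And>r. (circle_mean 0 a b l has_real_derivative F1 r) (at r)"
    "\<And>r. (F1 has_real_derivative F2 r) (at r)"
    "\<And>r. \<bar>circle_mean 0 a b l r\<bar> \<le> C" "\<And>r. \<bar>F1 r\<bar> \<le> C" "\<And>r. \<bar>F2 r\<bar> \<le> C"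
    "\<And>x y. \<bar>F2 x - F2 y\<bar> \<le> C * \<bar>x - y\<bar>"
    "\<And>r. r > 0 \<Longrightarrow> F2 r + cosh r / sinh r * F1 r = - (1 / 4 + l\<^sup>2) * circle_mean 0 a b l r"
  define \<kappa> where "\<kappa> = 1 / 8 + l\<^sup>2 / 2"
  have \<kappa>: "\<kappa> > 0" unfolding \<kappa>_def by (simp add: add_pos_nonneg)
  let ?f = "circle_mean 0 a b l"
  have C: "C \<ge> 0" using order_trans[OF abs_ge_zero S(3)[of 0]] .
  define C' where "C' = C * (1 + \<kappa>)"
  have CC: "C \<le> C'" "\<kappa> * C \<le> C'" using C \<kappa> by (auto simp: C'_def algebra_simps)
  have fc: "continuous_on UNIV ?f" using S(1) by (intro DERIV_continuous_on) auto
  define m where "m t = expectation (\<lambda>\<omega>. ?f (R t \<omega>))" for t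
  have eq: "m T = pi * a + integral {0..T} (\<lambda>s. - \<kappa> * m s)" if "T \<ge> 0" for T
  proof (cases "T = 0")
    case True
    have [measurable]: "R 0 \<in> borel_measurable M" "?f \<in> borel_measurable borel"
      using fc by (auto intro: R_measurable borel_measurable_continuous_onI)
    have "m 0 = expectation (\<lambda>\<omega>. pi * a)"
      unfolding m_def by (intro integral_cong_AE) (use AE_R_0 in \<open>auto simp: circle_mean_0\<close>)
    with True show ?thesis by (simp add: prob_space)
  next
    case False
    with that have T: "T > 0" by simp
    have "expectation (\<lambda>\<omega>. ?f (R T \<omega>)) - ?f 0 = integral {0..T} (\<lambda>s. expectation (\<lambda>\<omega>. - \<kappa> * ?f (R s \<omega>)))"
    proof (rule expectation_ito[OF T S(1,2), where C = C'])
      show "\<bar>?f x\<bar> \<le> C'" "\<bar>F1 x\<bar> \<le> C'" "\<bar>F2 x\<bar> \<le> C'" for x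
        using S(3-5)[of x] CC by linarith+
      show "\<bar>F2 x - F2 y\<bar> \<le> C' * \<bar>x - y\<bar>" for x y
        using S(6)[of x y] mult_right_mono[OF CC(1), of "\<bar>x - y\<bar>"] by simp
      show "continuous_on UNIV (\<lambda>x. - \<kappa> * ?f x)" by (intro continuous_intros fc)
      show "\<bar>- \<kappa> * ?f x\<bar> \<le> C'" for x
        using order_trans[OF mult_left_mono[OF S(3)[of x], of \<kappa>] CC(2)] \<kappa> by (simp add: abs_mult)
      show "- \<kappa> * ?f x = (F2 x + cosh x / sinh x * F1 x) / 2" if "x > 0" for x
        unfolding S(7)[OF that] by (simp add: \<kappa>_def algebra_simps)
    qed
    then show ?thesis by (simp add: m_def circle_mean_0)
  qed
  have "m t = pi * a * exp (- \<kappa> * t)"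
  proof (rule exponential_of_integral_equation[OF t])
    show "continuous_on {0..t} m"
      unfolding m_def[abs_def] by (rule continuous_on_subset[OF mean_continuous[OF fc S(3)]]) auto
  qed (use eq in auto)
  then show ?thesis by (simp add: m_def \<kappa>_def)
qed

definition angle_measure :: "real measure" where
  "angle_measure = density lborel (\<lambda>\<theta>. ennreal (indicator {0..pi} \<theta> / pi))"

lemma sets_angle_measure [simp, measurable_cong]: "sets angle_measure = sets borel"
  by (simp add: angle_measure_def)

lemma space_angle_measure [simp]: "space angle_measure = UNIV"
  by (simp add: angle_measure_def)

lemma integral_angle_measure:
  fixes h :: "real \<Rightarrow> real"
  assumes h: "continuous_on UNIV h"
  shows "integrable angle_measure h" "(\<integral>\<theta>. h \<theta> \<partial>angle_measure) = integral {0..pi} h / pi"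
proof -
  have hm [measurable]: "h \<in> borel_measurable borel" using h by (rule borel_measurable_continuous_onI)
  have s: "set_integrable lborel {0..pi} h"
    by (rule borel_integrable_atLeastAtMost') (rule continuous_on_subset[OF h subset_UNIV])
  then show "integrable angle_measure h"
    unfolding angle_measure_def set_integrable_def by (subst integrable_density) auto
  show "(\<integral>\<theta>. h \<theta> \<partial>angle_measure) = integral {0..pi} h / pi"
    unfolding angle_measure_def set_borel_integral_eq_integral(2)[OF s, symmetric] set_lebesgue_integral_def
    by (subst integral_density) auto
qed

lemma prob_space_angle_measure: "prob_space angle_measure"
proof
  have "emeasure angle_measure (space angle_measure) = (\<integral>\<^sup>+\<theta>. ennreal (1 / pi) * indicator {0..pi} \<theta> \<partial>lborel)"
    unfolding angle_measure_def by (subst emeasure_density) (auto intro!: nn_integral_cong split: split_indicator)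
  also have "\<dots> = ennreal (1 / pi) * ennreal pi" by (simp add: nn_integral_cmult_indicator)
  also have "\<dots> = 1" by (simp flip: ennreal_mult)
  finally show "emeasure angle_measure (space angle_measure) = 1" .
qed

lemma borel_measurable_busemann [measurable]:
  assumes [measurable]: "f \<in> borel_measurable N" "g \<in> borel_measurable N"
  shows "(\<lambda>x. busemann (f x) (g x)) \<in> borel_measurable N"
proof -
  have "(\<lambda>p :: real \<times> real. busemann (fst p) (snd p)) \<in> borel_measurable borel"
    by (intro borel_measurable_continuous_onI continuous_intros)
  then have [measurable]: "(\<lambda>p :: real \<times> real. busemann (fst p) (snd p)) \<in> borel_measurable (borel \<Otimes>\<^sub>M borel)"
    by (simp add: borel_prod)
  have "(\<lambda>x. (\<lambda>p. busemann (fst p) (snd p)) (f x, g x)) \<in> borel_measurable N" by measurable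
  then show ?thesis by simp
qed

lemma borel_measurable_wave [measurable]: "wave a b l \<in> borel_measurable borel"
  by (intro borel_measurable_continuous_onI continuous_on_wave continuous_on_id)

context bessel
begin

abbreviation "P \<equiv> M \<Otimes>\<^sub>M angle_measure"

interpretation A: prob_space angle_measure by (rule prob_space_angle_measure)
interpretation pair: pair_prob_space M angle_measure ..

text \<open>
  The expectation of a circle average, read as an integral over the product with a uniform angle.
\<close>

lemma wave_busemann_integral:
  assumes t: "t \<ge> 0"
  shows "integrable P (\<lambda>p. wave a b l (busemann (R t (fst p)) (snd p)))"
    and "(\<integral>p. wave a b l (busemann (R t (fst p)) (snd p)) \<partial>P) = a * exp (- (1 / 8 + l\<^sup>2 / 2) * t)"
proof -
  have [measurable]: "R t \<in> borel_measurable M" using t by (rule R_measurable)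
  let ?W = "\<lambda>p. wave a b l (busemann (R t (fst p)) (snd p))"
  have c: "continuous_on UNIV (\<lambda>\<theta>. wave a b l (busemann r \<theta>))" for a b l r by (intro continuous_intros)
  show int: "integrable P ?W"
  proof (rule integrableI_bounded)
    have "(\<integral>\<^sup>+p. ennreal (norm (?W p)) \<partial>P) = (\<integral>\<^sup>+\<omega>. \<integral>\<^sup>+\<theta>. ennreal (norm (?W (\<omega>, \<theta>))) \<partial>angle_measure \<partial>M)"
      by (rule A.nn_integral_fst[symmetric]) simp
    also have "\<dots> \<le> (\<integral>\<^sup>+\<omega>. ennreal (\<bar>a\<bar> + \<bar>b\<bar>) \<partial>M)"
    proof (rule nn_integral_mono)
      fix \<omega>
      have "(\<integral>\<^sup>+\<theta>. ennreal (norm (?W (\<omega>, \<theta>))) \<partial>angle_measure)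
          \<le> (\<integral>\<^sup>+\<theta>. ennreal (wave (\<bar>a\<bar> + \<bar>b\<bar>) 0 0 (busemann (R t \<omega>) \<theta>)) \<partial>angle_measure)"
      proof (intro nn_integral_mono ennreal_leI)
        fix \<theta>
        show "norm (?W (\<omega>, \<theta>)) \<le> wave (\<bar>a\<bar> + \<bar>b\<bar>) 0 0 (busemann (R t \<omega>) \<theta>)"
          using abs_wave_le[of a b l "busemann (R t \<omega>) \<theta>"] by (simp add: wave_def mult.commute)
      qed
      also have "\<dots> = ennreal (circle_mean 0 (\<bar>a\<bar> + \<bar>b\<bar>) 0 0 (R t \<omega>) / pi)"
        using integral_angle_measure[OF c[of "\<bar>a\<bar> + \<bar>b\<bar>" 0 0 "R t \<omega>"]]
        by (subst nn_integral_eq_integral) (auto simp: wave_def circle_mean_def)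
      also have "\<dots> \<le> ennreal (\<bar>a\<bar> + \<bar>b\<bar>)"
        using abs_circle_mean_le[of 0 "\<bar>a\<bar> + \<bar>b\<bar>" 0 0 "R t \<omega>"]
        by (intro ennreal_leI) (simp add: divide_le_eq)
      finally show "(\<integral>\<^sup>+\<theta>. ennreal (norm (?W (\<omega>, \<theta>))) \<partial>angle_measure) \<le> ennreal (\<bar>a\<bar> + \<bar>b\<bar>)" .
    qed
    also have "\<dots> < \<infinity>" by (simp add: emeasure_space_1)
    finally show "(\<integral>\<^sup>+p. ennreal (norm (?W p)) \<partial>P) < \<infinity>" .
  qed simp
  have "(\<integral>p. ?W p \<partial>P) = (\<integral>\<omega>. (\<integral>\<theta>. ?W (\<omega>, \<theta>) \<partial>angle_measure) \<partial>M)"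
    by (rule pair.integral_fst'[OF int, symmetric])
  also have "\<dots> = (\<integral>\<omega>. circle_mean 0 a b l (R t \<omega>) / pi \<partial>M)"
    using integral_angle_measure(2)[OF c] by (simp add: circle_mean_def)
  also have "\<dots> = a * exp (- (1 / 8 + l\<^sup>2 / 2) * t)"
    using expectation_circle_mean[OF t, of a b l] by simp
  finally show "(\<integral>p. ?W p \<partial>P) = a * exp (- (1 / 8 + l\<^sup>2 / 2) * t)" .
qed

text \<open>
  Normalised by \<open>exp (t / 8)\<close>, the measure with density \<open>exp (- S / 2)\<close> is a probability, and the waves
  of frequency \<open>l / sqrt t\<close> are its characteristic function: the image under \<open>S / sqrt t\<close> is standard
  normal by Levy's uniqueness theorem.
\<close>

lemma busemann_law:
  assumes t: "t > 0" and g [measurable]: "g \<in> borel_measurable borel"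
  shows "(\<integral>\<^sup>+\<omega>. \<integral>\<^sup>+\<theta>. ennreal (exp (- busemann (R t \<omega>) \<theta> / 2)) * g (busemann (R t \<omega>) \<theta>) \<partial>angle_measure \<partial>M)
       = ennreal (exp (- t / 8)) * (\<integral>\<^sup>+x. ennreal (std_normal_density x) * g (sqrt t * x) \<partial>lborel)"
proof -
  have [measurable]: "R t \<in> borel_measurable M" using t by (intro R_measurable) simp
  let ?S = "\<lambda>p. busemann (R t (fst p)) (snd p)"
  let ?d = "\<lambda>p. exp (t / 8) * exp (- ?S p / 2)"
  define \<nu> where "\<nu> = distr (density P (\<lambda>p. ennreal (?d p))) borel (\<lambda>p. ?S p / sqrt t)"
  have tt: "sqrt t > 0" using t by simp
  have t0: "t \<ge> 0" using t by simp
  have d_wave: "?d p = exp (t / 8) * wave 1 0 0 (?S p)" for p by (simp add: wave_def)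
  have dint: "integrable P ?d" "(\<integral>p. ?d p \<partial>P) = 1"
    unfolding d_wave using wave_busemann_integral[OF t0, of 1 0 0] by (auto simp: exp_minus)
  have "prob_space (density P (\<lambda>p. ennreal (?d p)))"
  proof
    have "emeasure (density P (\<lambda>p. ennreal (?d p))) (space (density P (\<lambda>p. ennreal (?d p)))) = (\<integral>\<^sup>+p. ennreal (?d p) \<partial>P)"
      unfolding space_density
      by (rule trans[OF emeasure_density[OF _ sets.top]]) (auto intro!: nn_integral_cong)
    also have "\<dots> = ennreal (\<integral>p. ?d p \<partial>P)" using dint(1) by (rule nn_integral_eq_integral) simp
    finally show "emeasure (density P (\<lambda>p. ennreal (?d p))) (space (density P (\<lambda>p. ennreal (?d p)))) = 1"
      using dint(2) by simp
  qed
  then have "prob_space \<nu>" unfolding \<nu>_def by (rule prob_space.prob_space_distr) simp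
  then have "real_distribution \<nu>"
    unfolding real_distribution_def real_distribution_axioms_def by (simp add: \<nu>_def)
  moreover have "char \<nu> = char std_normal_distribution"
  proof
    fix l :: real
    define k where "k = l / sqrt t"
    have "char \<nu> l = (\<integral>p. ?d p *\<^sub>R iexp (l * (?S p / sqrt t)) \<partial>P)"
      unfolding char_def \<nu>_def by (subst integral_distr) (auto simp: integral_density)
    also have "\<dots> = (\<integral>p. complex_of_real (exp (t / 8) * wave 1 0 k (?S p)) + \<i> * complex_of_real (exp (t / 8) * wave 0 1 k (?S p)) \<partial>P)"
    proof (rule Bochner_Integration.integral_cong[OF refl])
      fix p
      have "iexp (l * (?S p / sqrt t)) = complex_of_real (cos (k * ?S p)) + \<i> * complex_of_real (sin (k * ?S p))"
      proof -
        have "l * (?S p / sqrt t) = k * ?S p" by (simp add: k_def)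
        then show ?thesis by (simp only: exp_Euler cos_of_real sin_of_real)
      qed
      then show "?d p *\<^sub>R iexp (l * (?S p / sqrt t)) =
         complex_of_real (exp (t / 8) * wave 1 0 k (?S p)) + \<i> * complex_of_real (exp (t / 8) * wave 0 1 k (?S p))"
        by (simp add: wave_def scaleR_conv_of_real algebra_simps)
    qed
    also have "\<dots> = complex_of_real (exp (t / 8) * exp (- (1 / 8 + k\<^sup>2 / 2) * t))"
      using wave_busemann_integral[OF t0, of 1 0 k] wave_busemann_integral[OF t0, of 0 1 k]
      by (subst Bochner_Integration.integral_add) auto
    also have "exp (t / 8) * exp (- (1 / 8 + k\<^sup>2 / 2) * t) = exp (- (l\<^sup>2) / 2)"
    proof -
      have "k\<^sup>2 * t = l\<^sup>2" using t by (simp add: k_def power_divide)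
      then show ?thesis unfolding exp_add[symmetric] by (simp add: algebra_simps)
    qed
    finally show "char \<nu> l = char std_normal_distribution l"
      by (simp add: char_std_normal_distribution)
  qed
  ultimately have \<nu>: "\<nu> = std_normal_distribution"
    using real_dist_normal_dist by (intro Levy_uniqueness)
  have "(\<integral>\<^sup>+x. g (sqrt t * x) \<partial>\<nu>) = (\<integral>\<^sup>+p. ennreal (?d p) * g (?S p) \<partial>P)"
    unfolding \<nu>_def using tt by (subst nn_integral_distr) (auto simp: nn_integral_density)
  moreover have "(\<integral>\<^sup>+x. g (sqrt t * x) \<partial>\<nu>) = (\<integral>\<^sup>+x. ennreal (std_normal_density x) * g (sqrt t * x) \<partial>lborel)"
    unfolding \<nu> by (subst nn_integral_density) auto
  ultimately have eq: "(\<integral>\<^sup>+p. ennreal (?d p) * g (?S p) \<partial>P) = (\<integral>\<^sup>+x. ennreal (std_normal_density x) * g (sqrt t * x) \<partial>lborel)"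
    by simp
  have "(\<integral>\<^sup>+\<omega>. \<integral>\<^sup>+\<theta>. ennreal (exp (- busemann (R t \<omega>) \<theta> / 2)) * g (busemann (R t \<omega>) \<theta>) \<partial>angle_measure \<partial>M)
      = (\<integral>\<^sup>+p. ennreal (exp (- ?S p / 2)) * g (?S p) \<partial>P)"
    using A.nn_integral_fst[of "\<lambda>p. ennreal (exp (- ?S p / 2)) * g (?S p)" M] by simp
  also have "\<dots> = (\<integral>\<^sup>+p. ennreal (exp (- t / 8)) * (ennreal (?d p) * g (?S p)) \<partial>P)"
    by (intro nn_integral_cong) (simp flip: mult.assoc ennreal_mult exp_add)
  also have "\<dots> = ennreal (exp (- t / 8)) * (\<integral>\<^sup>+p. ennreal (?d p) * g (?S p) \<partial>P)"
    by (rule nn_integral_cmult) simp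
  finally show ?thesis unfolding eq .
qed

end

section \<open>Abel inversion\<close>

text \<open>
  The kernel that inverts the Abel transform from the radial law to the law of the Busemann function.
\<close>

definition abel_kernel :: "real \<Rightarrow> real \<Rightarrow> ennreal" where
  "abel_kernel a s = ennreal (sqrt 2 * sinh s / sqrt (cosh s - cosh a)) * indicator {a<..} s"

lemma borel_measurable_sinh_cosh [measurable]:
  "(sinh :: real \<Rightarrow> real) \<in> borel_measurable borel" "(cosh :: real \<Rightarrow> real) \<in> borel_measurable borel"
  by (intro borel_measurable_continuous_onI continuous_intros)+

lemma borel_measurable_abel_kernel [measurable]: "abel_kernel a \<in> borel_measurable borel"
  unfolding abel_kernel_def[abs_def] by measurable

lemma busemann_le: "r \<ge> 0 \<Longrightarrow> busemann r \<theta> \<le> r"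
proof -
  assume "r \<ge> 0"
  then have "exp (busemann r \<theta>) \<le> cosh r + sinh r"
    unfolding exp_busemann by (simp add: mult_left_le)
  then show ?thesis by (simp add: cosh_plus_sinh)
qed

text \<open>
  In the variable \<open>s = S\<close> this is the classical integral of
  \<open>sinh s / sqrt ((cosh r - cosh s) (cosh s - cosh a))\<close> over the interval from \<open>a\<close> to \<open>r\<close>, equal to \<open>pi\<close>.
  Staying in the angle, an antiderivative is an arcsine of an affine function of \<open>cosh S\<close>, which runs
  from 1 at the angle 0 to -1 at the angle where \<open>S = a\<close>.
\<close>

lemma abel_inversion:
  assumes r: "r \<ge> 0" and a: "a \<ge> 0"
  shows "(\<integral>\<^sup>+\<theta>. ennreal (exp (- busemann r \<theta> / 2)) * abel_kernel a (busemann r \<theta>) \<partial>angle_measure) = indicator {a<..} r"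
proof (cases "r > a")
  case False
  then have "abel_kernel a (busemann r \<theta>) = 0" for \<theta>
    using busemann_le[OF r, of \<theta>] by (simp add: abel_kernel_def)
  with False show ?thesis by simp
next
  case True
  let ?S = "busemann r"
  define c where "c = (exp a - cosh r) / sinh r"
  have sr: "sinh r > 0" using True a by simp
  have c1: "c < 1"
  proof -
    have "exp a < exp r" using True by simp
    then show ?thesis using sr by (simp add: c_def divide_less_eq cosh_plus_sinh[symmetric])
  qed
  have c2: "c > -1"
  proof -
    have "exp (- r) < 1" using True a by simp
    also have "1 \<le> exp a" using a by simp
    finally show ?thesis using sr by (simp add: c_def less_divide_eq cosh_minus_sinh[symmetric])
  qed
  (* the angle at which the Busemann function has decreased to a *)
  define \<alpha> where "\<alpha> = arccos c"
  have \<alpha>: "0 < \<alpha>" "\<alpha> < pi" "cos \<alpha> = c"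
    using arccos_lt_bounded[OF c2 c1] c1 c2 by (auto simp: \<alpha>_def)
  have expS: "exp (?S \<theta>) - exp a = sinh r * (cos \<theta> - cos \<alpha>)" for \<theta>
    unfolding exp_busemann \<alpha>(3) c_def using sr by (simp add: field_simps)
  have S_gt: "?S \<theta> > a \<longleftrightarrow> \<theta> < \<alpha>" if "\<theta> \<in> {0..pi}" for \<theta>
  proof -
    have "?S \<theta> > a \<longleftrightarrow> exp (?S \<theta>) - exp a > 0" by simp
    also have "\<dots> \<longleftrightarrow> cos \<theta> > cos \<alpha>" unfolding expS using sr by (simp add: zero_less_mult_iff)
    also have "\<dots> \<longleftrightarrow> \<theta> < \<alpha>" using that \<alpha> cos_mono_less_eq[of \<alpha> \<theta>] by auto
    finally show ?thesis .
  qed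
  have S\<alpha>: "?S \<alpha> = a" using expS[of \<alpha>] by simp
  have S_lt: "?S \<theta> < r" if "\<theta> \<in> {0<..pi}" for \<theta>
  proof -
    have "cos \<theta> < 1" using that cos_mono_less_eq[of \<theta> 0] by auto
    then have "exp (?S \<theta>) < cosh r + sinh r" unfolding exp_busemann using sr by simp
    then show ?thesis by (simp add: cosh_plus_sinh)
  qed
  have ge: "?S \<theta> \<ge> a" if "\<theta> \<in> {0..\<alpha>}" for \<theta>
    using S_gt[of \<theta>] S\<alpha> that \<alpha> by (cases "\<theta> = \<alpha>") auto
  define \<Delta> where "\<Delta> = cosh r - cosh a"
  have \<Delta>: "\<Delta> > 0" using True a by (simp add: \<Delta>_def cosh_real_nonneg_less_iff)
  let ?w = "\<lambda>\<theta>. (2 * cosh (?S \<theta>) - cosh r - cosh a) / \<Delta>"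
  let ?q = "\<lambda>\<theta>. exp (- ?S \<theta> / 2) * (sqrt 2 * sinh (?S \<theta>) / sqrt (cosh (?S \<theta>) - cosh a))"
  have w_ge: "-1 \<le> ?w \<theta>" if "\<theta> \<in> {0..\<alpha>}" for \<theta>
    using ge[OF that] a \<Delta> by (simp add: le_divide_eq \<Delta>_def cosh_real_nonneg_le_iff)
  have w_le: "?w \<theta> \<le> 1" if "\<theta> \<in> {0..\<alpha>}" for \<theta>
    using ge[OF that] busemann_le[OF r, of \<theta>] a \<Delta> by (simp add: divide_le_eq \<Delta>_def cosh_real_nonneg_le_iff)
  have "(?q has_integral (- arcsin (?w \<alpha>)) - (- arcsin (?w 0))) {0..\<alpha>}"
  proof (rule fundamental_theorem_of_calculus_interior)
    show "continuous_on {0..\<alpha>} (\<lambda>\<theta>. - arcsin (?w \<theta>))"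
      using w_ge w_le \<Delta> by (intro continuous_intros ballI) auto
    fix \<theta> assume \<theta>: "\<theta> \<in> {0<..<\<alpha>}"
    then have t0: "\<theta> \<in> {0..\<alpha>}" "\<theta> \<in> {0<..pi}" "\<theta> \<in> {0..pi}" using \<alpha> by auto
    have Sa: "?S \<theta> > a" using S_gt[OF t0(3)] \<theta> by simp
    have Sr: "?S \<theta> < r" using S_lt[OF t0(2)] .
    have ca: "cosh (?S \<theta>) - cosh a > 0" using Sa a by (simp add: cosh_real_nonneg_less_iff)
    have cr: "cosh r - cosh (?S \<theta>) > 0" using Sa Sr a by (simp add: cosh_real_nonneg_less_iff)
    define p q where "p = sqrt (cosh r - cosh (?S \<theta>))" and "q = sqrt (cosh (?S \<theta>) - cosh a)"
    have pq: "p > 0" "q > 0" "p\<^sup>2 = cosh r - cosh (?S \<theta>)" "q\<^sup>2 = cosh (?S \<theta>) - cosh a"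
      using ca cr by (auto simp: p_def q_def)
    have w1: "1 - (?w \<theta>)\<^sup>2 = (2 * p * q / \<Delta>)\<^sup>2"
    proof -
      have "1 - (?w \<theta>)\<^sup>2 = (\<Delta>\<^sup>2 - (2 * cosh (?S \<theta>) - cosh r - cosh a)\<^sup>2) / \<Delta>\<^sup>2"
        unfolding power_divide diff_divide_distrib[of "\<Delta>\<^sup>2"] using \<Delta> by simp
      also have "\<Delta>\<^sup>2 - (2 * cosh (?S \<theta>) - cosh r - cosh a)\<^sup>2 = 4 * p\<^sup>2 * q\<^sup>2"
        unfolding pq \<Delta>_def by (simp add: power2_eq_square algebra_simps)
      finally show ?thesis by (simp add: power_divide power_mult_distrib)
    qed
    have w2: "-1 < ?w \<theta>" "?w \<theta> < 1"
      using ca cr \<Delta> by (simp_all add: less_divide_eq divide_less_eq \<Delta>_def)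
    have sq: "sqrt (1 - (?w \<theta>)\<^sup>2) = 2 * p * q / \<Delta>"
      unfolding w1 using pq \<Delta> by simp
    (* elimination of the angle: the angular derivative as a function of the value of S *)
    have ang: "sinh r * sin \<theta> = sqrt 2 * exp (?S \<theta> / 2) * p"
    proof (rule power2_eq_imp_eq)
      have "(sinh r * sin \<theta>)\<^sup>2 = (sinh r)\<^sup>2 - (exp (?S \<theta>) - cosh r)\<^sup>2"
        unfolding exp_busemann power_mult_distrib sin_squared_eq by (simp add: power2_eq_square algebra_simps)
      also have "\<dots> = 2 * exp (?S \<theta>) * cosh r - (exp (?S \<theta>))\<^sup>2 - 1"
        unfolding sinh_square_eq by (simp add: power2_eq_square algebra_simps)
      also have "\<dots> = 2 * exp (?S \<theta>) * (cosh r - cosh (?S \<theta>))"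
        by (simp add: cosh_def power2_eq_square algebra_simps flip: exp_add)
      also have "\<dots> = (sqrt 2 * exp (?S \<theta> / 2) * p)\<^sup>2"
        unfolding power_mult_distrib pq by (simp add: power2_eq_square flip: exp_add)
      finally show "(sinh r * sin \<theta>)\<^sup>2 = (sqrt 2 * exp (?S \<theta> / 2) * p)\<^sup>2" .
      show "0 \<le> sinh r * sin \<theta>" using sr t0 sin_ge_zero[of \<theta>] by simp
      show "0 \<le> sqrt 2 * exp (?S \<theta> / 2) * p" using pq by simp
    qed
    have dS: "(?S has_real_derivative - sinh r * sin \<theta> / exp (?S \<theta>)) (at \<theta>)"
      using DERIV_busemann_angle[of r \<theta> UNIV] by (simp add: exp_busemann)
    have dw: "(?w has_real_derivative 2 * (sinh (?S \<theta>) * (- sinh r * sin \<theta> / exp (?S \<theta>))) / \<Delta>) (at \<theta>)"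
      using \<Delta> dS by (auto intro!: derivative_eq_intros)
    have "((\<lambda>\<theta>. - arcsin (?w \<theta>)) has_real_derivative
       - (inverse (sqrt (1 - (?w \<theta>)\<^sup>2)) * (2 * (sinh (?S \<theta>) * (- sinh r * sin \<theta> / exp (?S \<theta>))) / \<Delta>))) (at \<theta>)"
      by (intro DERIV_minus DERIV_chain2[OF DERIV_arcsin dw] w2)
    also have "- (inverse (sqrt (1 - (?w \<theta>)\<^sup>2)) * (2 * (sinh (?S \<theta>) * (- sinh r * sin \<theta> / exp (?S \<theta>))) / \<Delta>))
        = (sinh r * sin \<theta>) * sinh (?S \<theta>) / (exp (?S \<theta>) * (p * q))"
      unfolding sq using pq \<Delta> by (simp add: field_simps)
    also have "\<dots> = sqrt 2 * sinh (?S \<theta>) * exp (?S \<theta> / 2) / (exp (?S \<theta>) * q)"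
      unfolding ang using pq by (simp add: field_simps)
    also have "\<dots> = ?q \<theta>"
    proof -
      have "exp (?S \<theta>) = exp (?S \<theta> / 2) * exp (?S \<theta> / 2)" by (simp flip: exp_add)
      then show ?thesis unfolding q_def[symmetric] by (simp add: exp_minus field_simps)
    qed
    finally show "((\<lambda>\<theta>. - arcsin (?w \<theta>)) has_vector_derivative ?q \<theta>) (at \<theta>)"
      by (simp add: has_real_derivative_iff_has_vector_derivative)
  qed (use \<alpha> in simp)
  moreover have "?w \<alpha> = -1" using \<Delta> True a by (auto simp add: S\<alpha> \<Delta>_def divide_eq_eq)
  moreover have "?w 0 = 1"
    using \<Delta> True a by (simp add: busemann_def cosh_plus_sinh \<Delta>_def divide_eq_eq)
  ultimately have hi: "(?q has_integral pi) {0..\<alpha>}" by simp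
  have q0: "?q \<theta> \<ge> 0" if "\<theta> \<in> {0..\<alpha>}" for \<theta>
    using ge[OF that] a by (auto simp: cosh_real_nonneg_le_iff)
  have "(\<integral>\<^sup>+\<theta>. ennreal (exp (- ?S \<theta> / 2)) * abel_kernel a (?S \<theta>) \<partial>angle_measure)
      = (\<integral>\<^sup>+\<theta>. ennreal (1 / pi) * (ennreal (?q \<theta>) * indicator {0..\<alpha>} \<theta>) \<partial>lborel)"
    unfolding angle_measure_def
  proof (subst nn_integral_density)
    show "(\<integral>\<^sup>+\<theta>. ennreal (indicator {0..pi} \<theta> / pi) * (ennreal (exp (- ?S \<theta> / 2)) * abel_kernel a (?S \<theta>)) \<partial>lborel)
      = (\<integral>\<^sup>+\<theta>. ennreal (1 / pi) * (ennreal (?q \<theta>) * indicator {0..\<alpha>} \<theta>) \<partial>lborel)"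
    proof (rule nn_integral_cong)
      fix \<theta>
      show "ennreal (indicator {0..pi} \<theta> / pi) * (ennreal (exp (- ?S \<theta> / 2)) * abel_kernel a (?S \<theta>))
         = ennreal (1 / pi) * (ennreal (?q \<theta>) * indicator {0..\<alpha>} \<theta>)"
      proof (cases "\<theta> \<in> {0..pi}")
        case in_pi: True
        show ?thesis
        proof (cases "\<theta> < \<alpha>")
          case True
          with in_pi S_gt[OF in_pi] have k: "abel_kernel a (?S \<theta>)
              = ennreal (sqrt 2 * sinh (?S \<theta>) / sqrt (cosh (?S \<theta>) - cosh a))"
            by (simp add: abel_kernel_def)
          have q: "ennreal (?q \<theta>) = ennreal (exp (- ?S \<theta> / 2))
              * ennreal (sqrt 2 * sinh (?S \<theta>) / sqrt (cosh (?S \<theta>) - cosh a))"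
            by (rule ennreal_mult') simp
          show ?thesis unfolding k q using in_pi True by simp
        next
          case False
          (* at the end point the vanishing root in the denominator makes the right side 0 as well *)
          with in_pi S_gt[OF in_pi] S\<alpha> show ?thesis by (cases "\<theta> = \<alpha>") (auto simp: abel_kernel_def)
        qed
      qed (use \<alpha> in auto)
    qed
  qed auto
  also have "\<dots> = ennreal (1 / pi) * (\<integral>\<^sup>+\<theta>. ennreal (?q \<theta>) * indicator {0..\<alpha>} \<theta> \<partial>lborel)"
    by (rule nn_integral_cmult) measurable
  also have "(\<integral>\<^sup>+\<theta>. ennreal (?q \<theta>) * indicator {0..\<alpha>} \<theta> \<partial>lborel) = ennreal pi"
    by (rule nn_integral_has_integral_lebesgue'[OF q0 hi])
  also have "ennreal (1 / pi) * ennreal pi = 1" by (simp flip: ennreal_mult)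
  finally show ?thesis using True by simp
qed

text \<open>
  The law of the Busemann function, tested on the Abel kernel.
\<close>

lemma (in bessel) tail_probability:
  assumes t: "t > 0" and a: "a \<ge> 0"
  shows "emeasure M {\<omega> \<in> space M. R t \<omega> > a}
       = ennreal (exp (- t / 8)) * (\<integral>\<^sup>+x. ennreal (std_normal_density x) * abel_kernel a (sqrt t * x) \<partial>lborel)"
proof -
  have [measurable]: "R t \<in> borel_measurable M" using t by (intro R_measurable) simp
  have "emeasure M {\<omega> \<in> space M. R t \<omega> > a} = (\<integral>\<^sup>+\<omega>. indicator {\<omega> \<in> space M. R t \<omega> > a} \<omega> \<partial>M)" by simp
  also have "\<dots> = (\<integral>\<^sup>+\<omega>. \<integral>\<^sup>+\<theta>. ennreal (exp (- busemann (R t \<omega>) \<theta> / 2)) * abel_kernel a (busemann (R t \<omega>) \<theta>) \<partial>angle_measure \<partial>M)"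
  proof (rule nn_integral_cong_AE)
    have "AE \<omega> in M. R t \<omega> \<ge> 0" using t by (intro AE_R_nonneg) simp
    then show "AE \<omega> in M. indicator {\<omega> \<in> space M. R t \<omega> > a} \<omega> =
       (\<integral>\<^sup>+\<theta>. ennreal (exp (- busemann (R t \<omega>) \<theta> / 2)) * abel_kernel a (busemann (R t \<omega>) \<theta>) \<partial>angle_measure)"
      using AE_space by eventually_elim (simp only: abel_inversion[OF _ a], simp add: indicator_def)
  qed
  finally show ?thesis unfolding busemann_law[OF t borel_measurable_abel_kernel] .
qed

section \<open>Substitution and differentiation under the integral\<close>

lemma nn_integral_substitution_inj:
  fixes f g g' :: "real \<Rightarrow> real"
  assumes S: "S \<in> sets borel"
    and g: "\<And>u. u \<in> S \<Longrightarrow> (g has_real_derivative g' u) (at u within S)" and inj: "inj_on g S"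
    and nn: "\<And>x. x \<in> g ` S \<Longrightarrow> 0 \<le> f x"
    and int: "set_integrable lborel S (\<lambda>u. \<bar>g' u\<bar> * f (g u))"
  shows "(\<integral>\<^sup>+u. ennreal (\<bar>g' u\<bar> * f (g u)) * indicator S u \<partial>lborel)
       = (\<integral>\<^sup>+x. ennreal (f x) * indicator (g ` S) x \<partial>lborel)"
proof -
  let ?h = "\<lambda>u. \<bar>g' u\<bar> * f (g u)"
  have leb: "S \<in> sets lebesgue" using S by (simp add: sets_completionI_sets)
  have a: "?h absolutely_integrable_on S"
    using int unfolding set_integrable_def by (intro integrable_completion[THEN iffD2]) auto
  then have i: "?h integrable_on S" by (rule set_lebesgue_integral_eq_integral(1))
  have "f absolutely_integrable_on g ` S \<and> integral (g ` S) f = integral S ?h"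
    using has_absolute_integral_change_of_variables_1'[OF leb g inj, of f "integral S ?h"] a by blast
  then have "(f has_integral integral S ?h) (g ` S)"
    using set_lebesgue_integral_eq_integral(1) by (auto simp: has_integral_iff)
  moreover have "(?h has_integral integral S ?h) S" using i by (rule integrable_integral)
  ultimately show ?thesis
    using nn_integral_has_integral_lebesgue'[of S ?h "integral S ?h"]
      nn_integral_has_integral_lebesgue'[of "g ` S" f "integral S ?h"] nn by simp
qed

text \<open>
  The derivative may be one-sided, as \<open>S\<close> need not be a neighbourhood of \<open>y0\<close>: difference quotients are
  dominated by the bound on the derivative along the convex set \<open>S\<close>.
\<close>

lemma has_real_derivative_lebesgue_integral:
  fixes f f' :: "real \<Rightarrow> 'a \<Rightarrow> real"
  assumes S: "convex S" "y0 \<in> S"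
    and int: "\<And>y. y \<in> S \<Longrightarrow> integrable M (f y)"
    and meas: "f' y0 \<in> borel_measurable M"
    and der: "AE x in M. \<forall>y\<in>S. ((\<lambda>y. f y x) has_real_derivative f' y x) (at y within S)"
    and bd: "AE x in M. \<forall>y\<in>S. \<bar>f' y x\<bar> \<le> w x" and w: "integrable M w"
  shows "((\<lambda>y. \<integral>x. f y x \<partial>M) has_real_derivative (\<integral>x. f' y0 x \<partial>M)) (at y0 within S)"
  unfolding has_field_derivative_iff tendsto_at_iff_sequentially comp_def
proof (intro allI impI)
  fix X :: "nat \<Rightarrow> real" assume X: "\<forall>i. X i \<in> S - {y0}" "X \<longlonglongrightarrow> y0"
  have "(\<lambda>i. \<integral>x. (f (X i) x - f y0 x) / (X i - y0) \<partial>M) \<longlonglongrightarrow> (\<integral>x. f' y0 x \<partial>M)"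
  proof (rule integral_dominated_convergence[where w = w])
    show "AE x in M. (\<lambda>i. (f (X i) x - f y0 x) / (X i - y0)) \<longlonglongrightarrow> f' y0 x"
      using der
    proof eventually_elim
      case (elim x)
      then have "((\<lambda>y. (f y x - f y0 x) / (y - y0)) \<longlongrightarrow> f' y0 x) (at y0 within S)"
        using S(2) unfolding has_field_derivative_iff by blast
      then show ?case using X unfolding tendsto_at_iff_sequentially comp_def by blast
    qed
    show "AE x in M. norm ((f (X i) x - f y0 x) / (X i - y0)) \<le> w x" for i
      using der bd
    proof eventually_elim
      case (elim x)
      have "norm (f (X i) x - f y0 x) \<le> w x * norm (X i - y0)"
        by (rule field_differentiable_bound[OF S(1), where f = "\<lambda>y. f y x" and f' = "\<lambda>y. f' y x"])
           (use elim X S in auto)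
      moreover have "norm (X i - y0) > 0" using X by auto
      ultimately show ?case by (simp add: norm_divide divide_le_eq)
    qed
    show "(\<lambda>x. (f (X i) x - f y0 x) / (X i - y0)) \<in> borel_measurable M" for i
      using int[of "X i"] int[of y0] X(1) S(2) by (auto intro: borel_measurable_integrable)
  qed (use meas w in auto)
  moreover have "(\<integral>x. (f (X i) x - f y0 x) / (X i - y0) \<partial>M) = ((\<integral>x. f (X i) x \<partial>M) - (\<integral>x. f y0 x \<partial>M)) / (X i - y0)" for i
    using int[of "X i"] int[of y0] X(1) S(2)
    by (subst integral_divide_zero, subst Bochner_Integration.integral_diff) auto
  ultimately show "(\<lambda>i. ((\<integral>x. f (X i) x \<partial>M) - (\<integral>x. f y0 x \<partial>M)) / (X i - y0)) \<longlonglongrightarrow> (\<integral>x. f' y0 x \<partial>M)"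
    by (simp only:)
qed

section \<open>The function phi and the derivative of G\<close>

lemma cosh_phi_arg_ge_1: "y \<ge> 0 \<Longrightarrow> 1 \<le> y * exp (- x) + cosh (x :: real)"
  using cosh_real_ge_1[of x] by (simp add: add_increasing)

lemma phi_eq_arcosh:
  assumes "y \<ge> 0"
  shows "phi y x = arcosh (y * exp (- x) + cosh x)"
proof -
  have "(y * exp (- x) + cosh x)\<^sup>2 - 1 = y\<^sup>2 * exp (- 2 * x) + (sinh x)\<^sup>2 + 2 * y * exp (- x) * cosh x"
    by (simp add: power2_sum sinh_square_eq power_mult_distrib flip: exp_of_nat_mult)
  then show ?thesis
    unfolding phi_def arcosh_real_def[OF cosh_phi_arg_ge_1[OF assms]] by simp
qed

lemma phi_ge_abs: "y \<ge> 0 \<Longrightarrow> \<bar>x\<bar> \<le> phi y x"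
proof -
  assume y: "y \<ge> 0"
  have "cosh \<bar>x\<bar> \<le> cosh (phi y x)"
    using y cosh_phi_arg_ge_1[OF y, of x] by (simp add: phi_eq_arcosh)
  moreover have "phi y x \<ge> 0" using cosh_phi_arg_ge_1[OF y, of x] by (simp add: phi_eq_arcosh[OF y])
  ultimately show ?thesis by (simp only: cosh_real_nonneg_le_iff abs_ge_zero)
qed

lemma phi_0: "phi 0 x = \<bar>x\<bar>"
  using arcosh_cosh_real[of "\<bar>x\<bar>"] by (simp add: phi_eq_arcosh)

lemma borel_measurable_phi [measurable]:
  assumes [measurable]: "f \<in> borel_measurable N" "g \<in> borel_measurable N"
  shows "(\<lambda>x. phi (f x) (g x)) \<in> borel_measurable N"
  unfolding phi_def by measurable

lemma le_sinh: "(x::real) \<ge> 0 \<Longrightarrow> x \<le> sinh x"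
proof -
  assume x: "x \<ge> 0"
  have "sinh 0 - 0 \<le> sinh x - x"
  proof (rule DERIV_nonneg_imp_nondecreasing[OF x])
    fix z :: real
    show "\<exists>D. ((\<lambda>z. sinh z - z) has_real_derivative D) (at z) \<and> D \<ge> 0"
      by (rule exI[of _ "cosh z - 1"]) (auto intro!: derivative_eq_intros simp: cosh_real_ge_1)
  qed
  then show ?thesis by simp
qed

text \<open>
  Up to a constant, \<open>G\<close> is the Lebesgue integral of \<open>phi_kernel\<close>, because the factor \<open>exp (x\<^sup>2 / (2 v))\<close>
  in its integrand cancels the Gaussian density; \<open>phi_slope\<close> is minus the derivative of \<open>phi_kernel\<close>
  in \<open>y\<close>, in which the factor \<open>exp x\<close> has disappeared.
\<close>

definition phi_kernel :: "real \<Rightarrow> real \<Rightarrow> real \<Rightarrow> real" where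
  "phi_kernel v y x = exp (x - (phi y x)\<^sup>2 / (2 * v))"

definition phi_slope :: "real \<Rightarrow> real \<Rightarrow> real \<Rightarrow> real" where
  "phi_slope v y x = phi y x / sinh (phi y x) * exp (- (phi y x)\<^sup>2 / (2 * v)) / v"

lemma borel_measurable_phi_kernel [measurable]:
  assumes [measurable]: "f \<in> borel_measurable N" "g \<in> borel_measurable N"
  shows "(\<lambda>x. phi_kernel v (f x) (g x)) \<in> borel_measurable N"
  unfolding phi_kernel_def by measurable

lemma borel_measurable_phi_slope [measurable]:
  assumes [measurable]: "f \<in> borel_measurable N" "g \<in> borel_measurable N"
  shows "(\<lambda>x. phi_slope v (f x) (g x)) \<in> borel_measurable N"
  unfolding phi_slope_def by measurable

lemma exp_phi_le:
  assumes "v > 0" "y \<ge> 0"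
  shows "exp (- (phi y x)\<^sup>2 / (2 * v)) \<le> sqrt (2 * pi * v) * normal_density 0 (sqrt v) x"
proof -
  have "x\<^sup>2 \<le> (phi y x)\<^sup>2"
    using power_mono[OF phi_ge_abs[OF assms(2), of x] abs_ge_zero, of 2] by simp
  then have "exp (- (phi y x)\<^sup>2 / (2 * v)) \<le> exp (- x\<^sup>2 / (2 * v))"
    using assms by (simp add: divide_right_mono)
  also have "\<dots> = sqrt (2 * pi * v) * normal_density 0 (sqrt v) x"
    using assms by (simp add: normal_density_def)
  finally show ?thesis .
qed

lemma gauss_exp_integral:
  assumes v: "v > 0"
  shows "has_bochner_integral lborel (\<lambda>x. exp (x - x\<^sup>2 / (2 * v))) (exp (v / 2) * sqrt (2 * pi * v))"
proof -
  have "exp (x - x\<^sup>2 / (2 * v)) = exp (v / 2) * sqrt (2 * pi * v) * normal_density v (sqrt v) x" for x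
  proof -
    have "x - x\<^sup>2 / (2 * v) = v / 2 + - (x - v)\<^sup>2 / (2 * v)"
      using v by (simp add: field_simps power2_eq_square)
    then have "exp (x - x\<^sup>2 / (2 * v)) = exp (v / 2) * exp (- (x - v)\<^sup>2 / (2 * v))"
      by (simp only: exp_add)
    then show ?thesis using v by (simp add: normal_density_def)
  qed
  moreover have "has_bochner_integral lborel (normal_density v (sqrt v)) 1"
    using v integrable_normal_density[of "sqrt v" v] integral_normal_density[of "sqrt v" v]
    by (auto simp: has_bochner_integral_iff)
  then have "has_bochner_integral lborel (\<lambda>x. exp (v / 2) * sqrt (2 * pi * v) * normal_density v (sqrt v) x)
      (exp (v / 2) * sqrt (2 * pi * v) * 1)"
    by (intro has_bochner_integral_mult_right) auto
  ultimately show ?thesis by simp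
qed

lemma phi_kernel_integrable:
  assumes "v > 0" "y \<ge> 0"
  shows "integrable lborel (phi_kernel v y)"
proof (rule Bochner_Integration.integrable_bound)
  show "integrable lborel (\<lambda>x. exp (x - x\<^sup>2 / (2 * v)))"
    using gauss_exp_integral[OF assms(1)] by (simp add: has_bochner_integral_iff)
  show "AE x in lborel. norm (phi_kernel v y x) \<le> norm (exp (x - x\<^sup>2 / (2 * v)))"
  proof (rule AE_I2)
    fix x
    have "x\<^sup>2 \<le> (phi y x)\<^sup>2"
      using power_mono[OF phi_ge_abs[OF assms(2), of x] abs_ge_zero, of 2] by simp
    then show "norm (phi_kernel v y x) \<le> norm (exp (x - x\<^sup>2 / (2 * v)))"
      using assms by (simp add: phi_kernel_def divide_right_mono)
  qed
qed simp

text \<open>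
  The domination is uniform in \<open>y\<close> because \<open>phi y x\<close> is at least \<open>\<bar>x\<bar>\<close> and at most its hyperbolic sine.
\<close>

lemma phi_slope_bounds:
  assumes "v > 0" "y \<ge> 0"
  shows "0 \<le> phi_slope v y x" "\<bar>phi_slope v y x\<bar> \<le> sqrt (2 * pi * v) * normal_density 0 (sqrt v) x / v"
proof -
  have p: "phi y x \<ge> 0" using phi_ge_abs[OF assms(2), of x] by linarith
  show nn: "0 \<le> phi_slope v y x" using p assms by (simp add: phi_slope_def)
  have "phi y x / sinh (phi y x) \<le> 1"
    using le_sinh[OF p] p by (cases "phi y x = 0") (auto simp: divide_le_eq)
  then have "phi y x / sinh (phi y x) * exp (- (phi y x)\<^sup>2 / (2 * v)) \<le> 1 * exp (- (phi y x)\<^sup>2 / (2 * v))"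
    by (intro mult_right_mono) auto
  also have "\<dots> \<le> sqrt (2 * pi * v) * normal_density 0 (sqrt v) x"
    using exp_phi_le[OF assms] by simp
  finally have "phi_slope v y x \<le> sqrt (2 * pi * v) * normal_density 0 (sqrt v) x / v"
    unfolding phi_slope_def using assms by (intro divide_right_mono) auto
  with nn show "\<bar>phi_slope v y x\<bar> \<le> sqrt (2 * pi * v) * normal_density 0 (sqrt v) x / v" by simp
qed

text \<open>
  For \<open>x = 0\<close> and \<open>y = 0\<close> the argument of the inverse hyperbolic cosine is 1, where that function is not
  differentiable; a single point does not matter for the integral over \<open>x\<close>.
\<close>

lemma DERIV_phi_kernel:
  assumes v: "v > 0" and y: "y \<ge> 0" and x: "x \<noteq> 0"
  shows "((\<lambda>y. phi_kernel v y x) has_real_derivative - phi_slope v y x) (at y within {0..})"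
proof -
  let ?C = "\<lambda>y. y * exp (- x) + cosh x"
  have C: "?C y > 1"
  proof -
    have "cosh x > 1" using x cosh_real_strict_mono[of 0 "\<bar>x\<bar>"] by simp
    then show ?thesis using y by (simp add: add_nonneg_pos add_strict_increasing2)
  qed
  have s: "sinh (phi y x) = sqrt ((?C y)\<^sup>2 - 1)"
    using C by (simp add: phi_eq_arcosh[OF y] sinh_arcosh_real)
  have sp: "sinh (phi y x) > 0" unfolding s using C by (simp add: one_less_power)
  have dC: "(?C has_real_derivative exp (- x)) (at y within {0..})"
    by (auto intro!: derivative_eq_intros)
  have "((\<lambda>y. arcosh (?C y)) has_real_derivative 1 / sqrt ((?C y)\<^sup>2 - 1) * exp (- x)) (at y within {0..})"
    by (rule DERIV_chain2[OF arcosh_real_has_field_derivative[OF C] dC])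
  then have d: "((\<lambda>y. phi y x) has_real_derivative exp (- x) / sinh (phi y x)) (at y within {0..})"
    unfolding s has_field_derivative_def
    by (rule has_derivative_transform[rotated 2, THEN has_derivative_eq_rhs])
       (use y in \<open>auto simp: phi_eq_arcosh\<close>)
  define D where "D = exp (- x) / sinh (phi y x)"
  have "((\<lambda>y. x - (phi y x)\<^sup>2 / (2 * v)) has_real_derivative
      0 - real 2 * (D * phi y x ^ (2 - Suc 0)) / (2 * v)) (at y within {0..})"
    unfolding D_def by (intro DERIV_diff DERIV_const DERIV_cdivide DERIV_power d)
  from DERIV_chain2[OF DERIV_exp this]
  have "((\<lambda>y. phi_kernel v y x) has_real_derivative
      exp (x - (phi y x)\<^sup>2 / (2 * v)) * (0 - real 2 * (D * phi y x ^ (2 - Suc 0)) / (2 * v))) (at y within {0..})"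
    unfolding phi_kernel_def .
  also have "exp (x - (phi y x)\<^sup>2 / (2 * v)) * (0 - real 2 * (D * phi y x ^ (2 - Suc 0)) / (2 * v))
      = - phi_slope v y x"
  proof -
    have "exp (x - (phi y x)\<^sup>2 / (2 * v)) = exp x * exp (- (phi y x)\<^sup>2 / (2 * v))"
      by (simp flip: exp_add)
    then show ?thesis unfolding phi_slope_def D_def using v sp by (simp add: exp_minus field_simps)
  qed
  finally show ?thesis .
qed

lemma DERIV_phi_kernel_integral:
  assumes v: "v > 0" and y: "y \<ge> 0"
  shows "((\<lambda>y. \<integral>x. phi_kernel v y x \<partial>lborel) has_real_derivative - (\<integral>x. phi_slope v y x \<partial>lborel)) (at y within {0..})"
proof -
  have "((\<lambda>y. \<integral>x. phi_kernel v y x \<partial>lborel) has_real_derivative (\<integral>x. - phi_slope v y x \<partial>lborel)) (at y within {0..})"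
  proof (rule has_real_derivative_lebesgue_integral[where w = "\<lambda>x. sqrt (2 * pi * v) * normal_density 0 (sqrt v) x / v"])
    show "AE x in lborel. \<forall>y\<in>{0..}. ((\<lambda>y. phi_kernel v y x) has_real_derivative - phi_slope v y x) (at y within {0..})"
      using AE_lborel_singleton[of "0 :: real"] by eventually_elim (use DERIV_phi_kernel[OF v] in auto)
    show "AE x in lborel. \<forall>y\<in>{0..}. \<bar>- phi_slope v y x\<bar> \<le> sqrt (2 * pi * v) * normal_density 0 (sqrt v) x / v"
      using phi_slope_bounds(2)[OF v] by auto
    show "integrable lborel (\<lambda>x. sqrt (2 * pi * v) * normal_density 0 (sqrt v) x / v)"
      using v by (auto intro!: integrable_normal_density)
  qed (use phi_kernel_integrable[OF v] y in auto)
  then show ?thesis by simp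
qed

text \<open>
  The law of an increment, combined with \<open>W 0 = 0\<close> almost surely.
\<close>

lemma brownian_marginal:
  assumes "standard_brownian_motion N W" "v > 0"
  shows "distributed N lborel (W v) (\<lambda>x. ennreal (normal_density 0 (sqrt v) x))"
proof -
  interpret brownian N "natural_filtration N W" W
    using assms(1) by unfold_locales (simp add: standard_brownian_motion_def)
  have [measurable]: "W v \<in> borel_measurable N" "W 0 \<in> borel_measurable N"
    using assms(2) by (auto intro: B_measurable)
  have "\<forall>s t. 0 \<le> s \<and> s < t \<longrightarrow>
        distributed N lborel (\<lambda>\<omega>. W t \<omega> - W s \<omega>) (\<lambda>x. ennreal (normal_density 0 (sqrt (t - s)) x))"
    using bm unfolding brownian_motion_wrt_def by blast
  from this[rule_format, of 0 v] assms(2)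
  have d: "distributed N lborel (\<lambda>\<omega>. W v \<omega> - W 0 \<omega>) (\<lambda>x. ennreal (normal_density 0 (sqrt v) x))" by simp
  have "AE \<omega> in N. W 0 \<omega> = 0 \<and> continuous_on {0..} (\<lambda>t. W t \<omega>)"
    using bm unfolding brownian_motion_wrt_def by blast
  then have "AE \<omega> in N. W v \<omega> = W v \<omega> - W 0 \<omega>" by eventually_elim simp
  then have "distr N lborel (W v) = distr N lborel (\<lambda>\<omega>. W v \<omega> - W 0 \<omega>)"
    by (intro distr_cong_AE) auto
  with d show ?thesis unfolding distributed_def by simp
qed

lemma normal_density_G_integrand:
  assumes "v > 0"
  shows "normal_density 0 (sqrt v) x * exp (x + 1 / (2 * v) * (x\<^sup>2 - (phi y x)\<^sup>2)) = phi_kernel v y x / sqrt (2 * pi * v)"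
proof -
  have "exp (- x\<^sup>2 / (2 * v)) * exp (x + 1 / (2 * v) * (x\<^sup>2 - (phi y x)\<^sup>2)) = phi_kernel v y x"
    unfolding phi_kernel_def exp_add[symmetric] using assms by (simp add: field_simps)
  then show ?thesis using assms by (simp add: normal_density_def)
qed

lemma G_phi_kernel:
  assumes W: "standard_brownian_motion N W" and v: "v > 0" and y: "y \<ge> 0"
  shows "integrable N (G_integrand W v y)"
    and "G N W v y = exp (- v / 2) / sqrt (2 * pi * v) * (\<integral>x. phi_kernel v y x \<partial>lborel)"
proof -
  note d = brownian_marginal[OF W v]
  let ?h = "\<lambda>x. exp (x + 1 / (2 * v) * (x\<^sup>2 - (phi y x)\<^sup>2))"
  have h: "?h \<in> borel_measurable lborel" by simp
  have GI: "G_integrand W v y = (\<lambda>\<omega>. ?h (W v \<omega>))" by (simp add: G_integrand_def fun_eq_iff)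
  show "integrable N (G_integrand W v y)"
    unfolding GI distributed_integrable[OF d h normal_density_nonneg, symmetric]
      normal_density_G_integrand[OF v]
    using phi_kernel_integrable[OF v y] by simp
  have "(\<integral>\<omega>. G_integrand W v y \<omega> \<partial>N) = (\<integral>x. phi_kernel v y x / sqrt (2 * pi * v) \<partial>lborel)"
    unfolding GI distributed_integral[OF d h normal_density_nonneg, symmetric]
      normal_density_G_integrand[OF v] ..
  then show "G N W v y = exp (- v / 2) / sqrt (2 * pi * v) * (\<integral>x. phi_kernel v y x \<partial>lborel)"
    by (simp add: G_def)
qed

lemma DERIV_G:
  assumes W: "standard_brownian_motion N W" and v: "v > 0" and y: "y \<ge> 0"
  shows "(G N W v has_real_derivative - (exp (- v / 2) / sqrt (2 * pi * v) * (\<integral>x. phi_slope v y x \<partial>lborel))) (at y within {0..})"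
proof -
  let ?k = "exp (- v / 2) / sqrt (2 * pi * v)"
  have "((\<lambda>y. ?k * (\<integral>x. phi_kernel v y x \<partial>lborel)) has_real_derivative ?k * - (\<integral>x. phi_slope v y x \<partial>lborel)) (at y within {0..})"
    by (intro DERIV_cmult DERIV_phi_kernel_integral v y)
  then have "((\<lambda>y. ?k * (\<integral>x. phi_kernel v y x \<partial>lborel)) has_real_derivative - (?k * (\<integral>x. phi_slope v y x \<partial>lborel))) (at y within {0..})"
    by simp
  then show ?thesis
    unfolding has_field_derivative_def
    by (rule has_derivative_transform[rotated 2]) (use y G_phi_kernel(2)[OF W v] in auto)
qed

lemma G_deriv_eq:
  assumes W: "standard_brownian_motion N W" and v: "v > 0" and y: "y \<ge> 0"
  shows "G_deriv N W v y = - (exp (- v / 2) / sqrt (2 * pi * v) * (\<integral>x. phi_slope v y x \<partial>lborel))"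
  unfolding G_deriv_def
proof (rule vector_derivative_within)
  have "at y within {y<..} \<le> at y within {0..}" using y by (intro at_le) auto
  then show "at y within {0..} \<noteq> bot"
    using trivial_limit_at_right_real[of y] by (metis bot.extremum_uniqueI)
  show "(G N W v has_vector_derivative - (exp (- v / 2) / sqrt (2 * pi * v) * (\<integral>x. phi_slope v y x \<partial>lborel))) (at y within {0..})"
    using DERIV_G[OF W v y] by (simp add: has_real_derivative_iff_has_vector_derivative)
qed

text \<open>
  The total mass: \<open>phi 0 x = \<bar>x\<bar>\<close>, so \<open>G\<close> at 0 is \<open>exp (- v / 2)\<close> times the exponential moment of a
  centred normal variable of variance \<open>v\<close>.
\<close>

lemma G_0:
  assumes W: "standard_brownian_motion N W" and v: "v > 0"
  shows "G N W v 0 = 1"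
proof -
  have "(\<integral>x. phi_kernel v 0 x \<partial>lborel) = exp (v / 2) * sqrt (2 * pi * v)"
    using gauss_exp_integral[OF v] by (simp add: phi_kernel_def phi_0 has_bochner_integral_iff)
  then show ?thesis using v by (simp add: G_phi_kernel(2)[OF W v] exp_minus)
qed

section \<open>The tail and the density\<close>

text \<open>
  After the shift \<open>x = ln c + u\<close> the argument of the inverse hyperbolic cosine is even in \<open>u\<close>, and the two
  half lines combine \<open>exp u\<close> and \<open>exp (- u)\<close> to \<open>2 cosh u\<close>.
\<close>

lemma phi_kernel_fold:
  assumes v: "v > 0" and c: "c \<ge> 1" and y: "y = (c\<^sup>2 - 1) / 2"
  shows "(\<integral>\<^sup>+x. ennreal (phi_kernel v y x) \<partial>lborel)
       = (\<integral>\<^sup>+u. ennreal (2 * c * cosh u * exp (- (arcosh (c * cosh u))\<^sup>2 / (2 * v))) * indicator {0<..} u \<partial>lborel)"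
proof -
  have cp: "c > 0" using c by simp
  have y0: "y \<ge> 0" using c by (simp add: y)
  define E where "E u = exp (- (phi y (ln c + u))\<^sup>2 / (2 * v))" for u
  have [measurable]: "E \<in> borel_measurable borel" unfolding E_def[abs_def] by measurable
  have phi_eq: "phi y (ln c + u) = arcosh (c * cosh u)" for u
  proof -
    have "y * exp (- (ln c + u)) + cosh (ln c + u) = (2 * y + 1) * exp (- (ln c + u)) / 2 + exp (ln c + u) / 2"
      by (simp add: cosh_def field_simps)
    also have "\<dots> = c * cosh u"
      using cp by (simp add: y exp_add exp_diff exp_minus cosh_def field_simps power2_eq_square)
    finally show ?thesis by (simp add: phi_eq_arcosh[OF y0])
  qed
  have E_even: "E (- u) = E u" for u by (simp add: E_def phi_eq[of "-u", simplified] phi_eq[of u])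
  have ker: "phi_kernel v y (ln c + u) = c * exp u * E u" for u
  proof -
    have "phi_kernel v y (ln c + u) = exp (ln c) * exp u * exp (- (phi y (ln c + u))\<^sup>2 / (2 * v))"
      unfolding phi_kernel_def by (simp flip: exp_add)
    then show ?thesis using cp by (simp add: E_def)
  qed
  have "(\<integral>\<^sup>+x. ennreal (phi_kernel v y x) \<partial>lborel) = (\<integral>\<^sup>+u. ennreal (c * exp u * E u) \<partial>lborel)"
    by (subst nn_integral_real_affine[where c = 1 and t = "ln c"]) (simp_all add: ker)
  also have "\<dots> = (\<integral>\<^sup>+u. ennreal (c * exp u * E u) * indicator {0<..} u + ennreal (c * exp u * E u) * indicator {..<0} u \<partial>lborel)"
  proof (rule nn_integral_cong_AE)
    show "AE u in lborel. ennreal (c * exp u * E u) = ennreal (c * exp u * E u) * indicator {0<..} u + ennreal (c * exp u * E u) * indicator {..<0} u"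
      using AE_lborel_singleton[of "0 :: real"] by eventually_elim (auto simp: indicator_def)
  qed
  also have "\<dots> = (\<integral>\<^sup>+u. ennreal (c * exp u * E u) * indicator {0<..} u \<partial>lborel) + (\<integral>\<^sup>+u. ennreal (c * exp u * E u) * indicator {..<0} u \<partial>lborel)"
    by (rule nn_integral_add) auto
  also have "(\<integral>\<^sup>+u. ennreal (c * exp u * E u) * indicator {..<0} u \<partial>lborel) = (\<integral>\<^sup>+u. ennreal (c * exp (- u) * E u) * indicator {0<..} u \<partial>lborel)"
    by (subst nn_integral_real_affine[where c = "-1" and t = 0])
       (auto simp: E_even indicator_def intro!: nn_integral_cong)
  also have "(\<integral>\<^sup>+u. ennreal (c * exp u * E u) * indicator {0<..} u \<partial>lborel) + (\<integral>\<^sup>+u. ennreal (c * exp (- u) * E u) * indicator {0<..} u \<partial>lborel)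
      = (\<integral>\<^sup>+u. ennreal (c * exp u * E u) * indicator {0<..} u + ennreal (c * exp (- u) * E u) * indicator {0<..} u \<partial>lborel)"
    by (rule nn_integral_add[symmetric]) auto
  also have "\<dots> = (\<integral>\<^sup>+u. ennreal (2 * c * cosh u * E u) * indicator {0<..} u \<partial>lborel)"
  proof (rule nn_integral_cong)
    fix u
    have "ennreal (c * exp u * E u) + ennreal (c * exp (- u) * E u) = ennreal (c * exp u * E u + c * exp (- u) * E u)"
      using cp by (intro ennreal_plus[symmetric]) (auto simp: E_def)
    also have "c * exp u * E u + c * exp (- u) * E u = 2 * c * cosh u * E u"
      by (simp add: cosh_def field_simps)
    finally show "ennreal (c * exp u * E u) * indicator {0<..} u + ennreal (c * exp (- u) * E u) * indicator {0<..} u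
        = ennreal (2 * c * cosh u * E u) * indicator {0<..} u"
      by (simp only: distrib_right[symmetric])
  qed
  finally show ?thesis unfolding E_def phi_eq .
qed

lemma arcosh_cosh_image:
  fixes s a :: real
  assumes s: "s > 0" and a: "a \<ge> 0"
  shows "(\<lambda>u. 2 / s * arcosh (cosh (a / 2) * cosh u)) ` {0<..} = {x. a < s * x}"
proof -
  define c where "c = cosh (a / 2)"
  have c: "c \<ge> 1" by (simp add: c_def cosh_real_ge_1)
  have "2 / s * arcosh (c * cosh u) \<in> {x. a < s * x}" if u: "u > 0" for u
  proof -
    have "cosh u > 1" using cosh_real_strict_mono[of 0 u] u by simp
    then have "c < c * cosh u" using c by simp
    then have "arcosh c < arcosh (c * cosh u)" using c by (intro arcosh_real_strict_mono)
    moreover have "arcosh c = a / 2" using a by (simp add: c_def arcosh_cosh_real)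
    ultimately show ?thesis using s by simp
  qed
  moreover have "\<exists>u>0. x = 2 / s * arcosh (c * cosh u)" if x: "a < s * x" for x
  proof -
    define A where "A = s * x / 2"
    have A: "A > a / 2" using x by (simp add: A_def)
    then have "cosh A > c" unfolding c_def using a by (intro cosh_real_strict_mono) auto
    then have r: "cosh A / c > 1" using c by (simp add: less_divide_eq)
    have "arcosh (cosh A / c) > 0"
      using arcosh_real_strict_mono[OF order_refl r] by (simp only: arcosh_1)
    moreover have "c * cosh (arcosh (cosh A / c)) = cosh A" using r c by simp
    then have "2 / s * arcosh (c * cosh (arcosh (cosh A / c))) = x"
      using A a s by (simp add: arcosh_cosh_real A_def)
    ultimately show ?thesis by metis
  qed
  ultimately show ?thesis unfolding c_def by blast
qed

text \<open>
  The substitution is \<open>sqrt t x = 2 A\<close> with \<open>cosh A = c cosh u\<close> and \<open>c = cosh (a / 2)\<close>. Then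
  \<open>cosh (2 A) - cosh a = 2 (c sinh u)\<^sup>2\<close>, so the singularity of the Abel kernel at \<open>a\<close> is cancelled by the
  Jacobian, and the Gaussian exponent \<open>x\<^sup>2 / 2\<close> becomes \<open>2 A\<^sup>2 / t\<close>, which is \<open>A\<^sup>2 / (2 v)\<close> for \<open>v = t / 4\<close>.
\<close>

lemma abel_integral_eq_phi_kernel:
  assumes t: "t > 0" and a: "a \<ge> 0"
  shows "(\<integral>\<^sup>+x. ennreal (std_normal_density x) * abel_kernel a (sqrt t * x) \<partial>lborel)
       = ennreal (2 / (sqrt t * sqrt (2 * pi))) * (\<integral>\<^sup>+x. ennreal (phi_kernel (t / 4) ((cosh a - 1) / 4) x) \<partial>lborel)"
proof -
  define c where "c = cosh (a / 2)"
  have c: "c \<ge> 1" by (simp add: c_def cosh_real_ge_1)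
  have ca: "cosh a = 2 * c\<^sup>2 - 1" using cosh_double_cosh[of "a / 2"] by (simp add: c_def)
  have st: "sqrt t > 0" using t by simp
  define K where "K = 2 / (sqrt t * sqrt (2 * pi))"
  have K: "K > 0" using st by (simp add: K_def)
  let ?L = "\<lambda>u. 2 * c * cosh u * exp (- (arcosh (c * cosh u))\<^sup>2 / (2 * (t / 4)))"
  let ?g = "\<lambda>u. 2 / sqrt t * arcosh (c * cosh u)"
  let ?g' = "\<lambda>u. 2 / sqrt t * (1 / sqrt ((c * cosh u)\<^sup>2 - 1) * (c * sinh u))"
  let ?f = "\<lambda>x. std_normal_density x * (sqrt 2 * sinh (sqrt t * x) / sqrt (cosh (sqrt t * x) - cosh a))"
  have y: "(cosh a - 1) / 4 = (c\<^sup>2 - 1) / 2" by (simp add: ca)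
  have fold: "(\<integral>\<^sup>+x. ennreal (phi_kernel (t / 4) ((cosh a - 1) / 4) x) \<partial>lborel) = (\<integral>\<^sup>+u. ennreal (?L u) * indicator {0<..} u \<partial>lborel)"
    using t by (intro phi_kernel_fold c y) simp
  have c_cosh: "c * cosh u > 1" if "u > 0" for u
  proof -
    have "cosh u > 1" using cosh_real_strict_mono[of 0 u] that by simp
    also have "cosh u \<le> c * cosh u" using c by simp
    finally show ?thesis .
  qed
  have jac: "\<bar>?g' u\<bar> * ?f (?g u) = K * ?L u" if u: "u > 0" for u
  proof -
    define A where "A = arcosh (c * cosh u)"
    have chA: "cosh A = c * cosh u" and shA: "sinh A = sqrt ((c * cosh u)\<^sup>2 - 1)"
      using c_cosh[OF u] by (simp_all add: A_def sinh_arcosh_real)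
    have shA0: "sinh A > 0" unfolding shA using c_cosh[OF u] by (simp add: one_less_power)
    have su: "sinh u > 0" using u by simp
    have sg: "sqrt t * ?g u = 2 * A" using st by (simp add: A_def)
    have "cosh (2 * A) - cosh a = 2 * ((c * sinh u)\<^sup>2)"
      unfolding cosh_double_cosh chA ca by (simp add: power_mult_distrib sinh_square_eq algebra_simps)
    then have den: "sqrt (cosh (2 * A) - cosh a) = sqrt 2 * (c * sinh u)"
      using su c by (simp add: real_sqrt_mult)
    have nd: "std_normal_density (?g u) = exp (- A\<^sup>2 / (2 * (t / 4))) / sqrt (2 * pi)"
      using t by (simp add: std_normal_density_def A_def power_mult_distrib power_divide)
    have "\<bar>?g' u\<bar> = 2 / sqrt t * (1 / sinh A * (c * sinh u))"
      using st shA0 su c unfolding shA[symmetric] by (simp add: abs_mult)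
    then have "\<bar>?g' u\<bar> * ?f (?g u) = 2 / sqrt t * (1 / sinh A * (c * sinh u)) *
        (exp (- A\<^sup>2 / (2 * (t / 4))) / sqrt (2 * pi) * (sqrt 2 * (2 * sinh A * cosh A) / (sqrt 2 * (c * sinh u))))"
      unfolding sg nd den sinh_double by simp
    also have "\<dots> = K * (2 * cosh A * exp (- A\<^sup>2 / (2 * (t / 4))))"
      using st shA0 su c unfolding K_def by (simp add: field_simps)
    finally show ?thesis unfolding chA by (simp add: A_def)
  qed
  have meas: "(\<lambda>u. K * ?L u) \<in> borel_measurable borel"
  proof -
    have "continuous_on UNIV (\<lambda>u. K * ?L u)"
      using c t cosh_real_ge_1 by (intro continuous_intros) (auto intro: order_trans[OF _ mult_mono[of 1 c 1]])
    then show ?thesis by (rule borel_measurable_continuous_onI)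
  qed
  have nnK: "(\<integral>\<^sup>+u. ennreal (K * ?L u) * indicator {0<..} u \<partial>lborel)
      = ennreal K * (\<integral>\<^sup>+x. ennreal (phi_kernel (t / 4) ((cosh a - 1) / 4) x) \<partial>lborel)"
  proof -
    have [measurable]: "?L \<in> borel_measurable borel"
      using borel_measurable_times[OF borel_measurable_const[of "1 / K"] meas] K by simp
    have "(\<integral>\<^sup>+u. ennreal (K * ?L u) * indicator {0<..} u \<partial>lborel) = (\<integral>\<^sup>+u. ennreal K * (ennreal (?L u) * indicator {0<..} u) \<partial>lborel)"
      using K c by (intro nn_integral_cong) (simp add: ennreal_mult mult.assoc)
    also have "\<dots> = ennreal K * (\<integral>\<^sup>+u. ennreal (?L u) * indicator {0<..} u \<partial>lborel)"
      by (rule nn_integral_cmult) measurable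
    finally show ?thesis unfolding fold .
  qed
  have fin: "(\<integral>\<^sup>+x. ennreal (phi_kernel (t / 4) ((cosh a - 1) / 4) x) \<partial>lborel) < \<infinity>"
    using phi_kernel_integrable[of "t / 4" "(cosh a - 1) / 4"] t cosh_real_ge_1[of a]
    by (simp add: integrable_iff_bounded phi_kernel_def)
  have int: "set_integrable lborel {0<..} (\<lambda>u. \<bar>?g' u\<bar> * ?f (?g u))"
  proof -
    have "set_integrable lborel {0<..} (\<lambda>u. K * ?L u)"
      unfolding set_integrable_def
    proof (rule integrableI_bounded)
      show "(\<lambda>u. indicator {0<..} u *\<^sub>R (K * ?L u)) \<in> borel_measurable lborel" using meas by simp
      have "(\<integral>\<^sup>+u. ennreal (norm (indicator {0<..} u *\<^sub>R (K * ?L u))) \<partial>lborel) = (\<integral>\<^sup>+u. ennreal (K * ?L u) * indicator {0<..} u \<partial>lborel)"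
        using K c by (intro nn_integral_cong) (auto simp: indicator_def abs_mult)
      also have "\<dots> < \<infinity>" unfolding nnK using fin by (simp add: ennreal_mult_less_top)
      finally show "(\<integral>\<^sup>+u. ennreal (norm (indicator {0<..} u *\<^sub>R (K * ?L u))) \<partial>lborel) < \<infinity>" .
    qed
    moreover have "\<bar>?g' u\<bar> * ?f (?g u) = K * ?L u" if "u \<in> {0<..}" for u
      using jac[of u] that by simp
    ultimately show ?thesis by (subst set_integrable_cong[OF refl refl])
  qed
  have img: "?g ` {0<..} = {x. a < sqrt t * x}"
    unfolding c_def by (rule arcosh_cosh_image[OF st a])
  have "(\<integral>\<^sup>+u. ennreal (\<bar>?g' u\<bar> * ?f (?g u)) * indicator {0<..} u \<partial>lborel)
      = (\<integral>\<^sup>+x. ennreal (?f x) * indicator (?g ` {0<..}) x \<partial>lborel)"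
  proof (rule nn_integral_substitution_inj[where g = ?g and g' = ?g' and f = ?f])
    show "set_integrable lborel {0<..} (\<lambda>u. \<bar>?g' u\<bar> * ?f (?g u))" by (rule int)
    show "(?g has_real_derivative ?g' u) (at u within {0<..})" if "u \<in> {0<..}" for u
    proof -
      have d: "((\<lambda>u. c * cosh u) has_real_derivative c * sinh u) (at u within {0<..})"
        by (auto intro!: derivative_eq_intros)
      have "1 < c * cosh u" using c_cosh[of u] that by simp
      from DERIV_cmult[OF DERIV_chain2[OF arcosh_real_has_field_derivative[OF this] d]]
      show ?thesis .
    qed
    show "inj_on ?g {0<..}"
    proof (rule inj_onI)
      fix u w assume uw: "u \<in> {0<..}" "w \<in> {0<..}" "?g u = ?g w"
      then have "arcosh (c * cosh u) = arcosh (c * cosh w)" using st by simp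
      moreover have "cosh (arcosh (c * cosh u)) = c * cosh u" "cosh (arcosh (c * cosh w)) = c * cosh w"
        using c_cosh[of u] c_cosh[of w] uw by (auto intro!: cosh_arcosh_real)
      ultimately have "c * cosh u = c * cosh w" by metis
      then show "u = w" using uw c by simp
    qed
    show "0 \<le> ?f x" if "x \<in> ?g ` {0<..}" for x
    proof -
      have "a < sqrt t * x" using that unfolding img by simp
      then show ?thesis using a by (simp add: cosh_real_nonneg_le_iff)
    qed
  qed simp
  also have "(\<integral>\<^sup>+u. ennreal (\<bar>?g' u\<bar> * ?f (?g u)) * indicator {0<..} u \<partial>lborel) = (\<integral>\<^sup>+u. ennreal (K * ?L u) * indicator {0<..} u \<partial>lborel)"
  proof (rule nn_integral_cong)
    fix u
    show "ennreal (\<bar>?g' u\<bar> * ?f (?g u)) * indicator {0<..} u = ennreal (K * ?L u) * indicator {0<..} u"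
    proof (cases "u > 0")
      case True
      show ?thesis unfolding jac[OF True] ..
    qed simp
  qed
  also have "(\<integral>\<^sup>+x. ennreal (?f x) * indicator (?g ` {0<..}) x \<partial>lborel) = (\<integral>\<^sup>+x. ennreal (std_normal_density x) * abel_kernel a (sqrt t * x) \<partial>lborel)"
  proof (rule nn_integral_cong)
    fix x
    have "ennreal (?f x) = ennreal (std_normal_density x)
        * ennreal (sqrt 2 * sinh (sqrt t * x) / sqrt (cosh (sqrt t * x) - cosh a))"
      by (rule ennreal_mult') simp
    then show "ennreal (?f x) * indicator (?g ` {0<..}) x = ennreal (std_normal_density x) * abel_kernel a (sqrt t * x)"
      unfolding img abel_kernel_def
      by (simp only: mult.assoc indicator_def mem_Collect_eq greaterThan_iff)
  qed
  finally show ?thesis unfolding nnK by (simp only: K_def)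
qed

lemma (in bessel) tail_eq_G:
  assumes W: "standard_brownian_motion N W" and t: "t > 0" and a: "a \<ge> 0"
  shows "emeasure M {\<omega> \<in> space M. R t \<omega> > a} = ennreal (G N W (t / 4) ((cosh a - 1) / 4))"
proof -
  let ?y = "(cosh a - 1) / 4" and ?v = "t / 4"
  have v: "?v > 0" and y: "?y \<ge> 0" using t cosh_real_ge_1[of a] by auto
  have "emeasure M {\<omega> \<in> space M. R t \<omega> > a}
     = ennreal (exp (- t / 8)) * (ennreal (2 / (sqrt t * sqrt (2 * pi))) * (\<integral>\<^sup>+x. ennreal (phi_kernel ?v ?y x) \<partial>lborel))"
    unfolding tail_probability[OF t a] abel_integral_eq_phi_kernel[OF t a] ..
  also have "(\<integral>\<^sup>+x. ennreal (phi_kernel ?v ?y x) \<partial>lborel) = ennreal (\<integral>x. phi_kernel ?v ?y x \<partial>lborel)"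
    by (rule nn_integral_eq_integral[OF phi_kernel_integrable[OF v y]]) (simp add: phi_kernel_def)
  also have "ennreal (exp (- t / 8)) * (ennreal (2 / (sqrt t * sqrt (2 * pi))) * ennreal (\<integral>x. phi_kernel ?v ?y x \<partial>lborel))
     = ennreal (exp (- t / 8) * (2 / (sqrt t * sqrt (2 * pi)) * (\<integral>x. phi_kernel ?v ?y x \<partial>lborel)))"
    using t by (simp add: ennreal_mult' flip: ennreal_mult')
  also have "exp (- t / 8) * (2 / (sqrt t * sqrt (2 * pi)) * (\<integral>x. phi_kernel ?v ?y x \<partial>lborel)) = G N W ?v ?y"
  proof -
    have root: "sqrt (2 * pi * ?v) = sqrt t * sqrt (2 * pi) / 2"
    proof -
      have "2 * pi * ?v = t * (2 * pi) / 2\<^sup>2" by simp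
      then show ?thesis
        by (simp only: real_sqrt_divide real_sqrt_mult[of t "2 * pi"] real_sqrt_abs abs_numeral)
    qed
    show ?thesis unfolding G_phi_kernel(2)[OF W v y] root by simp
  qed
  finally show ?thesis .
qed

text \<open>
  By the tail formula the distribution function of \<open>cosh (R t)\<close> at \<open>z\<close> is \<open>1 - G ((z - 1) / 4)\<close>, and 1 is
  the value of \<open>G\<close> at 0; the fundamental theorem of calculus on the interval from 1 to \<open>z\<close> exhibits the
  density on the sets \<open>{..z}\<close>, which generate the Borel sets.
\<close>

theorem proposition2p13:
  fixes M :: "'a measure" and F :: "real \<Rightarrow> 'a measure" and B R :: "real \<Rightarrow> 'a \<Rightarrow> real"
    and N :: "'b measure" and W :: "real \<Rightarrow> 'b \<Rightarrow> real" and t :: real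
  assumes "hyperbolic_bessel_0 M F B R"
    and "standard_brownian_motion N W"
    and "t > 0"
  shows "(\<forall>y\<ge>0. integrable N (G_integrand W (t / 4) y)) \<and>
         (\<forall>y\<ge>0. G N W (t / 4) differentiable (at y within {0..})) \<and>
         (\<forall>y\<ge>0. G_deriv N W (t / 4) y \<le> 0) \<and>
         distributed M lborel (\<lambda>\<omega>. cosh (R t \<omega>))
           (\<lambda>z. ennreal (if 1 \<le> z then - (1 / 4) * G_deriv N W (t / 4) ((z - 1) / 4) else 0))"
proof -
  interpret bessel M F B R using assms(1) by unfold_locales
  note W = assms(2) and t = assms(3)
  define v where "v = t / 4"
  have v: "v > 0" using t by (simp add: v_def)
  define k where "k = exp (- v / 2) / sqrt (2 * pi * v)"
  have k: "k > 0" using v by (simp add: k_def)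
  have Gd: "G_deriv N W v y = - (k * (\<integral>x. phi_slope v y x \<partial>lborel))" if "y \<ge> 0" for y
    unfolding k_def by (rule G_deriv_eq[OF W v that])
  have dG: "(G N W v has_real_derivative G_deriv N W v y) (at y within {0..})" if "y \<ge> 0" for y
    using DERIV_G[OF W v that] unfolding Gd[OF that] k_def .
  have slope0: "(\<integral>x. phi_slope v y x \<partial>lborel) \<ge> 0" if "y \<ge> 0" for y
    using phi_slope_bounds(1)[OF v that] by (intro integral_nonneg_AE) auto
  have Gd0: "G_deriv N W v y \<le> 0" if "y \<ge> 0" for y
    unfolding Gd[OF that] using slope0[OF that] k by simp
  define d where "d z = (if 1 \<le> z then - (1 / 4) * G_deriv N W v ((z - 1) / 4) else 0)" for z
  have d0: "d z \<ge> 0" for z using Gd0[of "(z - 1) / 4"] by (simp add: d_def)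
  have d_meas [measurable]: "d \<in> borel_measurable borel"
  proof -
    have "d = (\<lambda>z. if 1 \<le> z then k / 4 * (\<integral>x. phi_slope v ((z - 1) / 4) x \<partial>lborel) else 0)"
      by (auto simp: d_def Gd)
    moreover have "(\<lambda>z. if 1 \<le> z then k / 4 * (\<integral>x. phi_slope v ((z - 1) / 4) x \<partial>lborel) else 0) \<in> borel_measurable borel"
      by measurable
    ultimately show ?thesis by simp
  qed
  have Rm [measurable]: "R t \<in> borel_measurable M" using t by (intro R_measurable) simp
  have Xm: "(\<lambda>\<omega>. cosh (R t \<omega>)) \<in> borel_measurable M" by measurable
  have "distributed M lborel (\<lambda>\<omega>. cosh (R t \<omega>)) d"
  proof (rule distributedI_real[where E = "range (\<lambda>z :: real. {..z})" and A = "\<lambda>i :: nat. {..real i}"])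
    show "sets (lborel :: real measure) = sigma_sets (space lborel) (range (\<lambda>z. {..z}))"
      by (simp add: borel_eq_atMost)
    show "Int_stable (range (\<lambda>z :: real. {..z}))" by (auto simp: Int_stable_def)
    show "(\<Union>i. {..real i}) = space lborel" using real_arch_simple by auto
    show "emeasure (distr M lborel (\<lambda>\<omega>. cosh (R t \<omega>))) {..real i} \<noteq> \<infinity>" for i
      using Xm by (simp add: emeasure_distr)
    fix A :: "real set" assume "A \<in> range (\<lambda>z. {..z})"
    then obtain z where A: "A = {..z}" by auto
    have "emeasure M ((\<lambda>\<omega>. cosh (R t \<omega>)) -` A \<inter> space M) = (\<integral>\<^sup>+x. ennreal (d x) * indicator A x \<partial>lborel)"
    proof (cases "z \<ge> 1")
      case False
      then have "\<not> cosh (R t \<omega>) \<le> z" for \<omega> using cosh_real_ge_1[of "R t \<omega>"] by linarith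
      then have "(\<lambda>\<omega>. cosh (R t \<omega>)) -` A \<inter> space M = {}" by (auto simp: A)
      moreover have "(\<lambda>x. ennreal (d x) * indicator A x) = (\<lambda>x. 0)"
        using False by (auto simp: A d_def indicator_def)
      ultimately show ?thesis by simp
    next
      case True
      define a where "a = arcosh z"
      have a: "a \<ge> 0" "cosh a = z" using True by (simp_all add: a_def)
      let ?y = "\<lambda>z :: real. (z - 1) / 4"
      have y: "?y z \<ge> 0" using True by simp
      have G0: "G N W v (?y z) \<ge> 0"
        unfolding G_phi_kernel(2)[OF W v y] using v
        by (intro mult_nonneg_nonneg Bochner_Integration.integral_nonneg) (simp_all add: phi_kernel_def)
      have "measure M {\<omega> \<in> space M. R t \<omega> > a} = G N W v (?y z)"
        using tail_eq_G[OF W t a(1)] G0 by (simp add: measure_def v_def a)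
      moreover have "measure M {\<omega> \<in> space M. \<not> R t \<omega> > a} = 1 - measure M {\<omega> \<in> space M. R t \<omega> > a}"
        by (rule prob_neg) measurable
      moreover have "emeasure M ((\<lambda>\<omega>. cosh (R t \<omega>)) -` A \<inter> space M) = emeasure M {\<omega> \<in> space M. \<not> R t \<omega> > a}"
      proof (rule emeasure_eq_AE)
        have "AE \<omega> in M. R t \<omega> \<ge> 0" using t by (intro AE_R_nonneg) simp
        then show "AE \<omega> in M. \<omega> \<in> (\<lambda>\<omega>. cosh (R t \<omega>)) -` A \<inter> space M \<longleftrightarrow> \<omega> \<in> {\<omega> \<in> space M. \<not> R t \<omega> > a}"
        proof eventually_elim
          case (elim \<omega>)
          have "cosh (R t \<omega>) \<le> z \<longleftrightarrow> R t \<omega> \<le> a"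
            using cosh_real_nonneg_le_iff[OF elim a(1)] a(2) by simp
          then show ?case by (auto simp: A)
        qed
      qed (use Xm in \<open>auto simp: A intro!: measurable_sets[OF Xm]\<close>)
      ultimately have lhs: "emeasure M ((\<lambda>\<omega>. cosh (R t \<omega>)) -` A \<inter> space M) = ennreal (1 - G N W v (?y z))"
        by (simp add: emeasure_eq_measure)
      have "(d has_integral - G N W v (?y z) - - G N W v (?y 1)) {1..z}"
      proof (rule fundamental_theorem_of_calculus[OF True])
        fix x assume x: "x \<in> {1..z}"
        have "((\<lambda>x. G N W v (?y x)) has_real_derivative G_deriv N W v (?y x) * (1 / 4)) (at x within {1..z})"
        proof (rule DERIV_image_chain[unfolded comp_def, where f = "G N W v" and g = ?y])
          show "(?y has_real_derivative 1 / 4) (at x within {1..z})" by (auto intro!: derivative_eq_intros)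
          show "(G N W v has_real_derivative G_deriv N W v (?y x)) (at (?y x) within ?y ` {1..z})"
            using x by (intro DERIV_subset[OF dG]) auto
        qed
        from DERIV_minus[OF this]
        show "((\<lambda>x. - G N W v (?y x)) has_vector_derivative d x) (at x within {1..z})"
          using x by (simp add: d_def has_real_derivative_iff_has_vector_derivative mult.commute)
      qed
      then have "(d has_integral 1 - G N W v (?y z)) {1..z}"
        using G_0[OF W v] by simp
      from nn_integral_has_integral_lebesgue'[OF d0 this]
      have "(\<integral>\<^sup>+x. ennreal (d x) * indicator {1..z} x \<partial>lborel) = ennreal (1 - G N W v (?y z))" .
      moreover have "(\<integral>\<^sup>+x. ennreal (d x) * indicator A x \<partial>lborel) = (\<integral>\<^sup>+x. ennreal (d x) * indicator {1..z} x \<partial>lborel)"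
        by (intro nn_integral_cong) (auto simp: A d_def indicator_def)
      ultimately show ?thesis using lhs by simp
    qed
    also have "\<dots> = (\<integral>\<^sup>+x. ennreal (d x * indicator A x) \<partial>lborel)"
      by (intro nn_integral_cong) (auto simp: indicator_def)
    finally show "emeasure M ((\<lambda>\<omega>. cosh (R t \<omega>)) -` A \<inter> space M) = (\<integral>\<^sup>+x. ennreal (d x * indicator A x) \<partial>lborel)" .
  qed (use Xm d0 in auto)
  then have "distributed M lborel (\<lambda>\<omega>. cosh (R t \<omega>))
      (\<lambda>z. ennreal (if 1 \<le> z then - (1 / 4) * G_deriv N W (t / 4) ((z - 1) / 4) else 0))"
    unfolding d_def v_def .
  moreover have "\<forall>y\<ge>0. integrable N (G_integrand W (t / 4) y)"
    using G_phi_kernel(1)[OF W v] by (simp add: v_def)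
  moreover have "\<forall>y\<ge>0. G N W (t / 4) differentiable (at y within {0..})"
    using dG by (auto simp: v_def differentiable_def has_field_derivative_def)
  moreover have "\<forall>y\<ge>0. G_deriv N W (t / 4) y \<le> 0"
    using Gd0 by (simp add: v_def)
  ultimately show ?thesis by blast
qed

end
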